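(* Let $K_0$ be a Hilbertian field of characteristic $\neq 2$ and let $K/K_0$ be a prosolvable (separable algebraic) extension. Then every non-degenerate quadratic form over $K$ of dimension $>4$ is isomorphic (over $K$) to a scaled trace form over $K$.
   Context: A field $K_0$ is Hilbertian if for any irreducible polynomial $f(T,X)$ over $K_0(T)$ (i.e. irreducible as a polynomial in $X$ over $K_0(T)$) there exist infinitely many $a\in K_0$ for which $f(a,X)$ is irreducible over $K_0$. A separable algebraic extension $K/K_0$ is called prosolvable if for every finite subextension $L_0/K_0$ (with $L_0\subseteq K$) the Galois group of the Galois closure of $L_0/K_0$ is solvable. A scaled trace form over $K$ is a quadratic form of the shape $x\mapsto \mathrm{Tr}_{F/K}(\alpha x^2)$, $x\in F$, where $F/K$ is a finite separable field extension and $\alpha\in F$ is nonzero; it is a quadratic form over $K$ of dimension $[F:K]$. *)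

theory Defs
  imports
    "HOL-Algebra.Algebraic_Closure_Type"
    "HOL-Algebra.Bij"
    "HOL-Algebra.Solvable_Groups"
begin

section \<open>Hilbertian fields\<close>

text \<open>
  The field of rational functions in \<open>T\<close> over the field \<open>'a\<close> is \<open>'a poly fract\<close>.  A rational
  function is defined at \<open>a\<close> if it has a representation whose denominator does not vanish at \<open>a\<close>.
\<close>

definition ratfun_defined_at :: "'a::field poly fract \<Rightarrow> 'a \<Rightarrow> bool" where
  "ratfun_defined_at r a \<longleftrightarrow> (\<exists>p q. r = Fraction_Field.Fract p q \<and> poly q a \<noteq> 0)"

definition ratfun_eval :: "'a::field poly fract \<Rightarrow> 'a \<Rightarrow> 'a" where
  "ratfun_eval r a =
     (THE c. \<exists>p q. r = Fraction_Field.Fract p q \<and> poly q a \<noteq> 0 \<and> c = poly p a / poly q a)"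

lemma ratfun_eval_Fract:
  assumes "poly q a \<noteq> 0"
  shows "ratfun_eval (Fraction_Field.Fract p q) a = poly p a / poly q a"
  unfolding ratfun_eval_def
proof (rule the_equality)
  show "\<exists>p' q'. Fraction_Field.Fract p q = Fraction_Field.Fract p' q' \<and> poly q' a \<noteq> 0 \<and>
          poly p a / poly q a = poly p' a / poly q' a"
    using assms by blast
next
  fix c
  assume "\<exists>p' q'. Fraction_Field.Fract p q = Fraction_Field.Fract p' q' \<and> poly q' a \<noteq> 0 \<and>
            c = poly p' a / poly q' a"
  then obtain p' q' where *: "Fraction_Field.Fract p q = Fraction_Field.Fract p' q'"
    "poly q' a \<noteq> 0" "c = poly p' a / poly q' a"
    by blast
  have "q \<noteq> 0" "q' \<noteq> 0"
    using assms *(2) by auto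
  with *(1) have "p * q' = p' * q"
    by (simp add: eq_fract)
  then have "poly p a * poly q' a = poly p' a * poly q a"
    by (metis poly_mult)
  with assms *(2) show "c = poly p a / poly q a"
    unfolding *(3) by (simp add: frac_eq_eq)
qed

text \<open>
  The polynomial \<open>f(T,X)\<close> has coefficients in the rational function field, so \<open>f(a,X)\<close> only makes
  sense at those \<open>a\<close> where all coefficients are defined; this excludes finitely many \<open>a\<close>.
\<close>

definition hilbertian :: "'a::field itself \<Rightarrow> bool" where
  "hilbertian (_ :: 'a itself) \<longleftrightarrow>
     (\<forall>f :: 'a poly fract poly. Factorial_Ring.irreducible f \<longrightarrow>
        infinite {a :: 'a. (\<forall>i. ratfun_defined_at (poly.coeff f i) a) \<and>
                           Factorial_Ring.irreducible (map_poly (\<lambda>r. ratfun_eval r a) f)})"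


section \<open>Field extensions\<close>

text \<open>
  An extension of the field \<open>'a\<close> is given by a ring homomorphism \<open>j :: 'a \<Rightarrow> 'b\<close> into a
  field \<open>'b\<close> (necessarily injective) together with a subfield of \<open>'b\<close> containing its range.
\<close>

definition field_embedding :: "('a::field \<Rightarrow> 'b::field) \<Rightarrow> bool" where
  "field_embedding j \<longleftrightarrow> j \<in> ring_hom ring_of_type_algebra ring_of_type_algebra"

definition ext_scale :: "('a::field \<Rightarrow> 'b::field) \<Rightarrow> 'a \<Rightarrow> 'b \<Rightarrow> 'b" where
  "ext_scale j c x = j c * x"

lemma field_embedding_iff:
  "field_embedding j \<longleftrightarrow>
     j 1 = 1 \<and> (\<forall>x y. j (x + y) = j x + j y) \<and> (\<forall>x y. j (x * y) = j x * j y)"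
  by (auto simp: field_embedding_def ring_hom_def ring_of_type_algebra_def)

lemma vector_space_ext_scale: "field_embedding j \<Longrightarrow> vector_space (ext_scale j)"
  by unfold_locales (auto simp: field_embedding_iff ext_scale_def algebra_simps)

lemma field_embedding_to_ac: "field_embedding (to_ac :: 'a::field \<Rightarrow> 'a alg_closure)"
  by (auto simp: field_embedding_iff)

definition intermediate_field :: "('a::field \<Rightarrow> 'b::field) \<Rightarrow> 'b set \<Rightarrow> bool" where
  "intermediate_field j L \<longleftrightarrow> subfield L ring_of_type_algebra \<and> range j \<subseteq> L"

definition finite_extension :: "('a::field \<Rightarrow> 'b::field) \<Rightarrow> 'b set \<Rightarrow> bool" where
  "finite_extension j L \<longleftrightarrow>
     intermediate_field j L \<and> (\<exists>B. finite B \<and> Modules.module.span (ext_scale j) B = L)"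

definition separable_poly :: "'a::field poly \<Rightarrow> bool" where
  "separable_poly p \<longleftrightarrow> rsquarefree (map_poly to_ac p)"

definition separable_extension :: "('a::field \<Rightarrow> 'b::field) \<Rightarrow> 'b set \<Rightarrow> bool" where
  "separable_extension j L \<longleftrightarrow>
     intermediate_field j L \<and>
     (\<forall>x\<in>L. \<exists>p. Factorial_Ring.irreducible p \<and> poly (map_poly j p) x = 0 \<and> separable_poly p)"

definition splits_in :: "'b::field poly \<Rightarrow> 'b set \<Rightarrow> bool" where
  "splits_in p N \<longleftrightarrow> (\<exists>c rs. set rs \<subseteq> N \<and> p = smult c (\<Prod>r\<leftarrow>rs. [:- r, 1:]))"

definition galois_extension :: "('a::field \<Rightarrow> 'b::field) \<Rightarrow> 'b set \<Rightarrow> bool" where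
  "galois_extension j N \<longleftrightarrow>
     separable_extension j N \<and>
     (\<forall>p. Factorial_Ring.irreducible p \<and> (\<exists>x\<in>N. poly (map_poly j p) x = 0) \<longrightarrow>
          splits_in (map_poly j p) N)"

text \<open>
  The Galois closure is formed inside the ambient field \<open>'b\<close>.  It is the expected object when
  \<open>'b\<close> is algebraically closed and \<open>L\<close> is separable over \<open>'a\<close>.
\<close>

definition galois_closure :: "('a::field \<Rightarrow> 'b::field) \<Rightarrow> 'b set \<Rightarrow> 'b set" where
  "galois_closure j L = \<Inter> {N. galois_extension j N \<and> L \<subseteq> N}"

text \<open>Automorphisms are extensional functions on \<open>N\<close>, multiplied by composition.\<close>

definition galois_group :: "('a::field \<Rightarrow> 'b::field) \<Rightarrow> 'b set \<Rightarrow> ('b \<Rightarrow> 'b) monoid" where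
  "galois_group j N = (BijGroup N)
     \<lparr>carrier := {h \<in> Bij N.
        h \<in> ring_hom (ring_of_type_algebra\<lparr>carrier := N\<rparr>) (ring_of_type_algebra\<lparr>carrier := N\<rparr>) \<and>
        (\<forall>c. h (j c) = j c)}\<rparr>"

definition prosolvable :: "('a::field \<Rightarrow> 'b::field) \<Rightarrow> bool" where
  "prosolvable \<iota> \<longleftrightarrow>
     separable_extension \<iota> UNIV \<and>
     (\<forall>L. finite_extension \<iota> L \<longrightarrow>
        solvable (galois_group (to_ac \<circ> \<iota>) (galois_closure (to_ac \<circ> \<iota>) (to_ac ` L))))"


section \<open>Quadratic forms and scaled trace forms\<close>

definition polar_form :: "('v::ab_group_add \<Rightarrow> 'k::field) \<Rightarrow> 'v \<Rightarrow> 'v \<Rightarrow> 'k" where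
  "polar_form q u v = q (u + v) - q u - q v"

text \<open>Linearity in the first argument follows from symmetry of the polar form.\<close>

definition quadratic_form ::
  "('k::field \<Rightarrow> 'v::ab_group_add \<Rightarrow> 'v) \<Rightarrow> ('v \<Rightarrow> 'k) \<Rightarrow> bool" where
  "quadratic_form s q \<longleftrightarrow>
     (\<forall>c v. q (s c v) = c\<^sup>2 * q v) \<and>
     (\<forall>u. Vector_Spaces.linear s (*) (polar_form q u))"

definition nondegenerate :: "('v::ab_group_add \<Rightarrow> 'k::field) \<Rightarrow> bool" where
  "nondegenerate q \<longleftrightarrow> (\<forall>u. (\<forall>v. polar_form q u v = 0) \<longrightarrow> u = 0)"

text \<open>
  The trace of \<open>x \<in> F\<close> is the trace of the linear map \<open>y \<mapsto> x * y\<close> on \<open>F\<close>, i.e. the sum of the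
  diagonal entries of its matrix with respect to any basis of \<open>F\<close>.
\<close>

definition field_trace :: "('k::field \<Rightarrow> 'b::field) \<Rightarrow> 'b set \<Rightarrow> 'b \<Rightarrow> 'k" where
  "field_trace j F x =
     (let B = (SOME B. \<not> Modules.module.dependent (ext_scale j) B \<and>
                       Modules.module.span (ext_scale j) B = F)
      in \<Sum>b\<in>B. Modules.module.representation (ext_scale j) B (x * b) b)"

definition scaled_trace_form :: "('k::field \<Rightarrow> 'b::field) \<Rightarrow> 'b set \<Rightarrow> 'b \<Rightarrow> 'b \<Rightarrow> 'k" where
  "scaled_trace_form j F \<alpha> x = field_trace j F (\<alpha> * x\<^sup>2)"

text \<open>
  Every finite extension of \<open>'k\<close> is isomorphic over \<open>'k\<close> to a subfield of the algebraic closure of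
  \<open>'k\<close>, so it suffices to let \<open>F\<close> range over such subfields.
\<close>

definition isomorphic_to_scaled_trace_form ::
  "('k::field \<Rightarrow> 'v::ab_group_add \<Rightarrow> 'v) \<Rightarrow> ('v \<Rightarrow> 'k) \<Rightarrow> bool" where
  "isomorphic_to_scaled_trace_form s q \<longleftrightarrow>
     (\<exists>(F :: 'k alg_closure set) \<alpha> \<phi>.
        finite_extension to_ac F \<and> separable_extension to_ac F \<and> \<alpha> \<in> F \<and> \<alpha> \<noteq> 0 \<and>
        Vector_Spaces.linear s (ext_scale to_ac) \<phi> \<and> bij_betw \<phi> UNIV F \<and>
        (\<forall>v. scaled_trace_form to_ac F \<alpha> (\<phi> v) = q v))"

end

theory Submission
  imports Defs "HOL-Combinatorics.Permutations"
begin

text \<open>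
  The form is diagonal, \<open>\<langle>h\<^sub>0, \<dots>, h\<^sub>n\<^sub>-\<^sub>1\<rangle>\<close>.  For arbitrary \<open>a\<^sub>0, \<dots>, a\<^sub>n\<^sub>-\<^sub>1\<close> it is carried by the
  algebra \<open>K[X]/(f\<^sub>n)\<close>, where \<open>f\<^sub>k\<^sub>+\<^sub>1 = (X - a\<^sub>k) f\<^sub>k - (h\<^sub>k / h\<^sub>k\<^sub>-\<^sub>1) f\<^sub>k\<^sub>-\<^sub>1\<close>: the \<open>f\<^sub>k\<close> with \<open>k < n\<close> are an
  orthogonal basis, multiplication by \<open>X\<close> is self-adjoint, and by the Christoffel--Darboux identity
  the form is \<open>Tr(\<alpha> x\<^sup>2)\<close> with \<open>\<alpha>\<^sup>-\<^sup>1 = \<Sum> f\<^sub>k\<^sup>2 / h\<^sub>k\<close>.  It remains to choose the \<open>a\<^sub>k\<close> so that \<open>f\<^sub>n\<close> is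
  irreducible over \<open>K\<close>.

  The coefficients \<open>h\<^sub>k / h\<^sub>k\<^sub>-\<^sub>1\<close> lie in a finite extension \<open>L\<close> of \<open>K\<^sub>0\<close>.  The \<open>a\<^sub>k \<in> K\<^sub>0\<close> are chosen one
  after the other such that \<open>f\<^sub>k\<close> has the full symmetric group over \<open>L\<close>.  If \<open>f\<close> and \<open>g\<close> are two
  consecutive polynomials, all roots of \<open>(X - T) f - g\<close> are transcendental over \<open>L\<close> and \<open>T\<close> is the same
  rational function \<open>X - g/f\<close> of each of them, so the Galois group over \<open>L(T)\<close> is transitive.  At \<open>T = \<infinity>\<close>
  one root goes to \<open>\<infinity>\<close> and the others to the roots of \<open>f\<close>, so the stabilizer of one root induces the
  full symmetric group on the others.  The Hilbert property, applied to the minimal polynomial of a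
  primitive element of the splitting field over \<open>K\<^sub>0(T)\<close>, gives a value of \<open>T\<close> that preserves the group.

  Finally, for \<open>n > 4\<close> every 3-cycle is a commutator of 3-cycles, hence is induced by arbitrarily deep
  iterated commutators of automorphisms.  These fix the Galois closure of any finite
  subextension of \<open>K/K\<^sub>0\<close>, so the roots of \<open>f\<^sub>n\<close> remain conjugate over \<open>K\<close>.
\<close>

section \<open>Subfields as sets\<close>

text \<open>The field \<open>K\<close> need not be Hilbertian: over a field closed under square
  roots every specialization of \<open>X^2 - T\<close> is reducible. So the parameters are
  specialized over \<open>K_0\<close> alone, and irreducibility over \<open>K\<close> is gained
  afterwards from group theory, since solvable quotients do not see the alternating group. For this
  the induction has to control the whole Galois group of each intermediate polynomial, and not just
  its irreducibility. The polynomials are characteristic polynomials of tridiagonal matrices that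
  are self-adjoint for the given form. The form dictates the off-diagonal data, the diagonal is
  free, and each step involves one new diagonal entry, linearly, as suits a pencil in one variable
  \<open>T\<close>. Finite Galois theory is replaced by one extension theorem: homomorphisms are
  prolonged to a maximal domain by Zorn's lemma, and Galois groups appear as automorphisms of an
  algebraically closed field. Laurent series in \<open>1/T\<close> make the behaviour at infinity
  concrete, since automorphisms of the constants act on their coefficients.\<close>

definition subring_set :: "'w::field set \<Rightarrow> bool" where
  "subring_set A \<longleftrightarrow> 0 \<in> A \<and> 1 \<in> A \<and> (\<forall>x\<in>A. - x \<in> A) \<and> (\<forall>x\<in>A. \<forall>y\<in>A. x + y \<in> A \<and> x * y \<in> A)"

definition subfield_set :: "'w::field set \<Rightarrow> bool" where
  "subfield_set E \<longleftrightarrow> subring_set E \<and> (\<forall>x\<in>E. inverse x \<in> E)"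

definition polys_over :: "'w::field set \<Rightarrow> 'w poly set" where
  "polys_over A = {p. \<forall>i. coeff p i \<in> A}"

text \<open>Homomorphisms are total functions that are constrained only on \<open>A\<close>, so maps
  with growing domains have one type and can be compared on a common part. That
  \<open>\<tau> 0 = 0\<close> follows by cancellation once \<open>A\<close> is a subring.\<close>

definition ring_hom_on :: "'w::field set \<Rightarrow> ('w \<Rightarrow> 'u::field) \<Rightarrow> bool" where
  "ring_hom_on A \<tau> \<longleftrightarrow> \<tau> 1 = 1 \<and>
     (\<forall>x\<in>A. \<forall>y\<in>A. \<tau> (x + y) = \<tau> x + \<tau> y \<and> \<tau> (x * y) = \<tau> x * \<tau> y)"

lemma subfield_set_imp_subring: "subfield_set E \<Longrightarrow> subring_set E"
  by (simp add: subfield_set_def)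

lemma subring_setD:
  assumes "subring_set A"
  shows "0 \<in> A" "1 \<in> A" "x \<in> A \<Longrightarrow> - x \<in> A" "x \<in> A \<Longrightarrow> y \<in> A \<Longrightarrow> x + y \<in> A"
    "x \<in> A \<Longrightarrow> y \<in> A \<Longrightarrow> x - y \<in> A" "x \<in> A \<Longrightarrow> y \<in> A \<Longrightarrow> x * y \<in> A"
    "x \<in> A \<Longrightarrow> x ^ n \<in> A"
proof -
  show [simp]: "0 \<in> A" "1 \<in> A" and *: "x \<in> A \<Longrightarrow> - x \<in> A" "x \<in> A \<Longrightarrow> y \<in> A \<Longrightarrow> x + y \<in> A"
    "x \<in> A \<Longrightarrow> y \<in> A \<Longrightarrow> x * y \<in> A" for x y
    using assms by (auto simp: subring_set_def)
  show "x - y \<in> A" if "x \<in> A" "y \<in> A" for x y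
    using *(2)[of "x" "-y"] *(1)[of y] that by simp
  show "x ^ n \<in> A" if "x \<in> A"
    using that by (induction n) (auto intro: *)
qed

lemma subring_set_sum:
  assumes "subring_set A" "\<And>i. i \<in> I \<Longrightarrow> f i \<in> A"
  shows "sum f I \<in> A"
  using assms(2) by (induction I rule: infinite_finite_induct) (auto intro: subring_setD[OF assms(1)])

lemma subfield_setD:
  assumes "subfield_set E"
  shows "x \<in> E \<Longrightarrow> inverse x \<in> E" "x \<in> E \<Longrightarrow> y \<in> E \<Longrightarrow> x / y \<in> E"
proof -
  show *: "x \<in> E \<Longrightarrow> inverse x \<in> E" for x using assms by (auto simp: subfield_set_def)
  show "x \<in> E \<Longrightarrow> y \<in> E \<Longrightarrow> x / y \<in> E"
    using assms *[of y] subring_setD(6)[of E x "inverse y"] by (simp add: divide_inverse subfield_set_def)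
qed

lemma polys_overD: "p \<in> polys_over A \<Longrightarrow> coeff p i \<in> A"
  by (simp add: polys_over_def)

lemma polys_over_mono: "A \<subseteq> B \<Longrightarrow> polys_over A \<subseteq> polys_over B"
  by (auto simp: polys_over_def)

context
  fixes A :: "'w::field set"
  assumes A: "subring_set A"
begin

lemma polys_over_0: "0 \<in> polys_over A" and polys_over_1: "1 \<in> polys_over A"
  using subring_setD[OF A] by (auto simp: polys_over_def coeff_1)

lemma polys_over_pCons: "pCons a p \<in> polys_over A \<longleftrightarrow> a \<in> A \<and> p \<in> polys_over A"
proof
  assume p: "pCons a p \<in> polys_over A"
  show "a \<in> A \<and> p \<in> polys_over A"
    using p[THEN polys_overD, of 0] p[THEN polys_overD, of "Suc _"] by (auto simp: polys_over_def)
qed (auto simp: polys_over_def coeff_pCons split: nat.splits)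

lemma polys_over_add: "p \<in> polys_over A \<Longrightarrow> q \<in> polys_over A \<Longrightarrow> p + q \<in> polys_over A"
  and polys_over_uminus: "p \<in> polys_over A \<Longrightarrow> - p \<in> polys_over A"
  and polys_over_diff: "p \<in> polys_over A \<Longrightarrow> q \<in> polys_over A \<Longrightarrow> p - q \<in> polys_over A"
  and polys_over_smult: "a \<in> A \<Longrightarrow> p \<in> polys_over A \<Longrightarrow> smult a p \<in> polys_over A"
  and polys_over_mult: "p \<in> polys_over A \<Longrightarrow> q \<in> polys_over A \<Longrightarrow> p * q \<in> polys_over A"
  and polys_over_monom: "a \<in> A \<Longrightarrow> monom a n \<in> polys_over A"
  using subring_setD[OF A]
  by (auto simp: polys_over_def coeff_mult intro!: subring_set_sum[OF A])

lemma polys_over_prod: "(\<And>i. i \<in> I \<Longrightarrow> f i \<in> polys_over A) \<Longrightarrow> prod f I \<in> polys_over A"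
  by (induction I rule: infinite_finite_induct) (auto simp: polys_over_1 intro: polys_over_mult)

lemma polys_over_pcompose: "p \<in> polys_over A \<Longrightarrow> q \<in> polys_over A \<Longrightarrow> pcompose p q \<in> polys_over A"
  by (induction p) (auto simp: polys_over_0 polys_over_pCons pcompose_pCons
      intro!: polys_over_add polys_over_mult)

lemma poly_in_subring: "p \<in> polys_over A \<Longrightarrow> x \<in> A \<Longrightarrow> poly p x \<in> A"
  by (induction p) (auto simp: polys_over_pCons subring_setD[OF A])

text \<open>Division by a monic polynomial works over any subring. The rings in view are those of
  finite dimension over a subfield and the ring of rational functions defined at a point.\<close>

lemma monic_division:
  assumes m: "m \<in> polys_over A" "lead_coeff m = 1" and "p \<in> polys_over A"
  shows "\<exists>q\<in>polys_over A. \<exists>r\<in>polys_over A. p = q * m + r \<and> (r = 0 \<or> degree r < degree m)"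
  using assms(3)
proof (induction "degree p" arbitrary: p rule: less_induct)
  case less
  consider "p = 0 \<or> degree p < degree m" | "p \<noteq> 0" "degree p \<ge> degree m" by linarith
  then show ?case
  proof cases
    case 1
    then show ?thesis
      using less.prems by (intro bexI[of _ 0] bexI[of _ p]) (auto simp: polys_over_0)
  next
    case 2
    have m0: "m \<noteq> 0" using m(2) by auto
    define c where "c = monom (lead_coeff p) (degree p - degree m)"
    have cA: "c \<in> polys_over A"
      unfolding c_def using less.prems by (intro polys_over_monom polys_overD)
    have c0: "c \<noteq> 0" using 2 by (auto simp: c_def monom_eq_0_iff)
    define p' where "p' = p - c * m"
    have p'A: "p' \<in> polys_over A"
      unfolding p'_def using less.prems cA m by (intro polys_over_diff polys_over_mult)
    have dc: "degree (c * m) = degree p"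
      using 2 m0 c0 by (simp add: degree_mult_eq c_def degree_monom_eq)
    have lc: "coeff (c * m) (degree p) = lead_coeff p"
      using lead_coeff_mult[of c m] m(2) unfolding dc by (simp add: c_def degree_monom_eq 2)
    \<comment> \<open>A constant \<open>p\<close> is treated separately because
      \<open>p' = 0\<close> would not have smaller degree than \<open>p\<close>; in that case
      \<open>m = 1\<close>.\<close>
    show ?thesis
    proof (cases "degree p = 0")
      case True
      then have "degree m = 0" using 2 by simp
      then have "m = 1" using m(2) degree_eq_zeroE[of m] by (metis coeff_pCons_0 one_pCons)
      then show ?thesis
        using less.prems by (intro bexI[of _ p] bexI[of _ 0]) (auto simp: polys_over_0)
    next
      case False
      have "degree p' < degree p"
      proof -
        have "degree p' \<le> degree p"
          unfolding p'_def using dc by (intro degree_diff_le) auto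
        moreover have "coeff p' (degree p) = 0" using lc by (simp add: p'_def)
        ultimately show ?thesis
          using False by (metis degree_0 leading_coeff_0_iff order_le_less)
      qed
      from less.hyps[OF this p'A] obtain q r where qr: "q \<in> polys_over A" "r \<in> polys_over A"
        "p' = q * m + r" "r = 0 \<or> degree r < degree m" by blast
      then have "p = (q + c) * m + r" by (simp add: p'_def algebra_simps)
      with qr cA show ?thesis by (blast intro: polys_over_add)
    qed
  qed
qed

text \<open>Quotient and remainder by a monic polynomial are unique, so the quotient found over the
  whole field is the one found over \<open>A\<close>. This takes the place of Gauss's lemma when
  relations are specialized.\<close>

lemma monic_dvd_over:
  assumes m: "m \<in> polys_over A" "lead_coeff m = 1" and "m * s \<in> polys_over A"
  shows "s \<in> polys_over A"
proof -
  obtain q r where qr: "q \<in> polys_over A" "m * s = q * m + r" "r = 0 \<or> degree r < degree m"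
    using monic_division[OF assms] by blast
  have "m \<noteq> 0" using m by auto
  have r: "r = m * (s - q)" using qr(2) by (simp add: algebra_simps)
  have "s - q = 0"
  proof (rule ccontr)
    assume "s - q \<noteq> 0"
    then have "degree r \<ge> degree m" "r \<noteq> 0"
      using \<open>m \<noteq> 0\<close> unfolding r by (auto simp: degree_mult_eq)
    with qr(3) show False by auto
  qed
  with qr(1) show ?thesis by simp
qed

end

section \<open>Intersections of subfields and the field generated by a set\<close>

lemma polys_over_UNIV [simp]: "polys_over UNIV = UNIV"
  by (auto simp: polys_over_def)

lemma subfield_set_UNIV [simp]: "subfield_set UNIV"
  by (auto simp: subfield_set_def subring_set_def)

lemma subfield_set_Inter: "(\<And>E. E \<in> \<E> \<Longrightarrow> subfield_set E) \<Longrightarrow> subfield_set (\<Inter>\<E>)"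
  by (fastforce simp: subfield_set_def subring_set_def)

definition field_hull :: "'w::field set \<Rightarrow> 'w set" where
  "field_hull S = \<Inter>{E. subfield_set E \<and> S \<subseteq> E}"

lemma subfield_field_hull: "subfield_set (field_hull S)"
  unfolding field_hull_def by (rule subfield_set_Inter) auto

lemma field_hull_superset: "S \<subseteq> field_hull S"
  unfolding field_hull_def by auto

lemma field_hull_minimal: "S \<subseteq> E \<Longrightarrow> subfield_set E \<Longrightarrow> field_hull S \<subseteq> E"
  unfolding field_hull_def by auto

lemma field_hull_mono: "S \<subseteq> S' \<Longrightarrow> field_hull S \<subseteq> field_hull S'"
  by (meson field_hull_minimal field_hull_superset order_trans subfield_field_hull)

section \<open>Minimal polynomials\<close>

definition algebraic_over :: "'w::field set \<Rightarrow> 'w \<Rightarrow> bool" where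
  "algebraic_over E x \<longleftrightarrow> (\<exists>p\<in>polys_over E. p \<noteq> 0 \<and> poly p x = 0)"

lemma min_poly_exists:
  assumes E: "subfield_set E" and x: "algebraic_over E x"
  obtains m where "m \<in> polys_over E" "lead_coeff m = 1" "poly m x = 0"
    "\<And>q. q \<in> polys_over E \<Longrightarrow> poly q x = 0 \<Longrightarrow> \<exists>r\<in>polys_over E. q = r * m"
proof -
  note A = subfield_set_imp_subring[OF E]
  define P where "P = (\<lambda>d. \<exists>m\<in>polys_over E. m \<noteq> 0 \<and> poly m x = 0 \<and> degree m = d)"
  have "\<exists>d. P d" using x unfolding P_def algebraic_over_def by blast
  then have PL: "P (LEAST d. P d)" by (rule LeastI_ex)
  then obtain m0 where m0: "m0 \<in> polys_over E" "m0 \<noteq> 0" "poly m0 x = 0" "degree m0 = (LEAST d. P d)"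
    unfolding P_def by blast
  define m where "m = smult (inverse (lead_coeff m0)) m0"
  have "lead_coeff m0 \<noteq> 0" using m0(2) by (simp only: leading_coeff_0_iff not_False_eq_True)
  then have m: "m \<in> polys_over E" "lead_coeff m = 1" "poly m x = 0" "degree m = (LEAST d. P d)"
    using m0(1,3,4) by (simp_all add: m_def polys_over_smult[OF A] subfield_setD[OF E] polys_overD del: leading_coeff_0_iff)
  show thesis
  proof (rule that[OF m(1-3)])
    fix q assume q: "q \<in> polys_over E" "poly q x = 0"
    obtain s r where sr: "s \<in> polys_over E" "r \<in> polys_over E" "q = s * m + r" "r = 0 \<or> degree r < degree m"
      using monic_division[OF A m(1,2) q(1)] by blast
    have "poly r x = 0" using q sr m by simp
    have "r = 0"
    proof (rule ccontr)
      assume "r \<noteq> 0"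
      with sr \<open>poly r x = 0\<close> have "P (degree r)" unfolding P_def by blast
      then have "(LEAST d. P d) \<le> degree r" by (rule Least_le)
      with sr(4) \<open>r \<noteq> 0\<close> m(4) show False by simp
    qed
    with sr show "\<exists>r\<in>polys_over E. q = r * m" by auto
  qed
qed

text \<open>\<open>E[x]\<close> is a field because dividing the minimal polynomial by
  \<open>p\<close> leaves a remainder of smaller degree whose value at \<open>x\<close> is a
  multiple of \<open>p(x)\<close>; inverting that value by induction inverts
  \<open>p(x)\<close>.\<close>

lemma simple_algebraic_extension:
  assumes E: "subfield_set E" and x: "algebraic_over E x"
  shows "field_hull (insert x E) = {poly p x |p. p \<in> polys_over E}"
proof
  note A = subfield_set_imp_subring[OF E]
  obtain m where m: "m \<in> polys_over E" "lead_coeff m = 1" "poly m x = 0"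
    and dvd: "\<And>q. q \<in> polys_over E \<Longrightarrow> poly q x = 0 \<Longrightarrow> \<exists>r\<in>polys_over E. q = r * m"
    using min_poly_exists[OF E x] by blast
  have m0: "m \<noteq> 0" using m by auto
  have inv: "\<exists>q\<in>polys_over E. poly p x * poly q x = 1" if "p \<in> polys_over E" "poly p x \<noteq> 0" "degree p < degree m" for p
    using that
  proof (induction "degree p" arbitrary: p rule: less_induct)
    case less
    define c where "c = inverse (lead_coeff p)"
    have c: "c \<in> E" "c \<noteq> 0"
      using less.prems by (auto simp: c_def intro!: subfield_setD[OF E] polys_overD)
    define p1 where "p1 = smult c p"
    have p1: "p1 \<in> polys_over E" "lead_coeff p1 = 1" "degree p1 = degree p" "poly p1 x = c * poly p x"
      using c less.prems by (auto simp: p1_def c_def intro!: polys_over_smult[OF A])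
    obtain s r where sr: "s \<in> polys_over E" "r \<in> polys_over E" "m = s * p1 + r" "r = 0 \<or> degree r < degree p1"
      using monic_division[OF A p1(1,2) m(1)] by blast
    show ?case
    proof (cases "degree p = 0")
      case True
      then obtain a where a: "p = [:a:]" by (metis degree_eq_zeroE)
      then show ?thesis
        using less.prems subfield_setD[OF E]
        by (intro bexI[of _ "[:inverse a:]"]) (auto simp: polys_over_pCons[OF A] polys_over_0[OF A])
    next
      case False
      \<comment> \<open>If \<open>r\<close> vanished at \<open>x\<close>, it would be zero, and
        \<open>m = s * p1\<close> would give a polynomial \<open>s\<close> of smaller degree than
        \<open>m\<close> that vanishes at \<open>x\<close>.\<close>
      have "poly r x \<noteq> 0"
      proof
        assume r0: "poly r x = 0"
        have "degree r < degree m" using sr(4) p1 less.prems(3) by auto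
        moreover obtain t where "r = t * m" using dvd[OF sr(2) r0] by blast
        ultimately have "r = 0" using m0 by (metis degree_mult_eq mult_eq_0_iff not_add_less2)
        then have ms: "m = s * p1" using sr by simp
        then have "poly s x = 0" using m(3) p1(4) c(2) less.prems(2) by auto
        then obtain t where t: "s = t * m" using dvd[OF sr(1)] by blast
        have "s \<noteq> 0" "p1 \<noteq> 0" using ms m0 by auto
        then have "degree m = degree s + degree p" using ms p1(3) by (simp add: degree_mult_eq)
        moreover have "degree s \<ge> degree m" using t \<open>s \<noteq> 0\<close> by (auto simp: degree_mult_eq)
        ultimately show False using False by simp
      qed
      then have "r \<noteq> 0" by auto
      with sr(4) p1(3) have dr: "degree r < degree p" by auto
      then obtain q where q: "q \<in> polys_over E" "poly r x * poly q x = 1"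
        using less.hyps[OF dr sr(2) \<open>poly r x \<noteq> 0\<close>] less.prems(3) by force
      have "poly r x = - (poly s x * (c * poly p x))"
        using arg_cong[OF sr(3), of "\<lambda>p. poly p x"] m(3) p1(4) by (simp add: eq_neg_iff_add_eq_0 add.commute)
      with q(2) have "poly p x * poly (smult (- c) (s * q)) x = 1"
        by (simp add: algebra_simps)
      moreover have "smult (- c) (s * q) \<in> polys_over E"
        using c sr q by (intro polys_over_smult[OF A] polys_over_mult[OF A] subring_setD[OF A])
      ultimately show ?thesis by blast
    qed
  qed
  define F where "F = {poly p x |p. p \<in> polys_over E}"
  have "subfield_set F"
    unfolding subfield_set_def subring_set_def
  proof (intro conjI ballI)
    show "0 \<in> F" "1 \<in> F" using polys_over_0[OF A] polys_over_1[OF A] unfolding F_def by force+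
    show "- y \<in> F" if "y \<in> F" for y
      using that polys_over_uminus[OF A] unfolding F_def by (force simp flip: poly_minus)
    show "y + z \<in> F" "y * z \<in> F" if "y \<in> F" "z \<in> F" for y z
      using that polys_over_add[OF A] polys_over_mult[OF A] unfolding F_def
      by (force simp flip: poly_add, force simp flip: poly_mult)
    show "inverse y \<in> F" if yF: "y \<in> F" for y
    proof (cases "y = 0")
      case False
      obtain p where p: "p \<in> polys_over E" "y = poly p x" using yF unfolding F_def by blast
      obtain s r where sr: "s \<in> polys_over E" "r \<in> polys_over E" "p = s * m + r" "r = 0 \<or> degree r < degree m"
        using monic_division[OF A m(1,2) p(1)] by blast
      have y: "y = poly r x" using sr p m by simp
      with False have "r \<noteq> 0" by auto
      then obtain q where q: "q \<in> polys_over E" "poly r x * poly q x = 1"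
        using inv[OF sr(2)] sr(4) y False by auto
      then have "inverse y = poly q x" using y by (simp add: inverse_unique)
      with q show ?thesis unfolding F_def by blast
    qed (use \<open>0 \<in> F\<close> in auto)
  qed
  moreover have "insert x E \<subseteq> F"
  proof -
    have "x = poly [:0, 1:] x" by simp
    moreover have "[:0, 1:] \<in> polys_over E"
      by (simp add: polys_over_pCons[OF A] polys_over_0[OF A] subring_setD[OF A])
    moreover have "y = poly [:y:] x \<and> [:y:] \<in> polys_over E" if "y \<in> E" for y
      using that by (simp add: polys_over_pCons[OF A] polys_over_0[OF A])
    ultimately show ?thesis unfolding F_def by blast
  qed
  ultimately show "field_hull (insert x E) \<subseteq> {poly p x |p. p \<in> polys_over E}"
    unfolding F_def by (intro field_hull_minimal)
  have EH: "insert x E \<subseteq> field_hull (insert x E)" by (rule field_hull_superset)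
  then have "polys_over E \<subseteq> polys_over (field_hull (insert x E))"
    by (intro polys_over_mono) auto
  then show "{poly p x |p. p \<in> polys_over E} \<subseteq> field_hull (insert x E)"
    using EH poly_in_subring[OF subfield_set_imp_subring[OF subfield_field_hull]] by blast
qed

section \<open>Extending field homomorphisms\<close>

lemma ring_hom_onD:
  assumes A: "subring_set A" and \<tau>: "ring_hom_on A \<tau>"
  shows "\<tau> 0 = 0" "\<tau> 1 = 1" "x \<in> A \<Longrightarrow> y \<in> A \<Longrightarrow> \<tau> (x + y) = \<tau> x + \<tau> y"
    "x \<in> A \<Longrightarrow> y \<in> A \<Longrightarrow> \<tau> (x * y) = \<tau> x * \<tau> y" "x \<in> A \<Longrightarrow> \<tau> (- x) = - \<tau> x"
    "x \<in> A \<Longrightarrow> y \<in> A \<Longrightarrow> \<tau> (x - y) = \<tau> x - \<tau> y"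
proof -
  show "\<tau> 1 = 1" and add: "\<And>x y. x \<in> A \<Longrightarrow> y \<in> A \<Longrightarrow> \<tau> (x + y) = \<tau> x + \<tau> y"
    and "\<And>x y. x \<in> A \<Longrightarrow> y \<in> A \<Longrightarrow> \<tau> (x * y) = \<tau> x * \<tau> y"
    using \<tau> by (auto simp: ring_hom_on_def)
  show z: "\<tau> 0 = 0" using add[of 0 0] subring_setD(1)[OF A] by (metis add.right_neutral add_left_imp_eq)
  show neg: "\<tau> (- x) = - \<tau> x" if "x \<in> A" for x
    using add[of x "-x"] that subring_setD[OF A] z by (simp add: add_eq_0_iff)
  show "x \<in> A \<Longrightarrow> y \<in> A \<Longrightarrow> \<tau> (x - y) = \<tau> x - \<tau> y"
    using add[of x "-y"] neg[of y] subring_setD[OF A] by simp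
qed

lemma ring_hom_on_sum:
  assumes A: "subring_set A" and \<tau>: "ring_hom_on A \<tau>" and "\<And>i. i \<in> I \<Longrightarrow> f i \<in> A"
  shows "\<tau> (sum f I) = (\<Sum>i\<in>I. \<tau> (f i))"
  using assms(3)
  by (induction I rule: infinite_finite_induct)
     (auto simp: ring_hom_onD[OF A \<tau>] subring_set_sum[OF A])

lemma ring_hom_on_subset: "ring_hom_on A \<tau> \<Longrightarrow> B \<subseteq> A \<Longrightarrow> ring_hom_on B \<tau>"
  by (auto simp: ring_hom_on_def)

lemma ring_hom_on_inverse:
  assumes E: "subfield_set E" and \<tau>: "ring_hom_on E \<tau>" and x: "x \<in> E"
  shows "\<tau> (inverse x) = inverse (\<tau> x)"
proof (cases "x = 0")
  case False
  note A = subfield_set_imp_subring[OF E]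
  have "\<tau> x * \<tau> (inverse x) = 1"
    using ring_hom_onD(2)[OF A \<tau>] ring_hom_onD(4)[OF A \<tau>, of x "inverse x"] x subfield_setD[OF E] False by auto
  then show ?thesis by (simp add: inverse_unique)
qed (simp add: ring_hom_onD[OF subfield_set_imp_subring[OF E] \<tau>])

lemma ring_hom_on_nonzero:
  assumes E: "subfield_set E" and \<tau>: "ring_hom_on E \<tau>" and x: "x \<in> E" "x \<noteq> 0"
  shows "\<tau> x \<noteq> 0"
proof
  assume "\<tau> x = 0"
  then have "\<tau> (x * inverse x) = 0"
    using ring_hom_onD(4)[OF subfield_set_imp_subring[OF E] \<tau>, of x "inverse x"] x subfield_setD[OF E] by simp
  then show False using x ring_hom_onD(2)[OF subfield_set_imp_subring[OF E] \<tau>] by simp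
qed

lemma ring_hom_on_eq_iff:
  assumes E: "subfield_set E" and \<tau>: "ring_hom_on E \<tau>" and "x \<in> E" "y \<in> E"
  shows "\<tau> x = \<tau> y \<longleftrightarrow> x = y"
  using ring_hom_on_nonzero[OF E \<tau>, of "x - y"] ring_hom_onD(6)[OF subfield_set_imp_subring[OF E] \<tau>, of x y]
    subring_setD(5)[OF subfield_set_imp_subring[OF E], of x y] assms(3,4) by auto

section \<open>Coefficientwise action of a homomorphism on polynomials\<close>

context
  fixes A :: "'w::field set" and \<tau> :: "'w \<Rightarrow> 'u::field"
  assumes A: "subring_set A" and \<tau>: "ring_hom_on A \<tau>"
begin

lemma map_poly_hom_on_0 [simp]: "map_poly \<tau> 0 = 0" and map_poly_hom_on_1: "map_poly \<tau> 1 = 1"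
  by (auto simp: ring_hom_onD[OF A \<tau>] map_poly_1)

lemma coeff_map_poly_hom_on: "coeff (map_poly \<tau> p) i = \<tau> (coeff p i)"
  by (simp add: coeff_map_poly ring_hom_onD[OF A \<tau>])

lemma map_poly_hom_on_add:
  "p \<in> polys_over A \<Longrightarrow> q \<in> polys_over A \<Longrightarrow> map_poly \<tau> (p + q) = map_poly \<tau> p + map_poly \<tau> q"
  by (intro poly_eqI) (auto simp: coeff_map_poly_hom_on ring_hom_onD[OF A \<tau>] polys_over_def)

lemma map_poly_hom_on_diff:
  "p \<in> polys_over A \<Longrightarrow> q \<in> polys_over A \<Longrightarrow> map_poly \<tau> (p - q) = map_poly \<tau> p - map_poly \<tau> q"
  by (intro poly_eqI) (auto simp: coeff_map_poly_hom_on ring_hom_onD[OF A \<tau>] polys_over_def)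

lemma map_poly_hom_on_smult:
  "c \<in> A \<Longrightarrow> p \<in> polys_over A \<Longrightarrow> map_poly \<tau> (smult c p) = smult (\<tau> c) (map_poly \<tau> p)"
  by (intro poly_eqI) (auto simp: coeff_map_poly_hom_on ring_hom_onD[OF A \<tau>] polys_over_def)

lemma map_poly_hom_on_mult:
  "p \<in> polys_over A \<Longrightarrow> q \<in> polys_over A \<Longrightarrow> map_poly \<tau> (p * q) = map_poly \<tau> p * map_poly \<tau> q"
  by (intro poly_eqI)
     (auto simp: coeff_map_poly_hom_on coeff_mult ring_hom_on_sum[OF A \<tau>] ring_hom_onD[OF A \<tau>]
        subring_setD[OF A] polys_over_def)

lemma map_poly_hom_on_prod:
  "(\<And>i. i \<in> I \<Longrightarrow> f i \<in> polys_over A) \<Longrightarrow> map_poly \<tau> (prod f I) = (\<Prod>i\<in>I. map_poly \<tau> (f i))"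
  by (induction I rule: infinite_finite_induct)
     (auto simp: map_poly_hom_on_1 map_poly_hom_on_mult polys_over_prod[OF A])

lemma map_poly_hom_on_pCons: "map_poly \<tau> (pCons a p) = pCons (\<tau> a) (map_poly \<tau> p)"
  by (intro poly_eqI) (auto simp: coeff_map_poly_hom_on coeff_pCons split: nat.splits)

lemma poly_map_poly_hom_on:
  "p \<in> polys_over A \<Longrightarrow> x \<in> A \<Longrightarrow> poly (map_poly \<tau> p) (\<tau> x) = \<tau> (poly p x)"
  by (induction p)
     (auto simp: map_poly_hom_on_pCons polys_over_pCons[OF A] ring_hom_onD[OF A \<tau>]
       poly_in_subring[OF A] subring_setD[OF A])

text \<open>A homomorphism on a ring may kill a leading coefficient, but never the coefficient
  1.\<close>

lemma map_poly_hom_on_monic: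
  assumes "lead_coeff p = 1"
  shows "degree (map_poly \<tau> p) = degree p" "lead_coeff (map_poly \<tau> p) = 1"
proof -
  show "degree (map_poly \<tau> p) = degree p"
    using assms le_degree[of "map_poly \<tau> p" "degree p"] map_poly_degree_leq[of \<tau> p]
    by (simp add: coeff_map_poly_hom_on ring_hom_onD[OF A \<tau>])
  then show "lead_coeff (map_poly \<tau> p) = 1"
    using assms by (simp add: coeff_map_poly_hom_on ring_hom_onD[OF A \<tau>])
qed

end

text \<open>The condition on \<open>x'\<close> says that every relation of \<open>x\<close> over
  \<open>E\<close> survives the application of \<open>\<tau>\<close>, so the value of
  \<open>\<tau>'\<close> does not depend on the polynomial chosen to represent an element.\<close>

lemma hom_extension_to_root:
  assumes E: "subfield_set E" and \<tau>: "ring_hom_on E \<tau>" and x: "algebraic_over E x"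
    and x': "\<And>q. q \<in> polys_over E \<Longrightarrow> poly q x = 0 \<Longrightarrow> poly (map_poly \<tau> q) x' = 0"
  obtains \<tau>' where "ring_hom_on (field_hull (insert x E)) \<tau>'" "\<And>y. y \<in> E \<Longrightarrow> \<tau>' y = \<tau> y" "\<tau>' x = x'"
proof -
  note A = subfield_set_imp_subring[OF E]
  define \<tau>' where "\<tau>' y = poly (map_poly \<tau> (SOME q. q \<in> polys_over E \<and> poly q x = y)) x'" for y
  have \<tau>': "\<tau>' (poly q x) = poly (map_poly \<tau> q) x'" if "q \<in> polys_over E" for q
  proof -
    define r where "r = (SOME r. r \<in> polys_over E \<and> poly r x = poly q x)"
    have r: "r \<in> polys_over E \<and> poly r x = poly q x"
      unfolding r_def by (rule someI[of _ q]) (use that in auto)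
    have "poly (map_poly \<tau> (r - q)) x' = 0"
      using r that by (intro x' polys_over_diff[OF A]) auto
    then show ?thesis
      using r that by (simp add: map_poly_hom_on_diff[OF A \<tau>] \<tau>'_def r_def)
  qed
  have hull: "field_hull (insert x E) = {poly p x |p. p \<in> polys_over E}"
    by (rule simple_algebraic_extension[OF E x])
  show thesis
  proof (rule that[of \<tau>'])
    show "ring_hom_on (field_hull (insert x E)) \<tau>'"
      unfolding ring_hom_on_def hull
    proof (intro conjI ballI)
      show "\<tau>' 1 = 1"
        using \<tau>'[OF polys_over_1[OF A]] by (simp add: map_poly_hom_on_1[OF A \<tau>])
      fix a b assume "a \<in> {poly p x |p. p \<in> polys_over E}" "b \<in> {poly p x |p. p \<in> polys_over E}"
      then obtain p q where pq: "p \<in> polys_over E" "q \<in> polys_over E" "a = poly p x" "b = poly q x" by blast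
      then show "\<tau>' (a + b) = \<tau>' a + \<tau>' b" "\<tau>' (a * b) = \<tau>' a * \<tau>' b"
        using \<tau>'[of "p + q"] \<tau>'[of "p * q"]
        by (simp_all add: \<tau>' map_poly_hom_on_add[OF A \<tau>] map_poly_hom_on_mult[OF A \<tau>]
            polys_over_add[OF A] polys_over_mult[OF A])
    qed
    show "\<tau>' y = \<tau> y" if "y \<in> E" for y
      using that \<tau>'[of "[:y:]"] polys_over_pCons[OF A] polys_over_0[OF A]
      by (simp add: map_poly_hom_on_pCons[OF A \<tau>] ring_hom_onD[OF A \<tau>])
    show "\<tau>' x = x'"
      using \<tau>'[of "[:0, 1:]"] polys_over_pCons[OF A] polys_over_0[OF A] subring_setD[OF A]
      by (simp add: map_poly_hom_on_pCons[OF A \<tau>] ring_hom_onD[OF A \<tau>])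
  qed
qed

text \<open>Expresses that \<open>P\<close> splits without exhibiting a factorization. The condition
  is put on single polynomials because one of the target fields, the Laurent series, is not
  algebraically closed; only polynomials known to split there are handled.\<close>

definition root_closed :: "'u::field poly \<Rightarrow> bool" where
  "root_closed P \<longleftrightarrow> (\<forall>m. m dvd P \<and> degree m > 0 \<longrightarrow> (\<exists>x. poly m x = 0))"

lemma hom_extension_to_split_root:
  assumes E: "subfield_set E" and \<tau>: "ring_hom_on E \<tau>"
    and p: "p \<in> polys_over E" "p \<noteq> 0" "poly p x = 0" "root_closed (map_poly \<tau> p)"
  obtains \<tau>' where "ring_hom_on (field_hull (insert x E)) \<tau>'" "\<And>y. y \<in> E \<Longrightarrow> \<tau>' y = \<tau> y"
proof -
  note A = subfield_set_imp_subring[OF E]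
  have x: "algebraic_over E x" using p unfolding algebraic_over_def by blast
  obtain m where m: "m \<in> polys_over E" "lead_coeff m = 1" "poly m x = 0"
    and dvd: "\<And>q. q \<in> polys_over E \<Longrightarrow> poly q x = 0 \<Longrightarrow> \<exists>r\<in>polys_over E. q = r * m"
    using min_poly_exists[OF E x] by blast
  have dm: "degree m > 0"
  proof (rule ccontr)
    assume "\<not> degree m > 0"
    then obtain a where "m = [:a:]" using degree_eq_zeroE by blast
    with m show False by simp
  qed
  obtain r where "r \<in> polys_over E" "p = r * m" using dvd p by blast
  then have "map_poly \<tau> m dvd map_poly \<tau> p"
    using m map_poly_hom_on_mult[OF A \<tau>] by simp
  moreover have "degree (map_poly \<tau> m) > 0"
    using dm map_poly_hom_on_monic[OF A \<tau> m(2)] by simp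
  ultimately obtain x' where x': "poly (map_poly \<tau> m) x' = 0"
    using p(4) unfolding root_closed_def by blast
  have "poly (map_poly \<tau> q) x' = 0" if q: "q \<in> polys_over E" "poly q x = 0" for q
  proof -
    obtain r where "r \<in> polys_over E" "q = r * m" using dvd[OF q] by blast
    then show ?thesis using m x' map_poly_hom_on_mult[OF A \<tau>] by simp
  qed
  then show thesis
    using hom_extension_to_root[OF E \<tau> x, of x'] that by blast
qed

text \<open>Zorn's lemma, once and for all. The last clause is the interface of the maximal domain:
  an element is shown to lie in \<open>D\<close> by exhibiting a polynomial over \<open>D\<close>
  whose image splits, with no tower of extensions to keep track of.\<close>

theorem hom_extension:
  assumes E: "subfield_set E" and \<tau>0: "ring_hom_on E (\<tau>0 :: 'w::field \<Rightarrow> 'u::field)"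
  obtains D \<tau> where "subfield_set D" "E \<subseteq> D" "ring_hom_on D \<tau>" "\<And>x. x \<in> E \<Longrightarrow> \<tau> x = \<tau>0 x"
    "\<And>p x. p \<in> polys_over D \<Longrightarrow> p \<noteq> 0 \<Longrightarrow> poly p x = 0 \<Longrightarrow> root_closed (map_poly \<tau> p) \<Longrightarrow> x \<in> D"
proof -
  define ok where "ok D \<tau> \<longleftrightarrow> (subfield_set D \<and> E \<subseteq> D \<and> ring_hom_on D \<tau> \<and> (\<forall>x\<in>E. \<tau> x = \<tau>0 x))"
    for D and \<tau> :: "'w \<Rightarrow> 'u"
  \<comment> \<open>The order is inclusion of graphs, which ignores the arbitrary values of
    \<open>\<tau>\<close> outside \<open>D\<close>.\<close>
  define graphs where "graphs = {V. \<exists>D \<tau>. ok D \<tau> \<and> V = (\<lambda>x. (x, \<tau> x)) ` D}"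
  have "\<exists>M\<in>graphs. \<forall>V\<in>graphs. M \<subseteq> V \<longrightarrow> V = M"
  proof (rule subset_Zorn_nonempty)
    have "ok E \<tau>0" using E \<tau>0 by (auto simp: ok_def)
    then show "graphs \<noteq> {}" unfolding graphs_def by blast
  next
    fix C assume C: "C \<noteq> {}" "subset.chain graphs C"
    define U where "U = \<Union>C"
    define D where "D = fst ` U"
    define \<tau> where "\<tau> x = (THE y. (x, y) \<in> U)" for x
    have chain: "V \<subseteq> Y \<or> Y \<subseteq> V" if "V \<in> C" "Y \<in> C" for V Y
      using C that unfolding subset.chain_def by auto
    have CG: "V \<in> graphs" if "V \<in> C" for V using C that unfolding subset.chain_def by auto
    have pair: "\<exists>D' \<tau>'. ok D' \<tau>' \<and> x \<in> D' \<and> y \<in> D' \<and> (\<lambda>x. (x, \<tau>' x)) ` D' \<in> C"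
      if xy: "x \<in> D" "y \<in> D" for x y
    proof -
      obtain V Y where XY: "V \<in> C" "Y \<in> C" "x \<in> fst ` V" "y \<in> fst ` Y"
        using xy unfolding D_def U_def by blast
      then obtain Z where Z: "Z \<in> C" "x \<in> fst ` Z" "y \<in> fst ` Z"
        using chain[OF XY(1,2)] by blast
      obtain D' \<tau>' where "ok D' \<tau>'" "Z = (\<lambda>x. (x, \<tau>' x)) ` D'"
        using CG[OF Z(1)] unfolding graphs_def by blast
      then show ?thesis using Z by (intro exI[of _ D'] exI[of _ \<tau>']) auto
    qed
    have uniq: "z = z'" if zz: "(x, z) \<in> U" "(x, z') \<in> U" for x z z'
    proof -
      obtain V Y where XY: "V \<in> C" "Y \<in> C" "(x, z) \<in> V" "(x, z') \<in> Y"
        using zz unfolding U_def by blast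
      then obtain Z where Z: "Z \<in> C" "(x, z) \<in> Z" "(x, z') \<in> Z"
        using chain[OF XY(1,2)] by blast
      then show ?thesis using CG[OF Z(1)] unfolding graphs_def by auto
    qed
    have val: "\<tau> x = \<tau>' x" if "(\<lambda>x. (x, \<tau>' x)) ` D' \<in> C" "x \<in> D'" for \<tau>' D' x
    proof -
      have "(x, \<tau>' x) \<in> U" using that unfolding U_def by blast
      then show ?thesis unfolding \<tau>_def by (rule the_equality) (use uniq \<open>(x, \<tau>' x) \<in> U\<close> in blast)
    qed
    have sub: "D' \<subseteq> D" if "(\<lambda>x. (x, \<tau>' x)) ` D' \<in> C" for \<tau>' :: "'w \<Rightarrow> 'u" and D'
      using that unfolding D_def U_def by force
    have U: "U = (\<lambda>x. (x, \<tau> x)) ` D"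
    proof
      show "U \<subseteq> (\<lambda>x. (x, \<tau> x)) ` D"
      proof
        fix z assume "z \<in> U"
        then obtain V where V: "V \<in> C" "z \<in> V" unfolding U_def by blast
        then obtain D' \<tau>' where D': "V = (\<lambda>x. (x, \<tau>' x)) ` D'" using CG[OF V(1)] unfolding graphs_def by blast
        then show "z \<in> (\<lambda>x. (x, \<tau> x)) ` D"
          using V val[of \<tau>' D'] sub[of \<tau>' D'] by auto
      qed
      show "(\<lambda>x. (x, \<tau> x)) ` D \<subseteq> U"
      proof
        fix z assume "z \<in> (\<lambda>x. (x, \<tau> x)) ` D"
        then obtain x where x: "x \<in> D" "z = (x, \<tau> x)" by blast
        obtain D' \<tau>' where D': "x \<in> D'" "(\<lambda>x. (x, \<tau>' x)) ` D' \<in> C" using pair[OF x(1) x(1)] by blast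
        then show "z \<in> U" using val[OF D'(2,1)] x unfolding U_def by blast
      qed
    qed
    have "ok D \<tau>"
      unfolding ok_def
    proof (intro conjI ballI)
      obtain V where "V \<in> C" using C by blast
      then obtain D0 \<tau>1 where D0: "ok D0 \<tau>1" "(\<lambda>x. (x, \<tau>1 x)) ` D0 \<in> C"
        using CG[of V] unfolding graphs_def by blast
      have "E \<subseteq> D0" using D0 by (auto simp: ok_def)
      then show "E \<subseteq> D" using sub[OF D0(2)] by blast
      show "\<tau> x = \<tau>0 x" if "x \<in> E" for x
        using val[OF D0(2), of x] D0(1) that by (auto simp: ok_def)
      have closed: "x + y \<in> D \<and> x * y \<in> D \<and> - x \<in> D \<and> inverse x \<in> D
          \<and> \<tau> (x + y) = \<tau> x + \<tau> y \<and> \<tau> (x * y) = \<tau> x * \<tau> y" if "x \<in> D" "y \<in> D" for x y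
      proof -
        obtain D' \<tau>' where D': "ok D' \<tau>'" "x \<in> D'" "y \<in> D'" "(\<lambda>x. (x, \<tau>' x)) ` D' \<in> C"
          using pair[OF \<open>x \<in> D\<close> \<open>y \<in> D\<close>] by blast
        have sf: "subfield_set D'" and rh: "ring_hom_on D' \<tau>'" using D' by (auto simp: ok_def)
        note A' = subfield_set_imp_subring[OF sf]
        show ?thesis
          using D' sub[OF D'(4)] val[OF D'(4)] subring_setD[OF A'] subfield_setD[OF sf]
            ring_hom_onD(3,4)[OF A' rh]
          by (simp add: subset_iff)
      qed
      have "0 \<in> E" "1 \<in> E" using subring_setD[OF subfield_set_imp_subring[OF E]] by auto
      with \<open>E \<subseteq> D\<close> have "0 \<in> D" "1 \<in> D" by auto
      with closed show "subfield_set D" by (auto simp: subfield_set_def subring_set_def)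
      have "\<tau> 1 = 1" using \<open>\<And>x. x \<in> E \<Longrightarrow> \<tau> x = \<tau>0 x\<close>[OF \<open>1 \<in> E\<close>] \<tau>0 by (simp add: ring_hom_on_def)
      with closed show "ring_hom_on D \<tau>" by (auto simp: ring_hom_on_def)
    qed
    with U show "\<Union>C \<in> graphs" unfolding graphs_def U_def by blast
  qed
  then obtain M where M: "M \<in> graphs" "\<And>V. V \<in> graphs \<Longrightarrow> M \<subseteq> V \<Longrightarrow> V = M" by blast
  then obtain D \<tau> where D: "ok D \<tau>" "M = (\<lambda>x. (x, \<tau> x)) ` D" unfolding graphs_def by blast
  have sf: "subfield_set D" and rh: "ring_hom_on D \<tau>" and sub: "E \<subseteq> D" and ext: "\<And>x. x \<in> E \<Longrightarrow> \<tau> x = \<tau>0 x"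
    using D by (auto simp: ok_def)
  show thesis
  proof (rule that[OF sf sub rh ext])
    fix p x assume "p \<in> polys_over D" "p \<noteq> 0" "poly p x = 0" "root_closed (map_poly \<tau> p)"
    then obtain \<tau>' where \<tau>': "ring_hom_on (field_hull (insert x D)) \<tau>'" "\<And>y. y \<in> D \<Longrightarrow> \<tau>' y = \<tau> y"
      using hom_extension_to_split_root[OF sf rh] by blast
    define D' where "D' = field_hull (insert x D)"
    have D': "insert x D \<subseteq> D'" unfolding D'_def by (rule field_hull_superset)
    have "ok D' \<tau>'"
      using \<tau>' sub ext D' by (auto simp: ok_def D'_def subfield_field_hull)
    then have "(\<lambda>x. (x, \<tau>' x)) ` D' \<in> graphs" unfolding graphs_def by blast
    moreover have "M \<subseteq> (\<lambda>x. (x, \<tau>' x)) ` D'" using D(2) \<tau>'(2) D' by force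
    ultimately have "(\<lambda>x. (x, \<tau>' x)) ` D' = M" by (rule M(2))
    then have "fst ` (\<lambda>x. (x, \<tau>' x)) ` D' = fst ` M" by simp
    then show "x \<in> D" using D(2) D' by (auto simp: image_image)
  qed auto
qed

section \<open>Algebraic elements and primitive elements\<close>

lemma root_of_dvd_prod:
  assumes "finite I" "m dvd (\<Prod>i\<in>I. [:- f i, 1:])" "degree m > 0"
  shows "\<exists>i\<in>I. poly m (f i :: 'w::field) = 0"
  using assms(1,2)
proof (induction I rule: finite_induct)
  case empty
  then have "degree m = 0" by (metis is_unit_iff_degree dvd_0_left_iff one_neq_zero prod.empty)
  with assms(3) show ?case by simp
next
  case (insert a I)
  show ?case
  proof (cases "poly m (f a) = 0")
    case False
    obtain k where k: "[:- f a, 1:] * (\<Prod>i\<in>I. [:- f i, 1:]) = m * k"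
      using insert.prems insert.hyps by (auto elim: dvdE)
    have "poly m (f a) * poly k (f a) = 0" using arg_cong[OF k, of "\<lambda>p. poly p (f a)"] by simp
    with False obtain k' where k': "k = [:- f a, 1:] * k'" by (auto simp: poly_eq_0_iff_dvd elim: dvdE)
    with k have "[:- f a, 1:] * (\<Prod>i\<in>I. [:- f i, 1:]) = [:- f a, 1:] * (m * k')"
      unfolding k' by (simp only: mult.left_commute)
    then have "(\<Prod>i\<in>I. [:- f i, 1:]) = m * k'" by (subst (asm) mult_cancel_left) auto
    then show ?thesis using insert.IH by auto
  qed auto
qed

lemma root_closed_prod: "finite I \<Longrightarrow> root_closed (\<Prod>i\<in>I. [:- f i, 1:])"
  unfolding root_closed_def using root_of_dvd_prod by blast

lemma root_closed_alg_closed [simp]: "root_closed (p :: 'u::alg_closed_field poly)"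
  unfolding root_closed_def using alg_closed_imp_poly_has_root by blast

section \<open>Rings of finite dimension over a subfield\<close>

lemma homogeneous_system_solution:
  assumes E: "subfield_set E" and "finite I" "card I > n"
    and "\<And>i j. i \<in> I \<Longrightarrow> j < n \<Longrightarrow> a i j \<in> E"
  shows "\<exists>c. (\<forall>i\<in>I. c i \<in> E) \<and> (\<exists>i\<in>I. c i \<noteq> 0) \<and> (\<forall>j<n. (\<Sum>i\<in>I. c i * a i j) = (0 :: 'w::field))"
  using assms(2-)
proof (induction n arbitrary: I a)
  case 0
  note A = subfield_set_imp_subring[OF E]
  from 0 obtain k where "k \<in> I" by fastforce
  then show ?case by (intro exI[of _ "\<lambda>_. 1"]) (auto simp: subring_setD[OF A])
next
  case (Suc n)
  note A = subfield_set_imp_subring[OF E]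
  show ?case
  proof (cases "\<forall>i\<in>I. a i n = 0")
    case True
    have "\<exists>c. (\<forall>i\<in>I. c i \<in> E) \<and> (\<exists>i\<in>I. c i \<noteq> 0) \<and> (\<forall>j<n. (\<Sum>i\<in>I. c i * a i j) = 0)"
      using Suc.prems by (intro Suc.IH) auto
    then obtain c where "\<forall>i\<in>I. c i \<in> E" "\<exists>i\<in>I. c i \<noteq> 0" "\<forall>j<n. (\<Sum>i\<in>I. c i * a i j) = 0"
      by blast
    with True show ?thesis by (intro exI[of _ c]) (auto simp: less_Suc_eq)
  next
    case False
    then obtain k where k: "k \<in> I" "a k n \<noteq> 0" by blast
    define I' where "I' = I - {k}"
    have I': "finite I'" "k \<notin> I'" "I = insert k I'" "card I' > n"
      using Suc.prems k by (auto simp: I'_def)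
    \<comment> \<open>The pivot \<open>k\<close> eliminates equation \<open>n\<close>: the other
      unknowns solve a system with one equation less, and the value \<open>c' k\<close> is then
      dictated by equation \<open>n\<close>.\<close>
    define a' where "a' i j = a i j - a i n / a k n * a k j" for i j
    have "a' i j \<in> E" if "i \<in> I'" "j < n" for i j
      unfolding a'_def using that k Suc.prems I'
      by (intro subring_setD[OF A] subfield_setD[OF E]) auto
    then obtain c where c: "\<forall>i\<in>I'. c i \<in> E" "\<exists>i\<in>I'. c i \<noteq> 0" "\<forall>j<n. (\<Sum>i\<in>I'. c i * a' i j) = 0"
      using Suc.IH[of I' a'] I' by blast
    define c' where "c' = c(k := - (\<Sum>i\<in>I'. c i * (a i n / a k n)))"
    have eq: "(\<Sum>i\<in>I. c' i * a i j) = (\<Sum>i\<in>I'. c i * a' i j)" for j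
    proof -
      have "(\<Sum>i\<in>I. c' i * a i j) = c' k * a k j + (\<Sum>i\<in>I'. c' i * a i j)"
        using I' by simp
      also have "(\<Sum>i\<in>I'. c' i * a i j) = (\<Sum>i\<in>I'. c i * a i j)"
        using I' by (intro sum.cong) (auto simp: c'_def)
      also have "c' k * a k j = - (\<Sum>i\<in>I'. c i * (a i n / a k n) * a k j)"
        by (simp add: c'_def sum_distrib_right)
      finally show ?thesis by (simp add: a'_def algebra_simps sum_subtractf)
    qed
    have "(\<Sum>i\<in>I. c' i * a i j) = 0" if "j < Suc n" for j
    proof (cases "j = n")
      case True
      have "a' i n = 0" for i using k by (simp add: a'_def)
      then show ?thesis using eq True by simp
    next
      case False
      then show ?thesis using eq c that by simp
    qed
    moreover have "\<forall>i\<in>I. c' i \<in> E"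
    proof -
      have "(\<Sum>i\<in>I'. c i * (a i n / a k n)) \<in> E"
        using c I' Suc.prems k by (intro subring_set_sum[OF A] subring_setD[OF A] subfield_setD[OF E]) auto
      then show ?thesis using c I' by (auto simp: c'_def intro: subring_setD[OF A])
    qed
    moreover have "\<exists>i\<in>I. c' i \<noteq> 0" using c I' by (auto simp: c'_def)
    ultimately show ?thesis by blast
  qed
qed

definition spans_over :: "'w::field set \<Rightarrow> nat \<Rightarrow> (nat \<Rightarrow> 'w) \<Rightarrow> 'w set \<Rightarrow> bool" where
  "spans_over E n b R \<longleftrightarrow> (\<forall>x\<in>R. \<exists>e. (\<forall>i<n. e i \<in> E) \<and> x = (\<Sum>i<n. e i * b i))"

text \<open>These rings stand in for towers of algebraic extensions: adjoining a root of a monic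
  polynomial keeps the dimension finite, and every element of such a ring is algebraic over
  \<open>E\<close>.\<close>

definition finite_ring_over :: "'w::field set \<Rightarrow> 'w set \<Rightarrow> bool" where
  "finite_ring_over E R \<longleftrightarrow> subring_set R \<and> E \<subseteq> R \<and> (\<exists>n b. spans_over E n b R)"

lemma finite_ring_over_self:
  assumes E: "subfield_set E"
  shows "finite_ring_over E E"
  unfolding finite_ring_over_def
proof (intro conjI)
  have "\<exists>e. (\<forall>i<Suc 0. e i \<in> E) \<and> x = (\<Sum>i<Suc 0. e i * 1)" if "x \<in> E" for x
    using that by (intro exI[of _ "\<lambda>_. x"]) auto
  then have "spans_over E (Suc 0) (\<lambda>_. 1) E" unfolding spans_over_def by blast
  then show "\<exists>n b. spans_over E n b E" by blast
qed (use subfield_set_imp_subring[OF E] in auto)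

lemma finite_ring_over_algebraic:
  assumes E: "subfield_set E" and R: "finite_ring_over E R" and x: "x \<in> R"
  shows "algebraic_over E x"
proof -
  have RA: "subring_set R" using R by (simp add: finite_ring_over_def)
  obtain n b where nb: "\<forall>y\<in>R. \<exists>e. (\<forall>i<n. e i \<in> E) \<and> y = (\<Sum>i<(n::nat). e i * b i)"
    using R unfolding finite_ring_over_def spans_over_def by blast
  have "x ^ k \<in> R" for k using x by (intro subring_setD[OF RA])
  then have "\<forall>k. \<exists>e. (\<forall>i<n. e i \<in> E) \<and> x ^ k = (\<Sum>i<n. e i * b i)" using nb by blast
  then obtain a where a: "\<And>k. (\<forall>i<n. a k i \<in> E) \<and> x ^ k = (\<Sum>i<n. a k i * b i)" by metis
  \<comment> \<open>The \<open>n + 1\<close> powers of \<open>x\<close> up to \<open>x ^ n\<close>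
    have coordinate vectors of length \<open>n\<close>; a nontrivial relation among these vectors is
    the desired polynomial.\<close>
  obtain c where c: "\<forall>k\<in>{..n}. c k \<in> E" "\<exists>k\<in>{..n}. c k \<noteq> 0" "\<forall>j<n. (\<Sum>k\<in>{..n}. c k * a k j) = 0"
    using homogeneous_system_solution[OF E, of "{..n}" n a] a by auto
  define p where "p = (\<Sum>k\<le>n. monom (c k) k)"
  note A = subfield_set_imp_subring[OF E]
  have coeff: "coeff p k = (if k \<le> n then c k else 0)" for k
    by (simp add: p_def coeff_sum)
  then have pE: "p \<in> polys_over E" "p \<noteq> 0"
    using c subring_setD[OF A] by (auto simp: polys_over_def poly_eq_iff)
  have "poly p x = (\<Sum>k\<le>n. c k * x ^ k)"
    by (simp add: p_def poly_sum poly_monom)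
  also have "\<dots> = (\<Sum>k\<le>n. c k * (\<Sum>i<n. a k i * b i))"
    using a by simp
  also have "\<dots> = (\<Sum>k\<le>n. \<Sum>i<n. c k * a k i * b i)"
    by (simp add: sum_distrib_left mult.assoc)
  also have "\<dots> = (\<Sum>i<n. \<Sum>k\<le>n. c k * a k i * b i)"
    by (rule sum.swap)
  also have "\<dots> = (\<Sum>i<n. (\<Sum>k\<le>n. c k * a k i) * b i)"
    by (simp add: sum_distrib_right)
  also have "\<dots> = 0" using c(3) by simp
  finally show ?thesis using pE unfolding algebraic_over_def by blast
qed

lemma finite_ring_over_adjoin:
  assumes R: "finite_ring_over E R" and p: "p \<in> polys_over R" "lead_coeff p = 1" "poly p x = 0"
  obtains R' where "finite_ring_over E R'" "insert x R \<subseteq> R'"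
proof -
  have RA: "subring_set R" and ER: "E \<subseteq> R" using R by (auto simp: finite_ring_over_def)
  obtain n b where nb: "\<forall>y\<in>R. \<exists>e. (\<forall>i<n. e i \<in> E) \<and> y = (\<Sum>i<(n::nat). e i * b i)"
    using R unfolding finite_ring_over_def spans_over_def by blast
  define R' where "R' = {poly q x |q. q \<in> polys_over R}"
  define d where "d = degree p"
  have sub: "insert x R \<subseteq> R'"
  proof -
    have "x = poly [:0, 1:] x" "[:0, 1:] \<in> polys_over R"
      by (simp_all add: polys_over_pCons[OF RA] polys_over_0[OF RA] subring_setD[OF RA])
    moreover have "y = poly [:y:] x \<and> [:y:] \<in> polys_over R" if "y \<in> R" for y
      using that by (simp add: polys_over_pCons[OF RA] polys_over_0[OF RA])
    ultimately show ?thesis unfolding R'_def by blast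
  qed
  have R'sub: "subring_set R'"
    unfolding subring_set_def
  proof (intro conjI ballI)
    show "0 \<in> R'" "1 \<in> R'" using sub subring_setD[OF RA] by auto
    show "- y \<in> R'" if "y \<in> R'" for y
      using that polys_over_uminus[OF RA] unfolding R'_def by (force simp flip: poly_minus)
    show "y + z \<in> R'" "y * z \<in> R'" if "y \<in> R'" "z \<in> R'" for y z
      using that polys_over_add[OF RA] polys_over_mult[OF RA] unfolding R'_def
      by (force simp flip: poly_add, force simp flip: poly_mult)
  qed
  \<comment> \<open>The generators \<open>x ^ k * b i\<close> with \<open>k < d\<close> and
    \<open>i < n\<close> are enumerated by \<open>m = k * n + i\<close>.\<close>
  have spanned: "\<exists>e. (\<forall>m<d * n. e m \<in> E) \<and> y = (\<Sum>m<d * n. e m * (x ^ (m div n) * b (m mod n)))"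
    if y: "y \<in> R'" for y
  proof -
    obtain q where q: "q \<in> polys_over R" "y = poly q x" using y unfolding R'_def by blast
    obtain s r where sr: "s \<in> polys_over R" "r \<in> polys_over R" "q = s * p + r" "r = 0 \<or> degree r < d"
      using monic_division[OF RA p(1,2) q(1)] unfolding d_def by blast
    have yr: "y = poly r x" using q sr p by simp
    have y_eq: "y = (\<Sum>k<d. coeff r k * x ^ k)"
    proof -
      have "y = (\<Sum>k\<le>degree r. coeff r k * x ^ k)" using yr by (simp add: poly_altdef)
      also have "\<dots> = (\<Sum>k<d. coeff r k * x ^ k)"
        by (cases "r = 0", simp, rule sum.mono_neutral_left) (use sr(4) in \<open>auto simp: coeff_eq_0\<close>)
      finally show ?thesis .
    qed
    have "\<forall>k. \<exists>e. (\<forall>i<n. e i \<in> E) \<and> coeff r k = (\<Sum>i<n. e i * b i)"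
      using sr(2) nb polys_overD by blast
    then obtain a where a: "\<And>k. (\<forall>i<n. a k i \<in> E) \<and> coeff r k = (\<Sum>i<n. a k i * b i)" by metis
    define e where "e m = a (m div n) (m mod n)" for m
    define h where "h m = e m * (x ^ (m div n) * b (m mod n))" for m
    have inner: "coeff r k * x ^ k = (\<Sum>i<n. a k i * (x ^ k * b i))" for k
    proof -
      have "coeff r k * x ^ k = (\<Sum>i<n. a k i * b i) * x ^ k" using a by simp
      also have "\<dots> = (\<Sum>i<n. a k i * (x ^ k * b i))"
        unfolding sum_distrib_right by (intro sum.cong refl) (simp add: mult_ac)
      finally show ?thesis .
    qed
    have "y = (\<Sum>k<d. \<Sum>i<n. a k i * (x ^ k * b i))"
      using y_eq inner by simp
    also have "\<dots> = (\<Sum>k<d. \<Sum>i<n. h (i + k * n))"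
      by (intro sum.cong refl) (auto simp: h_def e_def)
    also have "\<dots> = (\<Sum>k<d. sum h {k * n..<k * n + n})"
    proof (rule sum.cong[OF refl])
      fix k
      show "(\<Sum>i<n. h (i + k * n)) = sum h {k * n..<k * n + n}"
        using sum.shift_bounds_nat_ivl[of h 0 "k * n" n] by (simp add: atLeast0LessThan add.commute)
    qed
    also have "\<dots> = (\<Sum>m<d * n. h m)" by (rule sum.nat_group)
    finally have "y = (\<Sum>m<d * n. h m)" .
    moreover have "\<forall>m<d * n. e m \<in> E"
    proof (intro allI impI)
      fix m assume "m < d * n"
      then have "m mod n < n" by (cases "n = 0") auto
      then show "e m \<in> E" using a by (auto simp: e_def)
    qed
    ultimately show ?thesis unfolding h_def by blast
  qed
  then have "spans_over E (d * n) (\<lambda>m. x ^ (m div n) * b (m mod n)) R'"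
    unfolding spans_over_def by blast
  moreover have "E \<subseteq> R'" using sub ER by blast
  ultimately have "finite_ring_over E R'"
    using R'sub unfolding finite_ring_over_def by blast
  then show thesis using that sub by blast
qed

section \<open>The theorem of the primitive element\<close>

lemma simple_root_unique_imp_linear:
  assumes m: "lead_coeff m = 1" "m dvd (\<Prod>b\<in>S. [:- b, 1:])" "poly m \<beta> = (0::'w::field)"
    and S: "finite S" and only: "\<And>b. b \<in> S \<Longrightarrow> poly m b = 0 \<Longrightarrow> b = \<beta>"
  shows "m = [:- \<beta>, 1:]"
proof -
  obtain n where n: "m = [:- \<beta>, 1:] * n" using m(3) by (auto simp: poly_eq_0_iff_dvd elim: dvdE)
  have "degree m > 0"
  proof (rule ccontr)
    assume "\<not> degree m > 0"
    then obtain a where "m = [:a:]" using degree_eq_zeroE by blast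
    with m show False by simp
  qed
  then obtain b where "b \<in> S" "poly m b = 0" using root_of_dvd_prod[OF S, of m "\<lambda>x. x"] m by auto
  with only have \<beta>S: "\<beta> \<in> S" by blast
  have "degree n = 0"
  proof (rule ccontr)
    assume "degree n \<noteq> 0"
    moreover have "n dvd (\<Prod>b\<in>S. [:- b, 1:])" using m(2) n by (metis dvd_mult_right)
    ultimately obtain b where b: "b \<in> S" "poly n b = 0"
      using root_of_dvd_prod[OF S, of n "\<lambda>x. x"] by auto
    then have "b = \<beta>" using only n by auto
    with b obtain n' where n': "n = [:- \<beta>, 1:] * n'" by (auto simp: poly_eq_0_iff_dvd elim: dvdE)
    obtain k where k: "(\<Prod>b\<in>S. [:- b, 1:]) = m * k" using m(2) by (auto elim: dvdE)
    have "[:- \<beta>, 1:] * (\<Prod>b\<in>S - {\<beta>}. [:- b, 1:]) = m * k"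
      using k prod.remove[OF S \<beta>S, of "\<lambda>b. [:- b, 1:]"] by simp
    also have "m * k = [:- \<beta>, 1:] * ([:- \<beta>, 1:] * n' * k)"
      by (simp only: n n' mult.assoc)
    finally have "(\<Prod>b\<in>S - {\<beta>}. [:- b, 1:]) = [:- \<beta>, 1:] * n' * k"
      by (subst (asm) mult_cancel_left) auto
    then have "poly (\<Prod>b\<in>S - {\<beta>}. [:- b, 1:]) \<beta> = 0" by (simp only: poly_mult) simp
    then have "(\<Prod>b\<in>S - {\<beta>}. \<beta> - b) = 0" by (simp add: poly_prod)
    then show False using S by auto
  qed
  then obtain a where "n = [:a:]" using degree_eq_zeroE by blast
  moreover from this have "a \<noteq> 0" using n m(1) by auto
  ultimately show ?thesis using n m(1) by (simp add: degree_mult_eq)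
qed

text \<open>The classical argument: with \<open>\<gamma> = \<alpha> + c * \<beta>\<close>, the
  polynomials \<open>p(\<gamma> - c X)\<close> and the product over \<open>S\<close> have
  \<open>\<beta>\<close> as their only common root for suitable \<open>c\<close>. The minimal
  polynomial of \<open>\<beta>\<close> over the field of \<open>\<gamma>\<close> divides both, hence
  is linear.\<close>

lemma primitive_element_two:
  assumes E: "subfield_set E" and C: "infinite C" and \<alpha>: "algebraic_over E \<alpha>"
    and g: "(\<Prod>b\<in>S. [:- b, 1:]) \<in> polys_over E" and S: "finite S" "\<beta> \<in> S"
    and CE: "C \<subseteq> E"
  obtains c where "c \<in> C" "\<alpha> \<in> field_hull (insert (\<alpha> + c * \<beta>) E)" "\<beta> \<in> field_hull (insert (\<alpha> + c * \<beta>) E)"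
proof -
  obtain p where p: "p \<in> polys_over E" "p \<noteq> 0" "poly p \<alpha> = 0" using \<alpha> unfolding algebraic_over_def by blast
  \<comment> \<open>The number \<open>(a - \<alpha>) / (\<beta> - b)\<close> is the value of
    \<open>c\<close> for which \<open>\<gamma> - c * b\<close> is the root \<open>a\<close> of
    \<open>p\<close>. The pairs with \<open>b = \<beta>\<close> merely add 0, by the convention on
    division by zero.\<close>
  define bad where "bad = (\<lambda>(a, b). (a - \<alpha>) / (\<beta> - b)) ` ({a. poly p a = 0} \<times> S)"
  have "finite bad" unfolding bad_def using p S poly_roots_finite by blast
  then obtain c where c: "c \<in> C" "c \<notin> bad" using C by (meson finite_subset subsetI)
  define \<gamma> where "\<gamma> = \<alpha> + c * \<beta>"
  define F where "F = field_hull (insert \<gamma> E)"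
  have F: "subfield_set F" unfolding F_def by (rule subfield_field_hull)
  note A = subfield_set_imp_subring[OF F]
  have EF: "insert \<gamma> E \<subseteq> F" unfolding F_def by (rule field_hull_superset)
  then have "polys_over E \<subseteq> polys_over F" by (intro polys_over_mono) auto
  with g p have gF: "(\<Prod>b\<in>S. [:- b, 1:]) \<in> polys_over F" and pF: "p \<in> polys_over F" by auto
  have groot: "poly (\<Prod>b\<in>S. [:- b, 1:]) \<beta> = 0" using S by (auto simp: poly_prod)
  have g0: "(\<Prod>b\<in>S. [:- b, 1:]) \<noteq> 0" using S by auto
  have "algebraic_over F \<beta>" using gF groot g0 unfolding algebraic_over_def by blast
  then obtain m where m: "m \<in> polys_over F" "lead_coeff m = 1" "poly m \<beta> = 0"
    and dvd: "\<And>q. q \<in> polys_over F \<Longrightarrow> poly q \<beta> = 0 \<Longrightarrow> \<exists>r\<in>polys_over F. q = r * m"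
    using min_poly_exists[OF F] by blast
  have "m dvd (\<Prod>b\<in>S. [:- b, 1:])" using dvd[OF gF groot] by auto
  moreover have "b = \<beta>" if b: "b \<in> S" "poly m b = 0" for b
  proof (rule ccontr)
    assume nb: "b \<noteq> \<beta>"
    have "c \<in> F" "\<gamma> \<in> F" using c CE EF by auto
    then have "pcompose p [:\<gamma>, - c:] \<in> polys_over F"
      by (intro polys_over_pcompose[OF A] pF)
         (auto simp: polys_over_pCons[OF A] polys_over_0[OF A] intro: subring_setD[OF A])
    moreover have "poly (pcompose p [:\<gamma>, - c:]) \<beta> = 0"
      using p by (simp add: poly_pcompose \<gamma>_def mult.commute)
    ultimately obtain r where "pcompose p [:\<gamma>, - c:] = r * m" using dvd by blast
    then have "poly (pcompose p [:\<gamma>, - c:]) b = 0" using b by simp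
    then have "poly p (\<gamma> - c * b) = 0" by (simp add: poly_pcompose mult.commute)
    moreover have "c = (\<gamma> - c * b - \<alpha>) / (\<beta> - b)" using nb by (simp add: \<gamma>_def field_simps)
    ultimately have "c \<in> bad" unfolding bad_def using b by force
    with c show False by blast
  qed
  ultimately have "m = [:- \<beta>, 1:]"
    by (intro simple_root_unique_imp_linear[OF m(2) _ m(3) S(1)])
  then have "- \<beta> \<in> F" using polys_overD[OF m(1), of 0] by simp
  then have "\<beta> \<in> F" using subring_setD(3)[OF A, of "- \<beta>"] by simp
  moreover have "\<alpha> = \<gamma> - c * \<beta>" by (simp add: \<gamma>_def)
  moreover have "c \<in> F" "\<gamma> \<in> F" using c CE EF by auto
  ultimately have "\<alpha> \<in> F" using subring_setD(5,6)[OF A] by metis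
  with \<open>\<beta> \<in> F\<close> show thesis using that[OF c(1)] unfolding F_def \<gamma>_def by blast
qed

text \<open>Separability and splitting at once: some polynomial over \<open>E\<close>, possibly
  reducible, is a product of linear factors in the ambient field, and the factors are distinct
  because \<open>S\<close> is a set.\<close>

definition separable_over :: "'w::field set \<Rightarrow> 'w \<Rightarrow> bool" where
  "separable_over E \<beta> \<longleftrightarrow> (\<exists>S. finite S \<and> \<beta> \<in> S \<and> (\<Prod>b\<in>S. [:- b, 1:]) \<in> polys_over E)"

text \<open>One generator \<open>\<alpha>\<close> may be merely algebraic, as in the classical
  theorem; separability is asked of those in \<open>B\<close>. Keeping \<open>\<gamma>\<close>
  inside \<open>R\<close> preserves its algebraicity over \<open>E\<close> along the
  induction.\<close>

lemma primitive_element: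
  assumes E: "subfield_set E" and inf: "infinite E"
    and R: "subring_set R" "E \<subseteq> R" "\<And>x. x \<in> R \<Longrightarrow> algebraic_over E x"
    and \<alpha>: "\<alpha> \<in> R" and B: "finite B" "B \<subseteq> R" "\<And>\<beta>. \<beta> \<in> B \<Longrightarrow> separable_over E \<beta>"
  obtains \<gamma> where "\<gamma> \<in> R" "insert \<alpha> B \<subseteq> field_hull (insert \<gamma> E)"
proof -
  have "\<exists>\<gamma>\<in>R. insert \<alpha> B \<subseteq> field_hull (insert \<gamma> E)"
    using B
  proof (induction B rule: finite_induct)
    case empty
    then show ?case using \<alpha> field_hull_superset by blast
  next
    case (insert \<beta> B)
    then obtain \<gamma> where \<gamma>: "\<gamma> \<in> R" "insert \<alpha> B \<subseteq> field_hull (insert \<gamma> E)" by auto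
    obtain S where S: "finite S" "\<beta> \<in> S" "(\<Prod>b\<in>S. [:- b, 1:]) \<in> polys_over E"
      using insert.prems unfolding separable_over_def by blast
    obtain c where c: "c \<in> E" "\<gamma> \<in> field_hull (insert (\<gamma> + c * \<beta>) E)" "\<beta> \<in> field_hull (insert (\<gamma> + c * \<beta>) E)"
      using primitive_element_two[OF E inf R(3)[OF \<gamma>(1)] S(3,1,2)] by blast
    have "insert \<gamma> E \<subseteq> field_hull (insert (\<gamma> + c * \<beta>) E)"
      using c field_hull_superset[of "insert (\<gamma> + c * \<beta>) E"] by auto
    then have "field_hull (insert \<gamma> E) \<subseteq> field_hull (insert (\<gamma> + c * \<beta>) E)"
      by (rule field_hull_minimal[OF _ subfield_field_hull])
    with c \<gamma> have "insert \<alpha> (insert \<beta> B) \<subseteq> field_hull (insert (\<gamma> + c * \<beta>) E)" by auto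
    moreover have "\<gamma> + c * \<beta> \<in> R"
      using \<gamma> c R insert.prems by (intro subring_setD[OF R(1)]) auto
    ultimately show ?case by blast
  qed
  then show thesis using that by blast
qed

section \<open>Homomorphisms out of a field\<close>

lemma field_embedding_iff_hom_on: "field_embedding j \<longleftrightarrow> ring_hom_on UNIV j"
  by (auto simp: field_embedding_iff ring_hom_on_def)

lemma subring_set_UNIV [simp]: "subring_set UNIV"
  by (simp add: subring_set_def)

lemma subring_range_hom:
  assumes j: "ring_hom_on A j" and A: "subring_set A"
  shows "subring_set (j ` A)"
  unfolding subring_set_def
proof (intro conjI ballI)
  note D = ring_hom_onD[OF A j] and S = subring_setD[OF A]
  show "0 \<in> j ` A" "1 \<in> j ` A" using D(1,2) S(1,2) by (metis imageI)+
  show "- x \<in> j ` A" if "x \<in> j ` A" for x using that D(5) S(3) by force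
  show "x + y \<in> j ` A" "x * y \<in> j ` A" if "x \<in> j ` A" "y \<in> j ` A" for x y
    using that D(3,4) S(4,6) by (force, force)
qed

lemma subfield_range_hom:
  assumes j: "ring_hom_on E j" and E: "subfield_set E"
  shows "subfield_set (j ` E)"
  using subring_range_hom[OF j subfield_set_imp_subring[OF E]] ring_hom_on_inverse[OF E j] subfield_setD[OF E]
  by (force simp: subfield_set_def)

lemma polys_over_range:
  assumes j: "ring_hom_on UNIV j"
  shows "polys_over (range j) = range (map_poly j)"
proof
  note D = ring_hom_onD[OF subring_set_UNIV j]
  show "range (map_poly j) \<subseteq> polys_over (range j)"
    by (auto simp: polys_over_def coeff_map_poly D)
  show "polys_over (range j) \<subseteq> range (map_poly j)"
  proof
    fix p assume p: "p \<in> polys_over (range j)"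
    \<comment> \<open>The case distinction makes \<open>g 0 = 0\<close> hold by definition, as
      \<open>coeff_map_poly\<close> requires.\<close>
    define g where "g y = (if y = 0 then 0 else inv_into UNIV j y)" for y
    have "j (g y) = y" if "y \<in> range j" for y
      using that D f_inv_into_f[of y j UNIV] by (auto simp: g_def)
    then have "p = map_poly j (map_poly g p)"
      using p by (intro poly_eqI) (auto simp: coeff_map_poly D g_def polys_over_def)
    then show "p \<in> range (map_poly j)" by blast
  qed
qed

lemma map_poly_inj_hom:
  assumes j: "ring_hom_on UNIV j"
  shows "map_poly j p = map_poly j q \<longleftrightarrow> p = q"
  using ring_hom_on_eq_iff[OF subfield_set_UNIV j]
  by (auto simp: poly_eq_iff coeff_map_poly ring_hom_onD[OF subring_set_UNIV j])

lemma degree_map_poly_hom: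
  assumes j: "ring_hom_on UNIV j"
  shows "degree (map_poly j p) = degree p"
  using ring_hom_on_nonzero[OF subfield_set_UNIV j] by (intro degree_map_poly) auto

text \<open>The minimal polynomial is pulled back along \<open>j\<close> to a polynomial over the
  type \<open>'a\<close>, because irreducibility and the Hilbert property are formulated
  there.\<close>

lemma hom_min_poly:
  assumes j: "ring_hom_on UNIV (j :: 'a::field \<Rightarrow> 'w::field)" and x: "algebraic_over (range j) x"
  obtains \<mu> where "irreducible \<mu>" "lead_coeff \<mu> = 1" "poly (map_poly j \<mu>) x = 0"
    "\<And>q. poly (map_poly j q) x = 0 \<Longrightarrow> \<mu> dvd q"
proof -
  note H0 = subring_set_UNIV
  note mult = map_poly_hom_on_mult[OF H0 j, simplified]
  have E: "subfield_set (range j)" using subfield_range_hom[OF j] by simp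
  obtain m where m: "m \<in> polys_over (range j)" "lead_coeff m = 1" "poly m x = 0"
    and dvd: "\<And>q. q \<in> polys_over (range j) \<Longrightarrow> poly q x = 0 \<Longrightarrow> \<exists>r\<in>polys_over (range j). q = r * m"
    using min_poly_exists[OF E x] by blast
  obtain \<mu> where \<mu>: "m = map_poly j \<mu>" using m(1) polys_over_range[OF j] by auto
  have lc: "lead_coeff \<mu> = 1"
    using m(2) ring_hom_on_eq_iff[OF subfield_set_UNIV j, of "lead_coeff \<mu>" 1]
    by (simp add: \<mu> degree_map_poly_hom[OF j] coeff_map_poly ring_hom_onD[OF H0 j])
  have dv: "\<mu> dvd q" if q: "poly (map_poly j q) x = 0" for q
  proof -
    have "map_poly j q \<in> polys_over (range j)" using polys_over_range[OF j] by auto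
    then obtain r where "r \<in> polys_over (range j)" "map_poly j q = r * m" using dvd q by blast
    then obtain r' where "map_poly j q = map_poly j (r' * \<mu>)" using polys_over_range[OF j] \<mu> mult by auto
    then have "q = r' * \<mu>" by (simp only: map_poly_inj_hom[OF j])
    then show ?thesis by simp
  qed
  have \<mu>0: "\<mu> \<noteq> 0" using lc by auto
  have "irreducible \<mu>"
  proof (rule irreducibleI[OF \<mu>0])
    show "\<not> \<mu> dvd 1"
    proof
      assume "\<mu> dvd 1"
      then have "degree \<mu> = 0" using \<mu>0 by (simp add: is_unit_iff_degree)
      then obtain a where "\<mu> = [:a:]" using degree_eq_zeroE by blast
      with lc have "\<mu> = 1" by simp
      with m(3) \<mu> show False by (simp add: map_poly_hom_on_1[OF H0 j])
    qed
    fix a b assume ab: "\<mu> = a * b"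
    then have "poly (map_poly j a) x = 0 \<or> poly (map_poly j b) x = 0"
      using m(3) \<mu> mult by auto
    then have "\<mu> dvd a \<or> \<mu> dvd b" using dv by blast
    moreover have "b dvd 1" if h: "\<mu> dvd a" "\<mu> = a * b" for a b
    proof -
      obtain k where "a = \<mu> * k" using h(1) by (elim dvdE)
      then have "a = a * b * k" using h(2) by simp
      moreover have "a \<noteq> 0" using h \<mu>0 by auto
      ultimately have "b * k = 1" by (metis mult.assoc mult.right_neutral mult_cancel_left)
      then show ?thesis by (metis dvd_triv_left)
    qed
    ultimately show "a dvd 1 \<or> b dvd 1" using ab by (metis mult.commute)
  qed
  with that lc m(3) \<mu> dv show thesis by blast
qed

lemma irreducible_dvd_of_common_root:
  assumes j: "ring_hom_on UNIV (j :: 'a::field \<Rightarrow> 'w::field)" and p: "irreducible p"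
    and x: "poly (map_poly j p) x = 0" "poly (map_poly j q) x = 0"
  shows "p dvd q"
proof -
  have p0: "p \<noteq> 0" using p by auto
  then have "map_poly j p \<noteq> 0" using map_poly_inj_hom[OF j, of p 0] by auto
  then have "algebraic_over (range j) x"
    using x polys_over_range[OF j] unfolding algebraic_over_def by auto
  then obtain \<mu> where \<mu>: "irreducible \<mu>" "\<And>q. poly (map_poly j q) x = 0 \<Longrightarrow> \<mu> dvd q"
    using hom_min_poly[OF j] by blast
  then obtain k where k: "p = \<mu> * k" using x by (auto elim: dvdE)
  then have "k dvd 1" using p \<mu>(1) by (metis irreducible_def)
  then have "p dvd \<mu>" using k by (simp add: dvd_mult_unit_iff mult.commute mult_unit_dvd_iff)
  then show ?thesis using \<mu>(2)[OF x(2)] dvd_trans by blast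
qed

text \<open>The last assumption says that the target is algebraic over the range of \<open>j\<close>, in the form
  needed for maximal domains of homomorphisms: it makes towers of algebraic extensions dispensable.\<close>

lemma automorphism_exists:
  fixes j :: "'a::field \<Rightarrow> 'c::alg_closed_field"
  assumes j: "ring_hom_on UNIV j" and p: "irreducible p"
    and x: "poly (map_poly j p) x = 0" and x': "poly (map_poly j p) x' = 0"
    and alg: "\<And>D. subfield_set D \<Longrightarrow> range j \<subseteq> D \<Longrightarrow>
      (\<And>p x. p \<in> polys_over D \<Longrightarrow> p \<noteq> 0 \<Longrightarrow> poly p x = 0 \<Longrightarrow> x \<in> D) \<Longrightarrow> D = UNIV"
  obtains \<gamma> where "ring_hom_on UNIV \<gamma>" "bij \<gamma>" "\<And>c. \<gamma> (j c) = j c" "\<gamma> x = x'"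
proof -
  define E where "E = range j"
  have E: "subfield_set E" using subfield_range_hom[OF j] by (simp add: E_def)
  have id: "ring_hom_on E (\<lambda>y. y)" by (simp add: ring_hom_on_def)
  have "map_poly j p \<noteq> 0" using map_poly_inj_hom[OF j, of p 0] p by auto
  then have ax: "algebraic_over E x"
    using x polys_over_range[OF j] unfolding algebraic_over_def E_def by auto
  have "poly (map_poly (\<lambda>y. y) q) x' = 0" if q: "q \<in> polys_over E" "poly q x = 0" for q
  proof -
    obtain q' where q': "q = map_poly j q'" using q polys_over_range[OF j] by (auto simp: E_def)
    then have "p dvd q'" using irreducible_dvd_of_common_root[OF j p x] q by simp
    then show ?thesis using x' q' by (auto elim!: dvdE simp: map_poly_hom_on_mult[OF subring_set_UNIV j] map_poly_idI)
  qed
  then obtain \<tau>0 where \<tau>0: "ring_hom_on (field_hull (insert x E)) \<tau>0" "\<And>y. y \<in> E \<Longrightarrow> \<tau>0 y = y" "\<tau>0 x = x'"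
    using hom_extension_to_root[OF E id ax, of x'] by blast
  have sup: "insert x E \<subseteq> field_hull (insert x E)" by (rule field_hull_superset)
  obtain D \<gamma> where D: "subfield_set D" "field_hull (insert x E) \<subseteq> D" "ring_hom_on D \<gamma>"
    "\<And>y. y \<in> field_hull (insert x E) \<Longrightarrow> \<gamma> y = \<tau>0 y"
    "\<And>p x. p \<in> polys_over D \<Longrightarrow> p \<noteq> 0 \<Longrightarrow> poly p x = 0 \<Longrightarrow> root_closed (map_poly \<gamma> p) \<Longrightarrow> x \<in> D"
    using hom_extension[OF subfield_field_hull \<tau>0(1)] by blast
  \<comment> \<open>The target is algebraically closed, so every polynomial is
    \<open>root_closed\<close> and the maximal domain contains all roots of polynomials over
    it.\<close>
  have "D = UNIV"
    using D sup by (intro alg) (auto simp: E_def)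
  with D have \<gamma>: "ring_hom_on UNIV \<gamma>" by simp
  have jfix: "\<gamma> (j c) = j c" for c
  proof -
    have "j c \<in> E" by (simp add: E_def)
    then show ?thesis using D(4)[of "j c"] \<tau>0(2)[of "j c"] sup by auto
  qed
  have "inj \<gamma>" using ring_hom_on_eq_iff[OF subfield_set_UNIV \<gamma>] by (auto simp: inj_def)
  \<comment> \<open>A polynomial over the range is the image of one that splits, so its roots are
    images of roots; thus \<open>alg\<close> applies to the range as well.\<close>
  moreover have "range \<gamma> = UNIV"
  proof (rule alg)
    show "subfield_set (range \<gamma>)" using subfield_range_hom[OF \<gamma>] by simp
    show "range j \<subseteq> range \<gamma>" using jfix by (metis image_subsetI rangeI)
    fix q y assume q: "q \<in> polys_over (range \<gamma>)" "q \<noteq> 0" "poly q y = 0"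
    then obtain q' where q': "q = map_poly \<gamma> q'" using polys_over_range[OF \<gamma>] by auto
    then have "q' \<noteq> 0" using q by auto
    then obtain A where A: "q' = smult (lead_coeff q') (\<Prod>x\<in>#A. [:- x, 1:])"
      using alg_closed_imp_factorization by blast
    have "poly (map_poly \<gamma> (\<Prod>x\<in>#A. [:- x, 1:])) y = 0 \<Longrightarrow> y \<in> range \<gamma>"
    proof (induction A)
      case empty
      then show ?case by (simp add: map_poly_hom_on_1[OF subring_set_UNIV \<gamma>])
    next
      case (add a A)
      have "map_poly \<gamma> (\<Prod>x\<in>#add_mset a A. [:- x, 1:])
          = map_poly \<gamma> [:- a, 1:] * map_poly \<gamma> (\<Prod>x\<in>#A. [:- x, 1:])"
        by (simp only: image_mset_add_mset prod_mset.add_mset map_poly_hom_on_mult[OF subring_set_UNIV \<gamma>] polys_over_UNIV UNIV_I)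
      then have "y = \<gamma> a \<or> poly (map_poly \<gamma> (\<Prod>x\<in>#A. [:- x, 1:])) y = 0"
        using add.prems by (simp add: map_poly_hom_on_pCons[OF subring_set_UNIV \<gamma>] ring_hom_onD[OF subring_set_UNIV \<gamma>]
            del: mult_pCons_left)
      then show ?case using add.IH by blast
    qed
    moreover have "q = smult (\<gamma> (lead_coeff q')) (map_poly \<gamma> (\<Prod>x\<in>#A. [:- x, 1:]))"
      unfolding q' by (subst A) (simp add: map_poly_hom_on_smult[OF subring_set_UNIV \<gamma>])
    moreover have "\<gamma> (lead_coeff q') \<noteq> 0"
      using \<open>q' \<noteq> 0\<close> ring_hom_on_nonzero[OF subfield_set_UNIV \<gamma>] by auto
    ultimately show "y \<in> range \<gamma>" using q(3) by simp
  qed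
  ultimately have "bij \<gamma>" by (simp add: bij_def)
  moreover have "\<gamma> x = x'" using D(4)[of x] \<tau>0(3) sup by auto
  ultimately show thesis using that \<gamma> jfix by blast
qed

section \<open>Rational functions and Hilbertian specialization\<close>

definition transcendental_over_hom :: "('a::field \<Rightarrow> 'w::field) \<Rightarrow> 'w \<Rightarrow> bool" where
  "transcendental_over_hom j t \<longleftrightarrow> (\<forall>q. poly (map_poly j q) t = 0 \<longrightarrow> q = 0)"

text \<open>The embedding of the rational function field that sends the indeterminate to
  \<open>t\<close>. With Laurent series for \<open>t\<close> it yields the copy of
  \<open>K_0(T)\<close> and, for each root of the pencil, the field generated by this root over the
  constants.\<close>

definition ratfun_hom :: "('a::field \<Rightarrow> 'w::field) \<Rightarrow> 'w \<Rightarrow> 'a poly fract \<Rightarrow> 'w" where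
  "ratfun_hom j t r =
     (THE c. \<exists>p q. r = Fraction_Field.Fract p q \<and> q \<noteq> 0 \<and> c = poly (map_poly j p) t / poly (map_poly j q) t)"

context
  fixes j :: "'a::field \<Rightarrow> 'w::field" and t :: 'w
  assumes j: "ring_hom_on UNIV j" and t: "transcendental_over_hom j t"
begin

lemma ratfun_hom_Fract:
  assumes "q \<noteq> 0"
  shows "ratfun_hom j t (Fraction_Field.Fract p q) = poly (map_poly j p) t / poly (map_poly j q) t"
  unfolding ratfun_hom_def
proof (rule the_equality)
  note mult = map_poly_hom_on_mult[OF subring_set_UNIV j, simplified]
  fix c
  assume "\<exists>p' q'. Fraction_Field.Fract p q = Fraction_Field.Fract p' q' \<and> q' \<noteq> 0 \<and>
    c = poly (map_poly j p') t / poly (map_poly j q') t"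
  then obtain p' q' where *: "Fraction_Field.Fract p q = Fraction_Field.Fract p' q'" "q' \<noteq> 0"
    "c = poly (map_poly j p') t / poly (map_poly j q') t" by blast
  have "p * q' = p' * q" using *(1,2) assms by (simp add: eq_fract)
  then have "poly (map_poly j p) t * poly (map_poly j q') t = poly (map_poly j p') t * poly (map_poly j q) t"
    by (metis mult poly_mult)
  moreover have "poly (map_poly j q) t \<noteq> 0" "poly (map_poly j q') t \<noteq> 0"
    using t assms *(2) unfolding transcendental_over_hom_def by blast+
  ultimately show "c = poly (map_poly j p) t / poly (map_poly j q) t"
    unfolding *(3) by (simp add: frac_eq_eq)
qed (use assms in blast)

lemma ratfun_hom_hom: "ring_hom_on UNIV (ratfun_hom j t)"
  unfolding ring_hom_on_def
proof (intro conjI ballI)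
  note D = ring_hom_onD[OF subring_set_UNIV j]
  note mult = map_poly_hom_on_mult[OF subring_set_UNIV j, simplified]
  note add = map_poly_hom_on_add[OF subring_set_UNIV j, simplified]
  show "ratfun_hom j t 1 = 1"
    by (simp add: One_fract_def ratfun_hom_Fract map_poly_hom_on_1[OF subring_set_UNIV j])
  fix r s :: "'a poly fract"
  obtain p q where r: "r = Fraction_Field.Fract p q" "q \<noteq> 0" by (metis Fract_cases)
  obtain p' q' where s: "s = Fraction_Field.Fract p' q'" "q' \<noteq> 0" by (metis Fract_cases)
  have nz: "poly (map_poly j q) t \<noteq> 0" "poly (map_poly j q') t \<noteq> 0"
    using t r s unfolding transcendental_over_hom_def by blast+
  show "ratfun_hom j t (r + s) = ratfun_hom j t r + ratfun_hom j t s"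
    using nz by (simp add: r s ratfun_hom_Fract add mult add_frac_eq)
  show "ratfun_hom j t (r * s) = ratfun_hom j t r * ratfun_hom j t s"
    by (simp add: r s ratfun_hom_Fract mult)
qed

lemma ratfun_hom_const: "ratfun_hom j t (Fraction_Field.Fract [:c:] 1) = j c"
  and ratfun_hom_indeterminate: "ratfun_hom j t (Fraction_Field.Fract [:0, 1:] 1) = t"
  by (simp_all add: ratfun_hom_Fract map_poly_hom_on_1[OF subring_set_UNIV j]
      map_poly_hom_on_pCons[OF subring_set_UNIV j] ring_hom_onD[OF subring_set_UNIV j])

end

text \<open>This is the local ring of the affine line at \<open>a\<close>, with evaluation as its
  residue map.\<close>

lemma ratfun_defined_hom:
  fixes a :: "'a::field"
  shows "subring_set {r. ratfun_defined_at r a}" "ring_hom_on {r. ratfun_defined_at r a} (\<lambda>r. ratfun_eval r a)"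
proof -
  have const: "ratfun_defined_at (Fraction_Field.Fract p 1) a" for p
    unfolding ratfun_defined_at_def by force
  have c: "ratfun_defined_at (r + s) a \<and> ratfun_defined_at (r * s) a \<and> ratfun_defined_at (- r) a \<and>
      ratfun_eval (r + s) a = ratfun_eval r a + ratfun_eval s a \<and>
      ratfun_eval (r * s) a = ratfun_eval r a * ratfun_eval s a"
    if rs: "ratfun_defined_at r a" "ratfun_defined_at s a" for r s
  proof -
    obtain p q where r: "r = Fraction_Field.Fract p q" "poly q a \<noteq> 0" using rs(1) by (auto simp: ratfun_defined_at_def)
    obtain p' q' where s: "s = Fraction_Field.Fract p' q'" "poly q' a \<noteq> 0" using rs(2) by (auto simp: ratfun_defined_at_def)
    have nz: "q \<noteq> 0" "q' \<noteq> 0" "poly (q * q') a \<noteq> 0" using r s by auto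
    have sums: "r + s = Fraction_Field.Fract (p * q' + p' * q) (q * q')"
      "r * s = Fraction_Field.Fract (p * p') (q * q')" "- r = Fraction_Field.Fract (- p) q"
      using nz by (simp_all add: r s)
    have e1: "ratfun_eval (r + s) a = poly (p * q' + p' * q) a / poly (q * q') a"
      unfolding sums(1) by (rule ratfun_eval_Fract[OF nz(3)])
    have e2: "ratfun_eval (r * s) a = poly (p * p') a / poly (q * q') a"
      unfolding sums(2) by (rule ratfun_eval_Fract[OF nz(3)])
    show ?thesis
    proof (intro conjI)
      show "ratfun_defined_at (r + s) a" "ratfun_defined_at (r * s) a" "ratfun_defined_at (- r) a"
        unfolding sums ratfun_defined_at_def using nz r by blast+
      show "ratfun_eval (r + s) a = ratfun_eval r a + ratfun_eval s a"
        "ratfun_eval (r * s) a = ratfun_eval r a * ratfun_eval s a"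
        unfolding e1 e2 unfolding r(1) s(1) ratfun_eval_Fract[OF r(2)] ratfun_eval_Fract[OF s(2)]
        using r s by (simp_all add: field_simps)
    qed
  qed
  have "ratfun_defined_at 0 a" "ratfun_defined_at 1 a" "ratfun_eval 1 a = 1"
    using const[of 0] const[of 1] ratfun_eval_Fract[of 1 a 1]
    by (simp_all add: Zero_fract_def One_fract_def)
  with c show "subring_set {r. ratfun_defined_at r a}" "ring_hom_on {r. ratfun_defined_at r a} (\<lambda>r. ratfun_eval r a)"
    by (auto simp: subring_set_def ring_hom_on_def)
qed

lemma ratfun_undefined_finite: "finite {a :: 'a::field. \<not> ratfun_defined_at r a}"
proof -
  obtain p q where r: "r = Fraction_Field.Fract p q" "q \<noteq> 0" by (metis Fract_cases)
  then have "{a. \<not> ratfun_defined_at r a} \<subseteq> {a. poly q a = 0}"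
    unfolding ratfun_defined_at_def by blast
  then show ?thesis using poly_roots_finite[OF r(2)] finite_subset by blast
qed

lemma map_poly_comp_hom: "f 0 = 0 \<Longrightarrow> g 0 = 0 \<Longrightarrow> map_poly f (map_poly g p) = map_poly (\<lambda>x. f (g x)) p"
  by (intro poly_eqI) (simp add: coeff_map_poly)

text \<open>The place \<open>\<phi>\<close> specializes \<open>T\<close> to \<open>a\<close>.  Since the minimal polynomial of the primitive element
  \<open>\<theta>\<close> stays irreducible, every automorphism \<open>\<tau>\<close> specializes as well.\<close>

theorem hilbertian_specialization:
  fixes e :: "'a::field poly fract \<Rightarrow> 'w::field" and j :: "'a \<Rightarrow> 'c::alg_closed_field"
  assumes hilb: "hilbertian TYPE('a)"
    and e: "ring_hom_on UNIV e" and j: "ring_hom_on UNIV j"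
    and alg: "\<And>D. subfield_set D \<Longrightarrow> range j \<subseteq> D \<Longrightarrow>
      (\<And>p x. p \<in> polys_over D \<Longrightarrow> p \<noteq> 0 \<Longrightarrow> poly p x = 0 \<Longrightarrow> x \<in> D) \<Longrightarrow> D = UNIV"
    and \<theta>: "algebraic_over (range e) \<theta>"
    and U: "finite U" "U \<subseteq> field_hull (insert \<theta> (range e))"
  obtains a B \<phi> where "subring_set B" "ring_hom_on B \<phi>" "insert \<theta> U \<subseteq> B"
    "\<forall>r. ratfun_defined_at r a \<longrightarrow> e r \<in> B \<and> \<phi> (e r) = j (ratfun_eval r a)"
    "\<forall>\<tau>. ring_hom_on (field_hull (insert \<theta> (range e))) \<tau> \<and> (\<forall>r. \<tau> (e r) = e r) \<and> \<tau> \<theta> \<in> B \<longrightarrow>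
      (\<exists>\<gamma>. ring_hom_on UNIV \<gamma> \<and> bij \<gamma> \<and> (\<forall>c. \<gamma> (j c) = j c) \<and> (\<forall>u\<in>B. \<tau> u \<in> B \<and> \<gamma> (\<phi> u) = \<phi> (\<tau> u)))"
proof -
  note emult = map_poly_hom_on_mult[OF subring_set_UNIV e, simplified]
  note eadd = map_poly_hom_on_add[OF subring_set_UNIV e, simplified]
  note ediff = map_poly_hom_on_diff[OF subring_set_UNIV e, simplified]
  note eD = ring_hom_onD[OF subring_set_UNIV e]
  note jD = ring_hom_onD[OF subring_set_UNIV j]
  define N where "N = field_hull (insert \<theta> (range e))"
  have rE: "subfield_set (range e)" using subfield_range_hom[OF e] by simp
  have N: "N = {poly p \<theta> |p. p \<in> polys_over (range e)}"
    unfolding N_def by (rule simple_algebraic_extension[OF rE \<theta>])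
  have Nsf: "subfield_set N" unfolding N_def by (rule subfield_field_hull)
  have "\<forall>u\<in>U. \<exists>r. u = poly (map_poly e r) \<theta>"
    using U(2) unfolding N_def[symmetric] N polys_over_range[OF e] by blast
  then obtain R where R: "\<And>u. u \<in> U \<Longrightarrow> u = poly (map_poly e (R u)) \<theta>" by metis
  obtain \<mu> where \<mu>: "irreducible \<mu>" "lead_coeff \<mu> = 1" "poly (map_poly e \<mu>) \<theta> = 0"
    and \<mu>dvd: "\<And>q. poly (map_poly e q) \<theta> = 0 \<Longrightarrow> \<mu> dvd q"
    using hom_min_poly[OF e \<theta>] by blast
  \<comment> \<open>The elements of \<open>U\<close> are polynomials in \<open>\<theta>\<close>.
    Avoiding the finitely many poles of their coefficients places \<open>U\<close> in the ring
    \<open>B\<close> generated by \<open>\<theta>\<close> over the functions defined at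
    \<open>a\<close>.\<close>
  define bad where "bad = (\<Union>r\<in>(\<Union>u\<in>U. set (coeffs (R u))). {a. \<not> ratfun_defined_at r a})"
  have "finite bad"
    unfolding bad_def using U(1) ratfun_undefined_finite by blast
  moreover have "infinite {a :: 'a. (\<forall>i. ratfun_defined_at (coeff \<mu> i) a) \<and>
      irreducible (map_poly (\<lambda>r. ratfun_eval r a) \<mu>)}"
    using hilb \<mu>(1) unfolding hilbertian_def by blast
  ultimately obtain a where a: "\<And>i. ratfun_defined_at (coeff \<mu> i) a"
      "irreducible (map_poly (\<lambda>r. ratfun_eval r a) \<mu>)" "a \<notin> bad"
    using infinite_super[of "{a :: 'a. (\<forall>i. ratfun_defined_at (coeff \<mu> i) a) \<and>
      irreducible (map_poly (\<lambda>r. ratfun_eval r a) \<mu>)}" bad] by blast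
  define A where "A = {r. ratfun_defined_at r a}"
  define ev where "ev r = ratfun_eval r a" for r
  have A: "subring_set A" and ev: "ring_hom_on A ev"
    unfolding A_def ev_def by (rule ratfun_defined_hom)+
  note evD = ring_hom_onD[OF A ev]
  have \<mu>A: "\<mu> \<in> polys_over A" using a by (simp add: polys_over_def A_def)
  have RA: "R u \<in> polys_over A" if "u \<in> U" for u
    unfolding polys_over_def
  proof safe
    fix i
    show "coeff (R u) i \<in> A"
    proof (cases "coeff (R u) i = 0")
      case False
      then have "coeff (R u) i \<in> set (coeffs (R u))"
        by (metis coeff_in_coeffs coeff_0 le_degree)
      then show ?thesis using a(3) that unfolding bad_def A_def by auto
    qed (use subring_setD[OF A] in auto)
  qed
  define \<mu>a where "\<mu>a = map_poly ev \<mu>"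
  have \<mu>a: "irreducible \<mu>a" using a(2) unfolding \<mu>a_def ev_def .
  then have "degree \<mu>a > 0" by (metis gr0I irreducible_def is_unit_iff_degree)
  then have "degree (map_poly j \<mu>a) > 0" by (simp add: degree_map_poly_hom[OF j])
  then obtain \<theta>a where \<theta>a: "poly (map_poly j \<mu>a) \<theta>a = 0" using alg_closed_imp_poly_has_root by blast
  define sp where "sp r = poly (map_poly j (map_poly ev r)) \<theta>a" for r
  \<comment> \<open>Every relation of \<open>\<theta>\<close> is a multiple of \<open>\<mu>\<close>.
    As \<open>\<mu>\<close> is monic, the cofactor is again defined at \<open>a\<close>, so the
    relation can be specialized.\<close>
  have sp0: "sp r = 0" if r: "r \<in> polys_over A" "poly (map_poly e r) \<theta> = 0" for r
  proof -
    obtain s where s: "r = \<mu> * s" using \<mu>dvd[OF r(2)] by (elim dvdE)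
    then have "s \<in> polys_over A" using monic_dvd_over[OF A \<mu>A \<mu>(2)] r by simp
    then show ?thesis
      using \<theta>a \<mu>A unfolding sp_def s
      by (simp add: map_poly_hom_on_mult[OF A ev] map_poly_hom_on_mult[OF subring_set_UNIV j] \<mu>a_def)
  qed
  define B where "B = {poly (map_poly e r) \<theta> |r. r \<in> polys_over A}"
  define \<phi> where "\<phi> y = sp (SOME r. r \<in> polys_over A \<and> poly (map_poly e r) \<theta> = y)" for y
  have \<phi>: "\<phi> (poly (map_poly e r) \<theta>) = sp r" if "r \<in> polys_over A" for r
  proof -
    define s where "s = (SOME s. s \<in> polys_over A \<and> poly (map_poly e s) \<theta> = poly (map_poly e r) \<theta>)"
    have s: "s \<in> polys_over A \<and> poly (map_poly e s) \<theta> = poly (map_poly e r) \<theta>"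
      unfolding s_def by (rule someI[of _ r]) (use that in auto)
    have "sp (s - r) = 0"
      using s that by (intro sp0 polys_over_diff[OF A]) (auto simp: ediff)
    then show ?thesis
      using s that unfolding \<phi>_def s_def[symmetric] sp_def
      by (simp add: map_poly_hom_on_diff[OF A ev] map_poly_hom_on_diff[OF subring_set_UNIV j])
  qed
  have constB: "e r \<in> B \<and> \<phi> (e r) = j (ev r)" if "r \<in> A" for r
  proof -
    have "[:r:] \<in> polys_over A" using that by (simp add: polys_over_pCons[OF A] polys_over_0[OF A])
    moreover have "poly (map_poly e [:r:]) \<theta> = e r" by (simp add: map_poly_hom_on_pCons[OF subring_set_UNIV e])
    moreover have "sp [:r:] = j (ev r)"
      by (simp add: sp_def map_poly_hom_on_pCons[OF A ev] map_poly_hom_on_pCons[OF subring_set_UNIV j] evD jD)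
    ultimately show ?thesis using \<phi>[of "[:r:]"] unfolding B_def by force
  qed
  have hB: "ring_hom_on B \<phi>" and sB: "subring_set B"
  proof -
    have c: "x + y \<in> B \<and> x * y \<in> B \<and> - x \<in> B \<and> \<phi> (x + y) = \<phi> x + \<phi> y \<and> \<phi> (x * y) = \<phi> x * \<phi> y"
      if xy: "x \<in> B" "y \<in> B" for x y
    proof -
      obtain p where p: "p \<in> polys_over A" "x = poly (map_poly e p) \<theta>" using xy unfolding B_def by blast
      obtain q where q: "q \<in> polys_over A" "y = poly (map_poly e q) \<theta>" using xy unfolding B_def by blast
      have mem: "p + q \<in> polys_over A" "p * q \<in> polys_over A" "- p \<in> polys_over A"
        using p q by (auto intro: polys_over_add[OF A] polys_over_mult[OF A] polys_over_uminus[OF A])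
      have eqs: "x + y = poly (map_poly e (p + q)) \<theta>" "x * y = poly (map_poly e (p * q)) \<theta>"
        "- x = poly (map_poly e (- p)) \<theta>"
        using ediff[of 0 p] unfolding p q eadd emult by auto
      have "sp (p + q) = sp p + sp q" "sp (p * q) = sp p * sp q"
        unfolding sp_def using p q
        by (simp_all add: map_poly_hom_on_add[OF A ev] map_poly_hom_on_mult[OF A ev]
          map_poly_hom_on_add[OF subring_set_UNIV j] map_poly_hom_on_mult[OF subring_set_UNIV j])
      then have "\<phi> (x + y) = \<phi> x + \<phi> y" "\<phi> (x * y) = \<phi> x * \<phi> y"
        unfolding eqs(1,2) using \<phi>[OF mem(1)] \<phi>[OF mem(2)] \<phi>[OF p(1)] \<phi>[OF q(1)] p q by auto
      moreover have "x + y \<in> B" "x * y \<in> B" "- x \<in> B" unfolding eqs B_def using mem by blast+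
      ultimately show ?thesis by blast
    qed
    have "0 \<in> B" "1 \<in> B" "\<phi> 1 = 1"
      using constB[of 0] constB[of 1] subring_setD[OF A] by (auto simp: eD evD jD)
    with c show "ring_hom_on B \<phi>" "subring_set B" by (auto simp: ring_hom_on_def subring_set_def)
  qed
  have \<theta>1: "[:0, 1:] \<in> polys_over A"
    by (simp add: polys_over_pCons[OF A] polys_over_0[OF A] subring_setD[OF A])
  have \<theta>2: "poly (map_poly e [:0, 1:]) \<theta> = \<theta>" by (simp add: map_poly_hom_on_pCons[OF subring_set_UNIV e] eD)
  have \<theta>B: "\<theta> \<in> B" using \<theta>1 \<theta>2 unfolding B_def by force
  have \<phi>\<theta>: "\<phi> \<theta> = \<theta>a"
    using \<phi>[OF \<theta>1] unfolding \<theta>2 sp_def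
    by (simp add: map_poly_hom_on_pCons[OF A ev] map_poly_hom_on_pCons[OF subring_set_UNIV j] evD jD)
  have UB: "U \<subseteq> B" using R RA unfolding B_def by blast
  have BN: "B \<subseteq> N" unfolding N B_def using polys_over_range[OF e] by auto
  show thesis
  proof (rule that[OF sB hB])
    show "insert \<theta> U \<subseteq> B" using \<theta>B UB by blast
    show "\<forall>r. ratfun_defined_at r a \<longrightarrow> e r \<in> B \<and> \<phi> (e r) = j (ratfun_eval r a)"
      using constB by (auto simp: A_def ev_def)
    have "\<exists>\<gamma>. ring_hom_on UNIV \<gamma> \<and> bij \<gamma> \<and> (\<forall>c. \<gamma> (j c) = j c) \<and> (\<forall>u\<in>B. \<tau> u \<in> B \<and> \<gamma> (\<phi> u) = \<phi> (\<tau> u))"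
      if \<tau>: "ring_hom_on (field_hull (insert \<theta> (range e))) \<tau>" "\<And>r. \<tau> (e r) = e r" "\<tau> \<theta> \<in> B" for \<tau>
    proof -
      have \<tau>N: "ring_hom_on N \<tau>" using \<tau>(1) unfolding N_def .
      note NA = subfield_set_imp_subring[OF Nsf]
      have \<tau>0: "\<tau> 0 = 0" using ring_hom_onD[OF NA \<tau>N] by blast
      have \<theta>N: "insert \<theta> (range e) \<subseteq> N" unfolding N_def by (rule field_hull_superset)
      have \<tau>poly: "\<tau> (poly (map_poly e r) \<theta>) = poly (map_poly e r) (\<tau> \<theta>)" for r
      proof -
        have "map_poly e r \<in> polys_over N"
          using \<theta>N by (auto simp: polys_over_def coeff_map_poly eD)
        then have "\<tau> (poly (map_poly e r) \<theta>) = poly (map_poly \<tau> (map_poly e r)) (\<tau> \<theta>)"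
          using poly_map_poly_hom_on[OF NA \<tau>N, of "map_poly e r" \<theta>] \<theta>N by simp
        also have "map_poly \<tau> (map_poly e r) = map_poly e r"
          using \<tau>(2) by (simp add: map_poly_comp_hom \<tau>0 eD)
        finally show ?thesis .
      qed
      have \<phi>poly: "poly (map_poly e r) (\<tau> \<theta>) \<in> B \<and>
          \<phi> (poly (map_poly e r) (\<tau> \<theta>)) = poly (map_poly j (map_poly ev r)) (\<phi> (\<tau> \<theta>))"
        if r: "r \<in> polys_over A" for r
      proof
        have rB: "map_poly e r \<in> polys_over B"
          using r constB by (auto simp: polys_over_def coeff_map_poly eD)
        then show "poly (map_poly e r) (\<tau> \<theta>) \<in> B" by (rule poly_in_subring[OF sB _ \<tau>(3)])
        have "\<phi> (poly (map_poly e r) (\<tau> \<theta>)) = poly (map_poly \<phi> (map_poly e r)) (\<phi> (\<tau> \<theta>))"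
          by (rule poly_map_poly_hom_on[OF sB hB rB \<tau>(3), symmetric])
        also have "map_poly \<phi> (map_poly e r) = map_poly j (map_poly ev r)"
          using r constB
          by (intro poly_eqI) (auto simp: coeff_map_poly ring_hom_onD[OF sB hB] eD evD jD polys_over_def)
        finally show "\<phi> (poly (map_poly e r) (\<tau> \<theta>)) = poly (map_poly j (map_poly ev r)) (\<phi> (\<tau> \<theta>))" .
      qed
      \<comment> \<open>Both \<open>\<theta>\<close> and \<open>\<tau> \<theta>\<close> are roots of
        \<open>\<mu>\<close>, so both specialize to roots of the irreducible \<open>\<mu>a\<close>,
        and an automorphism carries one value to the other.\<close>
      have "poly (map_poly e \<mu>) (\<tau> \<theta>) = 0" using \<tau>poly[of \<mu>] \<mu>(3) \<tau>0 by simp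
      then have "poly (map_poly j \<mu>a) (\<phi> (\<tau> \<theta>)) = 0"
        using \<phi>poly[OF \<mu>A] ring_hom_onD[OF sB hB] unfolding \<mu>a_def by simp
      then obtain \<gamma> where \<gamma>: "ring_hom_on UNIV \<gamma>" "bij \<gamma>" "\<And>c. \<gamma> (j c) = j c" "\<gamma> \<theta>a = \<phi> (\<tau> \<theta>)"
        using automorphism_exists[OF j \<mu>a \<theta>a _ alg] by blast
      have "\<tau> u \<in> B \<and> \<gamma> (\<phi> u) = \<phi> (\<tau> u)" if u: "u \<in> B" for u
      proof -
        obtain r where r: "r \<in> polys_over A" "u = poly (map_poly e r) \<theta>" using u unfolding B_def by blast
        have "\<gamma> (\<phi> u) = \<gamma> (poly (map_poly j (map_poly ev r)) \<theta>a)" using \<phi>[OF r(1)] r by (simp add: sp_def)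
        also have "\<dots> = poly (map_poly \<gamma> (map_poly j (map_poly ev r))) (\<gamma> \<theta>a)"
          by (rule poly_map_poly_hom_on[OF subring_set_UNIV \<gamma>(1), symmetric]) auto
        also have "map_poly \<gamma> (map_poly j (map_poly ev r)) = map_poly j (map_poly ev r)"
          using \<gamma>(3) by (simp add: map_poly_comp_hom[of \<gamma> j] ring_hom_onD[OF subring_set_UNIV \<gamma>(1)] jD)
        finally show ?thesis using \<phi>poly[OF r(1)] \<tau>poly[of r] r \<gamma>(4) by simp
      qed
      with \<gamma> show ?thesis by blast
    qed
    then show "\<forall>\<tau>. ring_hom_on (field_hull (insert \<theta> (range e))) \<tau> \<and> (\<forall>r. \<tau> (e r) = e r) \<and> \<tau> \<theta> \<in> B \<longrightarrow>
      (\<exists>\<gamma>. ring_hom_on UNIV \<gamma> \<and> bij \<gamma> \<and> (\<forall>c. \<gamma> (j c) = j c) \<and> (\<forall>u\<in>B. \<tau> u \<in> B \<and> \<gamma> (\<phi> u) = \<phi> (\<tau> u)))"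
      by blast
  qed
qed

section \<open>Roots of a pencil as Laurent series\<close>

notation fps_nth (infixl "$" 75) and fls_nth (infixl "$$" 75)

definition poly_fps :: "'c::field poly \<Rightarrow> 'c fps \<Rightarrow> 'c fps" where
  "poly_fps p \<xi> = poly (map_poly fps_const p) \<xi>"

lemma poly_fps_0 [simp]: "poly_fps 0 \<xi> = 0"
  and poly_fps_pCons: "poly_fps (pCons a p) \<xi> = fps_const a + \<xi> * poly_fps p \<xi>"
  by (simp_all add: poly_fps_def map_poly_pCons)

lemma poly_fps_add: "poly_fps (p + q) \<xi> = poly_fps p \<xi> + poly_fps q \<xi>"
  by (induction p q rule: poly_induct2) (simp_all add: poly_fps_pCons algebra_simps flip: fps_const_add)

lemma poly_fps_smult: "poly_fps (smult c p) \<xi> = fps_const c * poly_fps p \<xi>"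
  by (induction p) (simp_all add: poly_fps_pCons algebra_simps flip: fps_const_mult)

lemma poly_fps_mult: "poly_fps (p * q) \<xi> = poly_fps p \<xi> * poly_fps q \<xi>"
  by (induction p) (simp_all add: poly_fps_pCons poly_fps_add poly_fps_smult algebra_simps)

lemma poly_fps_nth_0: "poly_fps p \<xi> $ 0 = poly p (\<xi> $ 0)"
  by (induction p) (simp_all add: poly_fps_pCons)

lemma poly_fps_compose: "\<eta> $ 0 = 0 \<Longrightarrow> poly_fps p \<xi> oo \<eta> = poly_fps p (\<xi> oo \<eta>)"
  by (induction p) (simp_all add: poly_fps_pCons fps_compose_add_distrib fps_compose_mult_distrib)

lemma fps_to_fls_poly_fps: "fps_to_fls (poly_fps p \<xi>) = poly (map_poly fls_const p) (fps_to_fls \<xi>)"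
  by (induction p) (simp_all add: poly_fps_pCons map_poly_pCons fls_times_fps_to_fls fps_const_to_fls)

text \<open>For \<open>T = 1/s\<close> the equation reads \<open>s = f(X) / (X f(X) - g(X))\<close>.
  The right side has a simple zero at \<open>X = z\<close>, because \<open>z\<close> is a simple
  root of \<open>f\<close> and \<open>g\<close> does not vanish there. Expanded at \<open>z\<close>
  it is therefore a power series \<open>G\<close> with a compositional inverse, and
  \<open>\<xi>\<close> is \<open>z\<close> plus this inverse.\<close>

lemma fps_root_of_pencil:
  fixes f g :: "'c::field poly"
  assumes f: "f = [:- z, 1:] * f1" and f1: "poly f1 z \<noteq> 0" and g: "poly g z \<noteq> 0"
  obtains \<xi> where "\<xi> $ 0 = z" "poly_fps f \<xi> = fps_X * (\<xi> * poly_fps f \<xi> - poly_fps g \<xi>)"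
proof -
  define Z where "Z = fps_const z + fps_X"
  have Z0: "Z $ 0 = z" by (simp add: Z_def)
  define N where "N = poly_fps f Z"
  define D where "D = Z * N - poly_fps g Z"
  have N: "N = fps_X * poly_fps f1 Z"
    unfolding N_def f poly_fps_mult by (simp add: poly_fps_pCons Z_def flip: fps_const_neg)
  have D0: "D $ 0 \<noteq> 0" using g by (simp add: D_def N poly_fps_nth_0 Z0)
  define G where "G = N * inverse D"
  have GD: "G * D = N" using D0 by (simp add: G_def mult.assoc inverse_mult_eq_1)
  have G0: "G $ 0 = 0" by (simp add: G_def N)
  have "G = fps_X * (poly_fps f1 Z * inverse D)" by (simp add: G_def N mult.assoc)
  then have "G $ 1 = (poly_fps f1 Z * inverse D) $ 0" by simp
  also have "\<dots> \<noteq> 0" using f1 D0 by (simp add: poly_fps_nth_0 Z0)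
  finally have G1: "G $ 1 \<noteq> 0" .
  define \<eta> where "\<eta> = fps_inv G"
  have \<eta>0: "\<eta> $ 0 = 0" by (simp add: \<eta>_def fps_inv_def)
  have G\<eta>: "G oo \<eta> = fps_X" unfolding \<eta>_def by (rule fps_inv_right[OF G0 G1])
  define \<xi> where "\<xi> = fps_const z + \<eta>"
  have Z\<xi>: "Z oo \<eta> = \<xi>" using \<eta>0 by (simp add: Z_def \<xi>_def fps_compose_add_distrib)
  have "(G oo \<eta>) * (D oo \<eta>) = N oo \<eta>" by (simp add: fps_compose_mult_distrib[OF \<eta>0, symmetric] GD)
  then have "fps_X * (\<xi> * poly_fps f \<xi> - poly_fps g \<xi>) = poly_fps f \<xi>"
    by (simp add: G\<eta> D_def N_def fps_compose_sub_distrib fps_compose_mult_distrib[OF \<eta>0] poly_fps_compose[OF \<eta>0] Z\<xi>)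
  moreover have "\<xi> $ 0 = z" using \<eta>0 by (simp add: \<xi>_def)
  ultimately show thesis using that by metis
qed

section \<open>Constants and coefficientwise automorphisms of Laurent series\<close>

lemma ring_hom_fls_const: "ring_hom_on UNIV (fls_const :: 'c::field \<Rightarrow> 'c fls)"
  by (auto simp: ring_hom_on_def intro: fls_eqI)

definition fls_map :: "('c::field \<Rightarrow> 'c) \<Rightarrow> 'c fls \<Rightarrow> 'c fls" where
  "fls_map \<gamma> w = Abs_fls (\<lambda>n. \<gamma> (w $$ n))"

lemma fls_map_nth:
  assumes "\<gamma> 0 = 0"
  shows "fls_map \<gamma> w $$ n = \<gamma> (w $$ n)"
  unfolding fls_map_def
  by (rule nth_Abs_fls_ex_lower_bound) (use assms in \<open>auto intro!: exI[of _ "fls_subdegree w"]\<close>)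

lemma ring_hom_fls_map:
  assumes \<gamma>: "ring_hom_on UNIV \<gamma>"
  shows "ring_hom_on UNIV (fls_map \<gamma>)"
proof -
  note D = ring_hom_onD[OF subring_set_UNIV \<gamma>]
  note nth = fls_map_nth[of \<gamma>, OF D(1)]
  have nz: "\<gamma> c = 0 \<longleftrightarrow> c = 0" for c
    using ring_hom_on_nonzero[OF subfield_set_UNIV \<gamma>, of c] D(1) by auto
  \<comment> \<open>A coefficient of a product is a finite sum whose range is given by the
    subdegrees, so these have to be preserved; injectivity of \<open>\<gamma>\<close> ensures
    it.\<close>
  have sd: "fls_subdegree (fls_map \<gamma> w) = fls_subdegree w" for w
  proof (cases "w = 0")
    case False
    then show ?thesis by (intro fls_subdegree_eqI) (auto simp: nth nz)
  next
    case True
    then have "fls_map \<gamma> w = 0" by (intro fls_eqI) (simp add: nth D)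
    then show ?thesis using True by simp
  qed
  show ?thesis
    unfolding ring_hom_on_def
  proof (intro conjI ballI)
    show "fls_map \<gamma> 1 = 1" by (intro fls_eqI) (simp add: nth D)
    fix v w :: "'a fls"
    show "fls_map \<gamma> (v + w) = fls_map \<gamma> v + fls_map \<gamma> w" by (intro fls_eqI) (simp add: nth D)
    show "fls_map \<gamma> (v * w) = fls_map \<gamma> v * fls_map \<gamma> w"
      by (intro fls_eqI)
         (simp add: nth D fls_times_nth(2) sd ring_hom_on_sum[OF subring_set_UNIV \<gamma>])
  qed
qed

lemma fls_map_const: "\<gamma> 0 = 0 \<Longrightarrow> fls_map \<gamma> (fls_const c) = fls_const (\<gamma> c)"
  by (intro fls_eqI) (simp add: fls_map_nth)

lemma fls_map_X_inv: "\<gamma> 0 = 0 \<Longrightarrow> \<gamma> 1 = 1 \<Longrightarrow> fls_map \<gamma> fls_X_inv = fls_X_inv"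
  by (intro fls_eqI) (simp add: fls_map_nth)

text \<open>The polynomial already splits over the algebraically closed field of constants, so the
  Laurent series contribute no further root. This is the test for transcendence.\<close>

lemma algebraic_over_fls_const:
  fixes w :: "'c::alg_closed_field fls"
  assumes "poly (map_poly fls_const q) w = 0" "q \<noteq> 0"
  obtains c where "w = fls_const c"
proof -
  obtain A where A: "q = smult (lead_coeff q) (\<Prod>x\<in>#A. [:- x, 1:])"
    using alg_closed_imp_factorization[OF assms(2)] by blast
  note j = ring_hom_fls_const
  note mult = map_poly_hom_on_mult[OF subring_set_UNIV j, simplified]
  have "poly (map_poly fls_const (\<Prod>x\<in>#A. [:- x, 1:])) w = 0 \<Longrightarrow> w \<in> range fls_const"
  proof (induction A)
    case (add a A)
    have "map_poly fls_const (\<Prod>x\<in>#add_mset a A. [:- x, 1:])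
        = map_poly fls_const [:- a, 1:] * map_poly fls_const (\<Prod>x\<in>#A. [:- x, 1:])"
      by (simp only: image_mset_add_mset prod_mset.add_mset mult)
    then have "w = fls_const a \<or> poly (map_poly fls_const (\<Prod>x\<in>#A. [:- x, 1:])) w = 0"
      using add.prems by (simp add: map_poly_pCons del: mult_pCons_left)
    then show ?case using add.IH by blast
  qed (simp add: map_poly_hom_on_1[OF subring_set_UNIV j])
  moreover have "map_poly fls_const q = smult (fls_const (lead_coeff q)) (map_poly fls_const (\<Prod>x\<in>#A. [:- x, 1:]))"
    by (subst A) (simp add: map_poly_hom_on_smult[OF subring_set_UNIV j])
  ultimately have "w \<in> range fls_const" using assms by simp
  then show thesis using that by blast
qed

lemma prod_distinct_roots_dvd:
  fixes P :: "'w::field poly"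
  assumes "finite I" "inj_on x I" "\<And>i. i \<in> I \<Longrightarrow> poly P (x i) = 0"
  shows "(\<Prod>i\<in>I. [:- x i, 1:]) dvd P"
  using assms
proof (induction I rule: finite_induct)
  case (insert a I)
  then have "(\<Prod>i\<in>I. [:- x i, 1:]) dvd P" by simp
  then obtain Q where Q: "P = (\<Prod>i\<in>I. [:- x i, 1:]) * Q" by (elim dvdE)
  have "poly (\<Prod>i\<in>I. [:- x i, 1:]) (x a) \<noteq> 0"
    using insert.hyps insert.prems(1) by (auto simp: poly_prod inj_on_def)
  with Q insert.prems(2)[of a] have "poly Q (x a) = 0" by simp
  then obtain Q' where "Q = [:- x a, 1:] * Q'" by (auto simp: poly_eq_0_iff_dvd elim: dvdE)
  then show ?case using Q insert.hyps by (simp add: mult.left_commute del: mult_pCons_left)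
qed auto

text \<open>One step of the three-term recurrence, with the next diagonal entry as the parameter
  \<open>t\<close>. The same expression is used with \<open>t\<close> generic, as a Laurent series,
  and with \<open>t\<close> in the base field.\<close>

definition pencil :: "'w::comm_ring_1 \<Rightarrow> 'w poly \<Rightarrow> 'w poly \<Rightarrow> 'w poly" where
  "pencil t f g = [:- t, 1:] * f - g"

lemma degree_pencil:
  fixes f :: "'w::field poly"
  assumes "lead_coeff f = 1" "g = 0 \<or> degree g < degree f"
  shows "degree (pencil t f g) = Suc (degree f)" "lead_coeff (pencil t f g) = 1"
proof -
  have f0: "f \<noteq> 0" using assms by auto
  have d: "degree ([:- t, 1:] * f) = Suc (degree f)" using f0 by (subst degree_mult_eq) auto
  have "coeff ([:- t, 1:] * f) (Suc (degree f)) = 1"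
    using lead_coeff_mult[of "[:- t, 1:]" f] d assms(1) by (simp del: mult_pCons_left)
  moreover have "coeff g (Suc (degree f)) = 0" using assms(2) by (auto intro: coeff_eq_0)
  ultimately have c: "coeff (pencil t f g) (Suc (degree f)) = 1" by (simp add: pencil_def del: mult_pCons_left)
  moreover have "degree (pencil t f g) \<le> Suc (degree f)"
    unfolding pencil_def by (rule degree_diff_le) (use d assms(2) in auto)
  ultimately show "degree (pencil t f g) = Suc (degree f)"
    using le_degree[of "pencil t f g" "Suc (degree f)"] by simp
  with c show "lead_coeff (pencil t f g) = 1" by simp
qed

lemma poly_pencil: "poly (pencil t f g) x = (x - t) * poly f x - poly g x"
  by (simp add: pencil_def algebra_simps)

lemma degree_prod_linear: "degree (\<Prod>i\<in>I. [:- x i :: 'w::field, 1:]) = card I"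
  and lead_coeff_prod_linear: "lead_coeff (\<Prod>i\<in>I. [:- x i, 1:]) = 1"
proof -
  show "degree (\<Prod>i\<in>I. [:- x i, 1:]) = card I" by (subst degree_prod_eq_sum_degree) auto
  show "lead_coeff (\<Prod>i\<in>I. [:- x i, 1:]) = 1" by (simp add: lead_coeff_prod)
qed

text \<open>With \<open>T = 1/s\<close>, the pencil \<open>(X - T) f - g\<close> has a root near each root of \<open>f\<close> and one root
  with a pole at \<open>s = 0\<close>.\<close>

lemma pencil_roots:
  fixes f g :: "'c::alg_closed_field poly"
  assumes m: "m > 0" and f: "f = (\<Prod>i<m. [:- z i, 1:])" and z: "inj_on z {..<m}"
    and g: "degree g < m" "\<And>i. i < m \<Longrightarrow> poly g (z i) \<noteq> 0"
  obtains x where "pencil fls_X_inv (map_poly fls_const f) (map_poly fls_const g) = (\<Prod>i<Suc m. [:- x i, 1:])"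
    "inj_on x {..<Suc m}" "\<And>i. i < m \<Longrightarrow> x i $$ 0 = z i" "\<And>i. i < m \<Longrightarrow> x i $$ (-1) = 0" "x m $$ (-1) = 1"
proof -
  note j = ring_hom_fls_const
  define F where "F = pencil fls_X_inv (map_poly fls_const f) (map_poly fls_const g :: 'c fls poly)"
  have df: "degree f = m" "lead_coeff f = 1" using degree_prod_linear[of z "{..<m}"] lead_coeff_prod_linear[of z "{..<m}"]
    unfolding f by auto
  have cf: "degree (map_poly fls_const f) = m" "lead_coeff (map_poly fls_const f) = 1"
    using map_poly_hom_on_monic[OF subring_set_UNIV j df(2)] df by auto
  have dg: "degree (map_poly fls_const g) < m" using g(1) by (simp add: degree_map_poly_hom[OF j])
  have dF: "degree F = Suc m" "lead_coeff F = 1"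
    using degree_pencil[OF cf(2), of "map_poly fls_const g" fls_X_inv] cf dg by (auto simp: F_def)
  have "\<exists>\<xi>. \<xi> $ 0 = z i \<and> poly F (fps_to_fls \<xi>) = 0" if i: "i < m" for i
  proof -
    define f1 where "f1 = (\<Prod>k\<in>{..<m} - {i}. [:- z k, 1:])"
    have "f = [:- z i, 1:] * f1" unfolding f f1_def using i by (intro prod.remove) auto
    moreover have "poly f1 (z i) \<noteq> 0" using z i by (auto simp: f1_def poly_prod inj_on_def)
    ultimately obtain \<xi> where \<xi>: "\<xi> $ 0 = z i" "poly_fps f \<xi> = fps_X * (\<xi> * poly_fps f \<xi> - poly_fps g \<xi>)"
      using fps_root_of_pencil[of f "z i" f1 g] g(2)[OF i] by blast
    define w where "w = fps_to_fls \<xi>"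
    have "poly (map_poly fls_const f) w = fls_X * (w * poly (map_poly fls_const f) w - poly (map_poly fls_const g) w)"
      using arg_cong[OF \<xi>(2), of fps_to_fls]
      by (simp add: w_def fls_times_fps_to_fls fps_to_fls_poly_fps)
    then have "fls_X_inv * poly (map_poly fls_const f) w
        = (fls_X_inv * fls_X) * (w * poly (map_poly fls_const f) w - poly (map_poly fls_const g) w)"
      by (metis mult.assoc)
    also have "fls_X_inv * fls_X = (1 :: 'c fls)" by (simp add: fls_X_inv_times_conv_shift)
    finally have "poly F w = 0" by (simp add: F_def poly_pencil algebra_simps)
    with \<xi> show ?thesis unfolding w_def by blast
  qed
  then obtain \<xi> where \<xi>: "\<And>i. i < m \<Longrightarrow> \<xi> i $ 0 = z i" "\<And>i. i < m \<Longrightarrow> poly F (fps_to_fls (\<xi> i)) = 0" by metis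
  define x0 where "x0 i = fps_to_fls (\<xi> i)" for i
  define P where "P = (\<Prod>i<m. [:- x0 i, 1:])"
  have inj0: "inj_on x0 {..<m}"
    using z by (auto simp: inj_on_def x0_def) (metis \<xi>(1) lessThan_iff)
  \<comment> \<open>The \<open>m\<close> power series are distinct roots because their constant
    terms \<open>z i\<close> are distinct. A single linear factor is left, whose root
    \<open>y\<close> is the one with the pole.\<close>
  have "P dvd F" unfolding P_def using \<xi>(2) by (intro prod_distinct_roots_dvd inj0) (auto simp: x0_def)
  then obtain Q where Q: "F = P * Q" by (elim dvdE)
  have dP: "degree P = m" "lead_coeff P = 1"
    using degree_prod_linear[of x0 "{..<m}"] lead_coeff_prod_linear[of x0 "{..<m}"] unfolding P_def by auto
  have "F \<noteq> 0" "P \<noteq> 0" using dF dP by auto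
  then have "Q \<noteq> 0" using Q by auto
  then have dQ: "degree Q = 1"
    using dF dP Q \<open>P \<noteq> 0\<close> by (auto simp: degree_mult_eq)
  have lQ: "lead_coeff Q = 1"
    using lead_coeff_mult[of P Q] unfolding Q[symmetric] dF(2) dP(2) by simp
  obtain y where y: "Q = [:- y, 1:]"
  proof -
    obtain a b where "Q = [:a, b:]" using degree1_coeffs[OF dQ] by blast
    moreover from this dQ lQ have "b = 1" by (auto split: if_splits)
    ultimately show thesis using that[of "- a"] by simp
  qed
  define x where "x = x0(m := y)"
  have FX: "F = (\<Prod>i<Suc m. [:- x i, 1:])"
  proof -
    have "(\<Prod>i<Suc m. [:- x i, 1:]) = (\<Prod>i<m. [:- x i, 1:]) * [:- x m, 1:]" by simp
    also have "(\<Prod>i<m. [:- x i, 1:]) = P" unfolding P_def by (intro prod.cong) (auto simp: x_def)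
    finally show ?thesis using Q y by (simp add: x_def)
  qed
  define A where "A = range (fps_to_fls :: 'c fps \<Rightarrow> _)"
  have A: "subring_set A"
    unfolding subring_set_def A_def
    by (auto simp flip: fps_to_fls_plus fls_times_fps_to_fls fps_to_fls_uminus
        intro: range_eqI[of _ _ 0] range_eqI[of _ _ 1])
  \<comment> \<open>Comparing the coefficients of \<open>X ^ m\<close> amounts to comparing sums of
    roots: \<open>y\<close> equals \<open>T\<close> up to a power series, since the other roots are
    power series.\<close>
  have ym: "y $$ (-1) = 1"
  proof -
    obtain k where k: "m = Suc k" using m gr0_implies_Suc by blast
    have lc: "coeff P m = 1" "coeff (map_poly fls_const f) m = 1" using dP cf by auto
    have "coeff F m = coeff P (m - 1) - y"
    proof -
      have "coeff F m = coeff (pCons 0 P - smult y P) m" by (simp add: Q y mult.commute)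
      also have "\<dots> = coeff P (m - 1) - y" using lc by (simp add: k)
      finally show ?thesis .
    qed
    moreover have "coeff F m = fls_const (coeff f (m - 1)) - fls_X_inv"
    proof -
      have "coeff F m = coeff (pCons 0 (map_poly fls_const f) - smult fls_X_inv (map_poly fls_const f)) m - coeff (map_poly fls_const g) m"
        by (simp add: F_def pencil_def)
      also have "coeff (map_poly fls_const g) m = 0" using dg by (rule coeff_eq_0)
      also have "coeff (pCons 0 (map_poly fls_const f) - smult fls_X_inv (map_poly fls_const f)) m
          = coeff (map_poly fls_const f) (m - 1) - fls_X_inv"
        using lc by (simp add: k)
      finally show ?thesis by (simp add: coeff_map_poly)
    qed
    ultimately have "y = coeff P (m - 1) - fls_const (coeff f (m - 1)) + fls_X_inv"
      by (simp add: algebra_simps)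
    moreover have "- x0 i \<in> A" for i using subring_setD(3)[OF A] by (simp add: A_def x0_def)
    then have "P \<in> polys_over A"
      unfolding P_def
      by (intro polys_over_prod[OF A])
         (simp add: polys_over_pCons[OF A] polys_over_0[OF A] subring_setD[OF A])
    then obtain q where "coeff P (m - 1) = fps_to_fls q" using polys_overD[of P A "m - 1"] by (auto simp: A_def)
    ultimately show ?thesis by simp
  qed
  show thesis
  proof (rule that[of x])
    show "pencil fls_X_inv (map_poly fls_const f) (map_poly fls_const g) = (\<Prod>i<Suc m. [:- x i, 1:])"
      using FX by (simp add: F_def)
    show xm: "x m $$ (-1) = 1" using ym by (simp add: x_def)
    show x1: "x i $$ (-1) = 0" "x i $$ 0 = z i" if "i < m" for i
      using \<xi>(1)[OF that] that by (auto simp: x_def x0_def)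
    show "inj_on x {..<Suc m}"
      using inj0 x1(1) xm by (auto simp: inj_on_def x_def less_Suc_eq)
  qed
qed

section \<open>Adjoining one root: the generic member of the pencil\<close>

text \<open>The Galois group is represented by automorphisms of the whole ambient field instead of a
  splitting field. They can therefore be restricted later to any stable subset, in particular to the
  Galois closure of a subextension.\<close>

definition full_symmetric :: "'c::field set \<Rightarrow> 'c poly \<Rightarrow> nat \<Rightarrow> (nat \<Rightarrow> 'c) \<Rightarrow> bool" where
  "full_symmetric C f m z \<longleftrightarrow> f = (\<Prod>i<m. [:- z i, 1:]) \<and> inj_on z {..<m} \<and>
     (\<forall>\<sigma>. \<sigma> permutes {..<m} \<longrightarrow>
        (\<exists>\<gamma>. ring_hom_on UNIV \<gamma> \<and> bij \<gamma> \<and> (\<forall>c\<in>C. \<gamma> c = c) \<and> (\<forall>i<m. \<gamma> (z i) = z (\<sigma> i))))"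

lemma subfield_preimage:
  assumes D: "subfield_set D" and \<tau>: "ring_hom_on D \<tau>" and M: "subfield_set M"
  shows "subfield_set {u \<in> D. \<tau> u \<in> M}"
proof -
  note A = subfield_set_imp_subring[OF D] and B = subfield_set_imp_subring[OF M]
  show ?thesis
    unfolding subfield_set_def subring_set_def
    by (auto simp: ring_hom_onD[OF A \<tau>] ring_hom_on_inverse[OF D \<tau>] subring_setD[OF A] subring_setD[OF B]
        subfield_setD[OF D] subfield_setD[OF M])
qed

lemma subfield_fixed:
  assumes D: "subfield_set D" and \<tau>: "ring_hom_on D \<tau>"
  shows "subfield_set {u \<in> D. \<tau> u = u}"
proof -
  note A = subfield_set_imp_subring[OF D]
  show ?thesis
    unfolding subfield_set_def subring_set_def
    by (auto simp: ring_hom_onD[OF A \<tau>] ring_hom_on_inverse[OF D \<tau>] subring_setD[OF A] subfield_setD[OF D])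
qed

lemma pencil_polys_over:
  assumes A: "subring_set A" and "t \<in> A" "f \<in> polys_over A" "g \<in> polys_over A"
  shows "pencil t f g \<in> polys_over A"
  unfolding pencil_def using assms(2-)
  by (intro polys_over_diff[OF A] polys_over_mult[OF A])
     (auto simp: polys_over_pCons[OF A] polys_over_0[OF A] subring_setD[OF A])

lemma map_poly_fixed: "\<tau> 0 = 0 \<Longrightarrow> p \<in> polys_over {u \<in> D. \<tau> u = u} \<Longrightarrow> map_poly \<tau> p = p"
  by (intro poly_eqI) (auto simp: coeff_map_poly polys_over_def)

lemma permutes_fixing_last:
  assumes "\<rho> permutes {..<Suc m}" "\<rho> m = m"
  shows "\<rho> permutes {..<m}"
  using assms unfolding permutes_def by (metis lessThan_iff less_Suc_eq)

text \<open>A permutation \<open>\<sigma>\<close> is composed of two automorphisms of different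
  origin. The isomorphism over the constants that sends \<open>x m\<close> to
  \<open>x (\<sigma> m)\<close> fixes \<open>T\<close> and prolongs to the splitting field, where it
  induces some \<open>\<pi>\<close> with \<open>\<pi> m = \<sigma> m\<close>. The remaining factor
  fixes \<open>m\<close>, and an automorphism of the constants induces it by acting on the
  coefficients of the series.\<close>

theorem generic_pencil_symmetric:
  fixes f g :: "'c::alg_closed_field poly"
  assumes full: "full_symmetric C f m z" and m: "m > 0"
    and fg: "f \<in> polys_over (field_hull C)" "g \<in> polys_over (field_hull C)"
    and g: "degree g < m" "\<And>i. i < m \<Longrightarrow> poly g (z i) \<noteq> 0"
  obtains x where "pencil fls_X_inv (map_poly fls_const f) (map_poly fls_const g) = (\<Prod>i<Suc m. [:- x i, 1:])"
    "inj_on x {..<Suc m}"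
    "\<forall>\<sigma>. \<sigma> permutes {..<Suc m} \<longrightarrow>
       (\<exists>\<tau>. ring_hom_on (field_hull (insert fls_X_inv (fls_const ` C) \<union> x ` {..<Suc m})) \<tau> \<and>
         (\<forall>u\<in>field_hull (insert fls_X_inv (fls_const ` C)). \<tau> u = u) \<and> (\<forall>i<Suc m. \<tau> (x i) = x (\<sigma> i)))"
proof -
  note j = ring_hom_fls_const
  note jD = ring_hom_onD[OF subring_set_UNIV j]
  have f: "f = (\<Prod>i<m. [:- z i, 1:])" and z: "inj_on z {..<m}"
    and sym: "\<And>\<sigma>. \<sigma> permutes {..<m} \<Longrightarrow>
      \<exists>\<gamma>. ring_hom_on UNIV \<gamma> \<and> bij \<gamma> \<and> (\<forall>c\<in>C. \<gamma> c = c) \<and> (\<forall>i<m. \<gamma> (z i) = z (\<sigma> i))"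
    using full unfolding full_symmetric_def by blast+
  define T :: "'c fls" where "T = fls_X_inv"
  define F where "F = pencil T (map_poly fls_const f) (map_poly fls_const g)"
  obtain x where F: "F = (\<Prod>i<Suc m. [:- x i, 1:])" and x: "inj_on x {..<Suc m}"
    and x0: "\<And>i. i < m \<Longrightarrow> x i $$ 0 = z i" "\<And>i. i < m \<Longrightarrow> x i $$ (-1) = 0" and xm: "x m $$ (-1) = 1"
    using pencil_roots[OF m f z g] unfolding F_def T_def by metis
  define S0 where "S0 = insert T (fls_const ` C)"
  define E1 where "E1 = field_hull S0"
  define N where "N = field_hull (S0 \<union> x ` {..<Suc m})"
  have E1N: "E1 \<subseteq> N" unfolding E1_def N_def by (intro field_hull_mono) auto
  have Nsf: "subfield_set N" unfolding N_def by (rule subfield_field_hull)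
  have roots: "\<exists>k<Suc m. y = x k" if "poly F y = 0" for y
    using that unfolding F poly_prod by (auto simp: prod_zero_iff less_Suc_eq)
  have Fx: "poly F (x k) = 0" if "k < Suc m" for k
    unfolding F poly_prod using that by (intro prod_zero) auto
  have constpoly: "poly (map_poly fls_const p) (fls_const c) = fls_const (poly p c)"
    for p :: "'c poly" and c
    using poly_map_poly_hom_on[OF subring_set_UNIV j, of p c] by simp
  have fls_m1: "fls_const c $$ (-1) = 0" "fls_const c $$ 0 = c" for c :: 'c by simp_all
  \<comment> \<open>A root algebraic over the constants would be constant, hence without pole and
    equal to some \<open>z k\<close>. There \<open>f\<close> vanishes, and the equation of the
    pencil would make \<open>g\<close> vanish too.\<close>
  have trans: "transcendental_over_hom fls_const (x k)" if k: "k < Suc m" for k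
    unfolding transcendental_over_hom_def
  proof (intro allI impI)
    fix q assume q: "poly (map_poly fls_const q) (x k) = 0"
    show "q = 0"
    proof (rule ccontr)
      assume "q \<noteq> 0"
      then obtain c where c: "x k = fls_const c" using algebraic_over_fls_const[OF q] by blast
      have "k \<noteq> m" using xm fls_m1(1)[of c] c by (metis zero_neq_one)
      then have "k < m" using k by simp
      then have "c = z k" using x0(1)[of k] fls_m1(2)[of c] unfolding c by simp
      have "poly f c = 0" unfolding \<open>c = z k\<close> f poly_prod using \<open>k < m\<close> by (intro prod_zero) auto
      then have "poly g c = 0"
        using Fx[OF k] by (simp add: F_def poly_pencil c constpoly)
      then show False using g(2)[OF \<open>k < m\<close>] \<open>c = z k\<close> by simp
    qed
  qed
  have f0: "f \<noteq> 0" unfolding f by simp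
  define e where "e k = ratfun_hom fls_const (x k)" for k
  have e: "ring_hom_on UNIV (e k)" if "k < Suc m" for k
    unfolding e_def by (rule ratfun_hom_hom[OF j trans[OF that]])
  have econst: "e k (Fraction_Field.Fract [:c:] 1) = fls_const c"
    and eX: "e k (Fraction_Field.Fract [:0, 1:] 1) = x k" if "k < Suc m" for k c
    unfolding e_def using ratfun_hom_const[OF j trans[OF that]] ratfun_hom_indeterminate[OF j trans[OF that]] by auto
  have eT: "e k (Fraction_Field.Fract ([:0, 1:] * f - g) f) = T" if k: "k < Suc m" for k
  proof -
    have nz: "poly (map_poly fls_const f) (x k) \<noteq> 0"
      using trans[OF k] f0 unfolding transcendental_over_hom_def by blast
    have "e k (Fraction_Field.Fract ([:0, 1:] * f - g) f)
        = poly (map_poly fls_const ([:0, 1:] * f - g)) (x k) / poly (map_poly fls_const f) (x k)"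
      unfolding e_def by (rule ratfun_hom_Fract[OF j trans[OF k] f0])
    also have "poly (map_poly fls_const ([:0, 1:] * f - g)) (x k)
        = x k * poly (map_poly fls_const f) (x k) - poly (map_poly fls_const g) (x k)"
      using map_poly_hom_on_diff[OF subring_set_UNIV j, of "[:0, 1:] * f" g]
        map_poly_hom_on_mult[OF subring_set_UNIV j, of "[:0, 1:]" f]
      by (simp add: map_poly_pCons)
    also have "\<dots> / poly (map_poly fls_const f) (x k) = T"
      using Fx[OF k] nz unfolding F_def poly_pencil by (simp add: field_simps)
    finally show ?thesis .
  qed
  have "\<forall>\<sigma>. \<sigma> permutes {..<Suc m} \<longrightarrow> (\<exists>\<tau>. ring_hom_on N \<tau> \<and> (\<forall>u\<in>E1. \<tau> u = u) \<and> (\<forall>i<Suc m. \<tau> (x i) = x (\<sigma> i)))"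
  proof (intro allI impI)
    fix \<sigma> assume \<sigma>: "\<sigma> permutes {..<Suc m}"
    define k where "k = \<sigma> m"
    have k: "k < Suc m" using permutes_in_image[OF \<sigma>, of m] by (simp add: k_def)
    define Em where "Em = range (e m)"
    have em: "ring_hom_on UNIV (e m)" and ek: "ring_hom_on UNIV (e k)" using e k by auto
    have Em: "subfield_set Em" unfolding Em_def using subfield_range_hom[OF em] by simp
    \<comment> \<open>This is the isomorphism between the fields generated by \<open>x m\<close> and
      by \<open>x k\<close> over the constants. It fixes \<open>T\<close>, which is the same
      rational function of both generators.\<close>
    define \<tau>0 where "\<tau>0 u = e k (inv_into UNIV (e m) u)" for u
    have inje: "inj (e m)" using ring_hom_on_eq_iff[OF subfield_set_UNIV em] by (auto simp: inj_def)
    have \<tau>0: "\<tau>0 (e m r) = e k r" for r unfolding \<tau>0_def by (simp add: inv_into_f_f[OF inje])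
    have h0: "ring_hom_on Em \<tau>0"
      unfolding ring_hom_on_def
    proof (intro conjI ballI)
      note Dm = ring_hom_onD[OF subring_set_UNIV em] and Dk = ring_hom_onD[OF subring_set_UNIV ek]
      show "\<tau>0 1 = 1" using \<tau>0[of 1] Dm(2) Dk(2) by simp
      fix u v assume "u \<in> Em" "v \<in> Em"
      then obtain r s where rs: "u = e m r" "v = e m s" unfolding Em_def by blast
      show "\<tau>0 (u + v) = \<tau>0 u + \<tau>0 v"
        using \<tau>0[of "r + s"] by (simp add: rs \<tau>0 Dm Dk)
      show "\<tau>0 (u * v) = \<tau>0 u * \<tau>0 v"
        using \<tau>0[of "r * s"] by (simp add: rs \<tau>0 Dm Dk)
    qed
    obtain D \<tau> where D: "subfield_set D" "Em \<subseteq> D" "ring_hom_on D \<tau>" "\<And>u. u \<in> Em \<Longrightarrow> \<tau> u = \<tau>0 u"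
      "\<And>p y. p \<in> polys_over D \<Longrightarrow> p \<noteq> 0 \<Longrightarrow> poly p y = 0 \<Longrightarrow> root_closed (map_poly \<tau> p) \<Longrightarrow> y \<in> D"
      using hom_extension[OF Em h0] by blast
    note DA = subfield_set_imp_subring[OF D(1)]
    have \<tau>e: "\<tau> (e m r) = e k r" for r using D(4)[of "e m r"] \<tau>0 by (simp add: Em_def)
    define Fix where "Fix = {u \<in> D. \<tau> u = u}"
    have Fix: "subfield_set Fix" unfolding Fix_def by (rule subfield_fixed[OF D(1,3)])
    have constFix: "fls_const c \<in> Fix" for c
    proof -
      have "fls_const c \<in> Em" unfolding Em_def using econst[of m c] by (metis lessI rangeI)
      then show ?thesis unfolding Fix_def using D(2) \<tau>e[of "Fraction_Field.Fract [:c:] 1"] econst k by auto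
    qed
    have TFix: "T \<in> Fix"
    proof -
      have "T \<in> Em" unfolding Em_def using eT[of m] by (metis lessI rangeI)
      then show ?thesis unfolding Fix_def using D(2) \<tau>e[of "Fraction_Field.Fract ([:0, 1:] * f - g) f"] eT k by auto
    qed
    have FFix: "F \<in> polys_over Fix"
      unfolding F_def using constFix TFix
      by (intro pencil_polys_over subfield_set_imp_subring[OF Fix]) (auto simp: polys_over_def coeff_map_poly)
    then have FD: "F \<in> polys_over D" unfolding Fix_def by (auto simp: polys_over_def)
    have \<tau>z: "\<tau> 0 = 0" using ring_hom_onD[OF DA D(3)] by blast
    have \<tau>F: "map_poly \<tau> F = F" by (rule map_poly_fixed[OF \<tau>z FFix[unfolded Fix_def]])
    \<comment> \<open>The coefficients of \<open>F\<close> are fixed by \<open>\<tau>\<close>, so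
      the image of \<open>F\<close> is again a product of linear factors; this puts all roots into
      the maximal domain.\<close>
    have xD: "x i \<in> D" if i: "i < Suc m" for i
    proof (rule D(5)[OF FD _ Fx[OF i]])
      show "F \<noteq> 0" unfolding F by (metis lead_coeff_prod_linear coeff_0 zero_neq_one)
      show "root_closed (map_poly \<tau> F)" unfolding \<tau>F unfolding F by (rule root_closed_prod) simp
    qed
    have "\<forall>i. \<exists>l. i < Suc m \<longrightarrow> l < Suc m \<and> \<tau> (x i) = x l"
    proof
      fix i
      show "\<exists>l. i < Suc m \<longrightarrow> l < Suc m \<and> \<tau> (x i) = x l"
      proof (cases "i < Suc m")
        case True
        have "poly F (\<tau> (x i)) = 0"
          using poly_map_poly_hom_on[OF DA D(3) FD xD[OF True]] Fx[OF True] \<tau>F \<tau>z by simp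
        then show ?thesis using roots by blast
      qed auto
    qed
    then obtain \<pi>0 where \<pi>0: "\<And>i. i < Suc m \<Longrightarrow> \<pi>0 i < Suc m \<and> \<tau> (x i) = x (\<pi>0 i)" by metis
    define \<pi> where "\<pi> i = (if i < Suc m then \<pi>0 i else i)" for i
    have \<pi>1: "\<pi> i < Suc m" "\<tau> (x i) = x (\<pi> i)" if "i < Suc m" for i
      using \<pi>0[OF that] that by (auto simp: \<pi>_def)
    have "inj_on \<pi> {..<Suc m}"
    proof (rule inj_onI)
      fix a b assume ab: "a \<in> {..<Suc m}" "b \<in> {..<Suc m}" "\<pi> a = \<pi> b"
      then have "\<tau> (x a) = \<tau> (x b)" using \<pi>1 by simp
      then have "x a = x b" using ring_hom_on_eq_iff[OF D(1,3)] xD ab by auto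
      then show "a = b" using x ab by (auto dest: inj_onD)
    qed
    moreover have "\<pi> ` {..<Suc m} \<subseteq> {..<Suc m}" using \<pi>1 by auto
    ultimately have "bij_betw \<pi> {..<Suc m} {..<Suc m}" by (simp add: bij_betw_def endo_inj_surj)
    then have \<pi>: "\<pi> permutes {..<Suc m}" by (intro bij_imp_permutes) (auto simp: \<pi>_def)
    have \<pi>m: "\<pi> m = k"
    proof -
      have "x (\<pi> m) = x k" using \<pi>1(2)[of m] \<tau>e[of "Fraction_Field.Fract [:0, 1:] 1"] eX k by simp
      then show ?thesis using inj_onD[OF x] \<pi>1(1)[of m] k by auto
    qed
    \<comment> \<open>So that \<open>\<sigma> = \<pi> \<circ> \<rho>\<close> with
      \<open>\<rho> m = m\<close>: the part of \<open>\<sigma>\<close> not yet realized only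
      permutes the roots without pole.\<close>
    define \<rho> where "\<rho> = inv_into UNIV \<pi> \<circ> \<sigma>"
    have \<rho>S: "\<rho> permutes {..<Suc m}" unfolding \<rho>_def by (rule permutes_compose[OF \<sigma> permutes_inv[OF \<pi>]])
    have \<pi>\<rho>: "\<pi> (\<rho> i) = \<sigma> i" for i unfolding \<rho>_def using permutes_inverses(1)[OF \<pi>] by simp
    have "\<rho> m = m"
      using \<pi>\<rho>[of m] \<pi>m permutes_inj[OF \<pi>] unfolding k_def by (metis injD)
    then have \<rho>: "\<rho> permutes {..<m}" by (rule permutes_fixing_last[OF \<rho>S])
    obtain \<gamma> where \<gamma>: "ring_hom_on UNIV \<gamma>" "\<forall>c\<in>C. \<gamma> c = c" "\<forall>i<m. \<gamma> (z i) = z (\<rho> i)"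
      using sym[OF \<rho>] by blast
    note \<gamma>D = ring_hom_onD[OF subring_set_UNIV \<gamma>(1)]
    define h where "h = fls_map \<gamma>"
    have h: "ring_hom_on UNIV h" unfolding h_def by (rule ring_hom_fls_map[OF \<gamma>(1)])
    have hnth: "h w $$ n = \<gamma> (w $$ n)" for w n unfolding h_def by (rule fls_map_nth) (rule \<gamma>D(1))
    have hconst: "h (fls_const c) = fls_const (\<gamma> c)" for c unfolding h_def by (rule fls_map_const) (rule \<gamma>D(1))
    have hT: "h T = T" unfolding h_def T_def by (rule fls_map_X_inv) (use \<gamma>D in auto)
    have "field_hull C \<subseteq> {u \<in> UNIV. \<gamma> u = u}"
      using \<gamma>(2) by (intro field_hull_minimal subfield_fixed[OF subfield_set_UNIV \<gamma>(1)]) auto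
    then have \<gamma>hull: "\<gamma> c = c" if "c \<in> field_hull C" for c using that by auto
    have hF: "map_poly h F = F"
    proof -
      have "F \<in> polys_over {u \<in> UNIV. h u = u}"
        unfolding F_def using hT fg \<gamma>hull hconst
        by (intro pencil_polys_over subfield_set_imp_subring[OF subfield_fixed[OF subfield_set_UNIV h]])
           (auto simp: polys_over_def coeff_map_poly)
      then show ?thesis using ring_hom_onD(1)[OF subring_set_UNIV h] map_poly_fixed by blast
    qed
    \<comment> \<open>\<open>h\<close> permutes the roots while acting on each coefficient: the pole
      singles out \<open>x m\<close>, and the constant terms \<open>z i\<close>, permuted by
      \<open>\<rho>\<close>, identify the others.\<close>
    have hx: "h (x i) = x (\<rho> i)" if i: "i < Suc m" for i
    proof -
      have "poly F (h (x i)) = 0"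
        using poly_map_poly_hom_on[OF subring_set_UNIV h, of F "x i"] Fx[OF i] hF
          ring_hom_onD[OF subring_set_UNIV h] by simp
      then obtain l where l: "l < Suc m" "h (x i) = x l" using roots by blast
      show ?thesis
      proof (cases "i = m")
        case True
        then have "x l $$ (-1) = 1" using hnth[of "x i" "-1"] l xm \<gamma>D by simp
        then have "l = m" using x0(2)[of l] l(1) by (cases "l = m") auto
        with True l \<open>\<rho> m = m\<close> show ?thesis by simp
      next
        case False
        then have im: "i < m" using i by simp
        then have "x l $$ (-1) = 0" using hnth[of "x i" "-1"] l x0 \<gamma>D by simp
        then have "l < m" using xm l(1) by (cases "l = m") auto
        have "x l $$ 0 = z (\<rho> i)" using hnth[of "x i" 0] l(2) x0(1)[OF im] \<gamma>(3) im by simp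
        then have "z l = z (\<rho> i)" using x0(1)[OF \<open>l < m\<close>] by simp
        moreover have "\<rho> i < m" using permutes_in_image[OF \<rho>, of i] im by simp
        ultimately have "l = \<rho> i" using inj_onD[OF z] \<open>l < m\<close> by auto
        with l show ?thesis by simp
      qed
    qed
    have S0D: "S0 \<subseteq> Fix" unfolding S0_def using TFix constFix by auto
    then have E1Fix: "E1 \<subseteq> Fix" unfolding E1_def by (rule field_hull_minimal[OF _ Fix])
    have ND: "N \<subseteq> D"
      unfolding N_def using S0D xD Fix_def by (intro field_hull_minimal D(1)) auto
    \<comment> \<open>\<open>h\<close> maps the generators of \<open>N\<close> into
      \<open>N\<close>, hence \<open>N\<close> into itself; only then is \<open>\<tau>\<close>
      applied to elements of its domain in the composite.\<close>
    have "S0 \<union> x ` {..<Suc m} \<subseteq> {u \<in> UNIV. h u \<in> N}"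
    proof -
      have sup: "S0 \<union> x ` {..<Suc m} \<subseteq> N" unfolding N_def by (rule field_hull_superset)
      have "h u = u" if "u \<in> S0" for u using that hT hconst \<gamma>(2) unfolding S0_def by auto
      moreover have "h (x i) \<in> N" if "i < Suc m" for i
        using hx[OF that] sup permutes_in_image[OF \<rho>S, of i] that by auto
      ultimately show ?thesis using sup by auto
    qed
    then have "N \<subseteq> {u \<in> UNIV. h u \<in> N}"
      using field_hull_minimal[OF _ subfield_preimage[OF subfield_set_UNIV h Nsf]] N_def by blast
    then have hN: "h u \<in> D" if "u \<in> N" for u using that ND by auto
    have hE1: "h u = u" if "u \<in> E1" for u
    proof -
      have "S0 \<subseteq> {u \<in> UNIV. h u = u}" using hT hconst \<gamma>(2) unfolding S0_def by auto
      then have "E1 \<subseteq> {u \<in> UNIV. h u = u}"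
        unfolding E1_def by (rule field_hull_minimal[OF _ subfield_fixed[OF subfield_set_UNIV h]])
      then show ?thesis using that by auto
    qed
    have "ring_hom_on N (\<lambda>u. \<tau> (h u))"
      using hN h D(3) by (auto simp: ring_hom_on_def)
    moreover have "\<tau> (h u) = u" if "u \<in> E1" for u
      using hE1[OF that] E1Fix that unfolding Fix_def by auto
    moreover have "\<tau> (h (x i)) = x (\<sigma> i)" if "i < Suc m" for i
      using hx[OF that] \<pi>1(2)[of "\<rho> i"] permutes_in_image[OF \<rho>S, of i] that \<pi>\<rho> by auto
    ultimately show "\<exists>\<tau>. ring_hom_on N \<tau> \<and> (\<forall>u\<in>E1. \<tau> u = u) \<and> (\<forall>i<Suc m. \<tau> (x i) = x (\<sigma> i))"
      by (intro exI[of _ "\<lambda>u. \<tau> (h u)"]) blast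
  qed
  then show thesis
    using that[OF F[unfolded F_def T_def] x] unfolding N_def E1_def S0_def T_def by blast
qed

section \<open>Specializing the pencil\<close>

lemma ring_hom_on_inv:
  assumes \<rho>: "ring_hom_on UNIV \<rho>" "bij \<rho>"
  shows "ring_hom_on UNIV (inv_into UNIV \<rho>)"
proof -
  note D = ring_hom_onD[OF subring_set_UNIV \<rho>(1)]
  have l: "inv_into UNIV \<rho> (\<rho> u) = u" for u using \<rho>(2) by (simp add: bij_is_inj)
  have r: "\<rho> (inv_into UNIV \<rho> u) = u" for u using \<rho>(2) by (simp add: bij_is_surj surj_f_inv_f)
  show ?thesis
    unfolding ring_hom_on_def
  proof (intro conjI ballI)
    show "inv_into UNIV \<rho> 1 = 1" using l[of 1] D by simp
    fix x y
    show "inv_into UNIV \<rho> (x + y) = inv_into UNIV \<rho> x + inv_into UNIV \<rho> y"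
      using l[of "inv_into UNIV \<rho> x + inv_into UNIV \<rho> y"] by (simp add: D r)
    show "inv_into UNIV \<rho> (x * y) = inv_into UNIV \<rho> x * inv_into UNIV \<rho> y"
      using l[of "inv_into UNIV \<rho> x * inv_into UNIV \<rho> y"] by (simp add: D r)
  qed
qed

text \<open>For the irreducible polynomial \<open>X\<close> the Hilbert property already names an
  infinite subset of the field.\<close>

lemma hilbertian_infinite:
  assumes "hilbertian TYPE('a::field)"
  shows "infinite (UNIV :: 'a set)"
proof -
  have "irreducible [:0, 1 :: 'a poly fract:]" by (rule irreducible_linear_field_poly) simp
  then have "infinite {a :: 'a. (\<forall>i. ratfun_defined_at (coeff [:0, 1:] i) a) \<and>
      irreducible (map_poly (\<lambda>r. ratfun_eval r a) [:0, 1:])}"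
    using assms unfolding hilbertian_def by blast
  then show ?thesis by (rule infinite_super[OF subset_UNIV])
qed

lemma map_poly_pencil:
  assumes A: "subring_set A" and \<tau>: "ring_hom_on A \<tau>" and "t \<in> A" "f \<in> polys_over A" "g \<in> polys_over A"
  shows "map_poly \<tau> (pencil t f g) = pencil (\<tau> t) (map_poly \<tau> f) (map_poly \<tau> g)"
proof -
  have "[:- t, 1:] \<in> polys_over A"
    using assms(3) by (simp add: polys_over_pCons[OF A] polys_over_0[OF A] subring_setD[OF A])
  moreover have "map_poly \<tau> [:- t, 1:] = [:- \<tau> t, 1:]"
    using assms(3) by (simp add: map_poly_hom_on_pCons[OF A \<tau>] ring_hom_onD[OF A \<tau>])
  ultimately show ?thesis
    unfolding pencil_def using assms(4,5)
    by (simp only: map_poly_hom_on_diff[OF A \<tau>] map_poly_hom_on_mult[OF A \<tau>] polys_over_mult[OF A])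
qed

lemma subring_set_Int: "subring_set A \<Longrightarrow> subring_set B \<Longrightarrow> subring_set (A \<inter> B)"
  by (auto simp: subring_set_def)

lemma algebraic_over_mono: "algebraic_over E x \<Longrightarrow> E \<subseteq> E' \<Longrightarrow> algebraic_over E' x"
  unfolding algebraic_over_def using polys_over_mono[of E E'] by blast

text \<open>The Hilbert property concerns \<open>K_0(T)\<close>, while the symmetric group acts over
  \<open>L(T)\<close> with \<open>L = K_0(\<omega>)\<close>. So the splitting field \<open>N\<close>
  of the generic pencil over \<open>L(T)\<close> is written as a simple extension of
  \<open>K_0(T)\<close>, and the automorphisms over \<open>L(T)\<close> are specialized as
  automorphisms over \<open>K_0(T)\<close>. The place may send \<open>\<omega>\<close> to a
  conjugate; an automorphism \<open>\<rho>\<close> of the target repairs this.\<close>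

theorem pencil_specialization:
  fixes j :: "'a::field \<Rightarrow> 'c::alg_closed_field"
  assumes hilb: "hilbertian TYPE('a)" and j: "ring_hom_on UNIV j"
    and alg: "\<And>D. subfield_set D \<Longrightarrow> range j \<subseteq> D \<Longrightarrow>
      (\<And>p x. p \<in> polys_over D \<Longrightarrow> p \<noteq> 0 \<Longrightarrow> poly p x = 0 \<Longrightarrow> x \<in> D) \<Longrightarrow> D = UNIV"
    and p0: "irreducible p0" "poly (map_poly j p0) \<omega> = 0" and sep: "separable_over (range j) \<omega>"
    and C: "C = insert \<omega> (range j)"
    and full: "full_symmetric C f m z" and m: "m > 0"
    and fg: "f \<in> polys_over (field_hull C)" "g \<in> polys_over (field_hull C)"
    and g: "degree g < m" "\<And>i. i < m \<Longrightarrow> poly g (z i) \<noteq> 0"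
  obtains a z' where "full_symmetric C (pencil (j a) f g) (Suc m) z'"
proof -
  note jD = ring_hom_onD[OF subring_set_UNIV j]
  note k = ring_hom_fls_const
  note kD = ring_hom_onD[OF subring_set_UNIV k]
  define T :: "'c fls" where "T = fls_X_inv"
  define F where "F = pencil T (map_poly fls_const f) (map_poly fls_const g)"
  define I where "I = {..<Suc m}"
  define S0 where "S0 = insert T (fls_const ` C)"
  define E1 where "E1 = field_hull S0"
  obtain x where F: "F = (\<Prod>i\<in>I. [:- x i, 1:])" and xinj: "inj_on x I"
    and gen: "\<forall>\<sigma>. \<sigma> permutes I \<longrightarrow> (\<exists>\<tau>. ring_hom_on (field_hull (S0 \<union> x ` I)) \<tau> \<and>
         (\<forall>u\<in>E1. \<tau> u = u) \<and> (\<forall>i<Suc m. \<tau> (x i) = x (\<sigma> i)))"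
    unfolding F_def T_def I_def S0_def E1_def by (rule generic_pencil_symmetric[OF full m fg g])
  define N where "N = field_hull (S0 \<union> x ` I)"
  have Nsf: "subfield_set N" unfolding N_def by (rule subfield_field_hull)
  have supN: "S0 \<union> x ` I \<subseteq> N" unfolding N_def by (rule field_hull_superset)
  have E1sf: "subfield_set E1" unfolding E1_def by (rule subfield_field_hull)
  have supE1: "S0 \<subseteq> E1" unfolding E1_def by (rule field_hull_superset)
  have E1N: "E1 \<subseteq> N" unfolding E1_def using supN by (intro field_hull_minimal Nsf) auto
  define j' where "j' c = fls_const (j c)" for c
  have j': "ring_hom_on UNIV j'" by (simp add: ring_hom_on_def j'_def jD kD(3))
  have j'D: "j' 0 = 0" using ring_hom_onD[OF subring_set_UNIV j'] by blast
  have mapj': "map_poly j' q = map_poly fls_const (map_poly j q)" for q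
    using map_poly_comp_hom[of fls_const j q] jD(1) unfolding j'_def[abs_def] by simp
  have trans: "transcendental_over_hom j' T"
    unfolding transcendental_over_hom_def
  proof (intro allI impI)
    fix q assume q: "poly (map_poly j' q) T = 0"
    show "q = 0"
    proof (rule ccontr)
      assume "q \<noteq> 0"
      then have "map_poly j q \<noteq> 0" using map_poly_inj_hom[OF j, of q 0] by auto
      then obtain c where "T = fls_const c" using algebraic_over_fls_const q unfolding mapj' by blast
      then have "T $$ (-1) = fls_const c $$ (-1)" by simp
      then show False by (simp add: T_def)
    qed
  qed
  define e where "e = ratfun_hom j' T"
  have e: "ring_hom_on UNIV e" unfolding e_def by (rule ratfun_hom_hom[OF j' trans])
  have econst: "e (Fraction_Field.Fract [:c:] 1) = fls_const (j c)" for c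
    unfolding e_def using ratfun_hom_const[OF j' trans] by (simp add: j'_def)
  have eX: "e (Fraction_Field.Fract [:0, 1:] 1) = T"
    unfolding e_def by (rule ratfun_hom_indeterminate[OF j' trans])
  define E where "E = range e"
  have Esf: "subfield_set E" unfolding E_def using subfield_range_hom[OF e] by simp
  note EA = subfield_set_imp_subring[OF Esf]
  have TE: "T \<in> E" unfolding E_def using eX by (metis rangeI)
  have cE: "fls_const (j c) \<in> E" for c unfolding E_def using econst by (metis rangeI)
  have Einf: "infinite E"
  proof
    assume "finite E"
    then have "finite (range j')" using cE by (auto intro: finite_subset[of _ E] simp: j'_def)
    moreover have "inj j'" using ring_hom_on_eq_iff[OF subfield_set_UNIV j'] by (auto simp: inj_def)
    ultimately show False using hilbertian_infinite[OF hilb] finite_imageD by blast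
  qed
  define \<omega>' where "\<omega>' = fls_const \<omega>"
  have jE1: "fls_const (j c) \<in> E1" and wE1: "\<omega>' \<in> E1" and TE1: "T \<in> E1" for c
    using supE1 unfolding S0_def C \<omega>'_def by blast+
  have EE1: "E \<subseteq> E1"
  proof
    fix u assume "u \<in> E"
    then obtain r where r: "u = e r" unfolding E_def by blast
    obtain p q where pq: "r = Fraction_Field.Fract p q" "q \<noteq> 0" by (metis Fract_cases)
    have "u = poly (map_poly j' p) T / poly (map_poly j' q) T"
      using ratfun_hom_Fract[OF j' trans pq(2), of p] unfolding r pq(1) e_def .
    moreover have "map_poly j' h \<in> polys_over E1" for h
      using jE1 by (simp add: polys_over_def coeff_map_poly[of j', OF j'D]) (simp add: j'_def)
    ultimately show "u \<in> E1"
      using subfield_setD(2)[OF E1sf] poly_in_subring[OF subfield_set_imp_subring[OF E1sf] _ TE1] by metis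
  qed
  have S0hull: "S0 \<subseteq> M" if "insert \<omega>' E \<subseteq> M" for M
    using that TE cE unfolding S0_def C \<omega>'_def by blast
  have E1_eq: "E1 = field_hull (insert \<omega>' E)"
  proof
    show "E1 \<subseteq> field_hull (insert \<omega>' E)"
      unfolding E1_def by (intro field_hull_minimal S0hull field_hull_superset subfield_field_hull)
    show "field_hull (insert \<omega>' E) \<subseteq> E1" using wE1 EE1 by (intro field_hull_minimal E1sf) auto
  qed
  define p1 where "p1 = map_poly j' (smult (inverse (lead_coeff p0)) p0)"
  have p00: "p0 \<noteq> 0" using p0(1) by auto
  have p1E: "p1 \<in> polys_over E" using cE by (simp add: p1_def polys_over_def coeff_map_poly[of j', OF j'D]) (simp add: j'_def)
  have p1l: "lead_coeff p1 = 1"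
  proof -
    have "lead_coeff (smult (inverse (lead_coeff p0)) p0) = 1" using p00 by simp
    then show ?thesis unfolding p1_def using map_poly_hom_on_monic[OF subring_set_UNIV j'] by blast
  qed
  have p1w: "poly p1 \<omega>' = 0"
  proof -
    have "poly (map_poly fls_const (map_poly j p0)) \<omega>' = fls_const (poly (map_poly j p0) \<omega>)"
      unfolding \<omega>'_def by (rule poly_map_poly_hom_on[OF subring_set_UNIV k]) auto
    then have "poly (map_poly j' p0) \<omega>' = 0" using p0(2) by (simp add: mapj')
    then show ?thesis by (simp add: p1_def map_poly_hom_on_smult[OF subring_set_UNIV j'])
  qed
  have FE1: "F \<in> polys_over E1"
  proof -
    have "field_hull C \<subseteq> {u \<in> UNIV. fls_const u \<in> E1}"
      using supE1 by (intro field_hull_minimal subfield_preimage[OF subfield_set_UNIV k E1sf]) (auto simp: S0_def)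
    then show ?thesis
      unfolding F_def using fg supE1
      by (intro pencil_polys_over subfield_set_imp_subring[OF E1sf]) (auto simp: S0_def polys_over_def coeff_map_poly)
  qed
  have Fl: "lead_coeff F = 1" unfolding F by (rule lead_coeff_prod_linear)
  have Fx: "poly F (x i) = 0" if "i \<in> I" for i
    unfolding F poly_prod using that by (intro prod_zero) (auto simp: I_def)
  obtain R1 where R1: "finite_ring_over E R1" "insert \<omega>' E \<subseteq> R1"
    using finite_ring_over_adjoin[OF finite_ring_over_self[OF Esf] p1E p1l p1w] by blast
  have aw: "algebraic_over E \<omega>'" using finite_ring_over_algebraic[OF Esf R1(1)] R1(2) by blast
  have E1R1: "E1 \<subseteq> R1"
  proof -
    have "subring_set R1" using R1 by (simp add: finite_ring_over_def)
    moreover have "polys_over E \<subseteq> polys_over R1" using R1(2) by (intro polys_over_mono) auto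
    ultimately show ?thesis
      unfolding E1_eq simple_algebraic_extension[OF Esf aw] using R1(2) poly_in_subring by blast
  qed
  have "\<exists>R. finite_ring_over E R \<and> R1 \<subseteq> R \<and> x ` {..<n} \<subseteq> R" if "n \<le> Suc m" for n
    using that
  proof (induction n)
    case 0
    then show ?case using R1 by auto
  next
    case (Suc n)
    then obtain R where R: "finite_ring_over E R" "R1 \<subseteq> R" "x ` {..<n} \<subseteq> R" by auto
    have "F \<in> polys_over R" using FE1 E1R1 R(2) polys_over_mono[of E1 R] by auto
    moreover have "poly F (x n) = 0" using Fx[of n] Suc.prems by (simp add: I_def)
    ultimately obtain R' where "finite_ring_over E R'" "insert (x n) R \<subseteq> R'"
      using finite_ring_over_adjoin[OF R(1) _ Fl] by blast
    with R show ?case by (intro exI[of _ R']) (auto simp: lessThan_Suc)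
  qed
  then obtain R0 where R0: "finite_ring_over E R0" "R1 \<subseteq> R0" "x ` I \<subseteq> R0" unfolding I_def by blast
  \<comment> \<open>The primitive element has to be algebraic over \<open>K_0(T)\<close>, which
    \<open>R0\<close> ensures, and to lie in the splitting field, which \<open>N\<close>
    ensures.\<close>
  define R where "R = R0 \<inter> N"
  have R: "subring_set R"
    unfolding R_def using R0(1) subfield_set_imp_subring[OF Nsf]
    by (intro subring_set_Int) (auto simp: finite_ring_over_def)
  have Ralg: "algebraic_over E u" if "u \<in> R" for u
    using that finite_ring_over_algebraic[OF Esf R0(1)] by (auto simp: R_def)
  have E1R: "E1 \<subseteq> R" using E1R1 R0(2) E1N by (auto simp: R_def)
  have xR: "x ` I \<subseteq> R" using R0(3) supN by (auto simp: R_def)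
  have FI: "(\<Prod>b\<in>x ` I. [:- b, 1:]) = F" unfolding F by (simp add: prod.reindex[OF xinj])
  have sep1: "separable_over E1 (x i)" if "i \<in> I" for i
    unfolding separable_over_def
    using that FE1 FI by (intro exI[of _ "x ` I"] conjI) (auto simp: I_def)
  have E1inf: "infinite E1" using EE1 Einf infinite_super by blast
  \<comment> \<open>Separability of the roots is at hand over \<open>E1 = L(T)\<close>, where the
    pencil has its coefficients, and that of \<open>\<omega>'\<close> over
    \<open>E = K_0(T)\<close>. Hence a primitive element over \<open>E1\<close> comes before one
    over \<open>E\<close>.\<close>
  obtain \<theta>0 where \<theta>0: "\<theta>0 \<in> R" "insert 0 (x ` I) \<subseteq> field_hull (insert \<theta>0 E1)"
  proof (rule primitive_element[OF E1sf E1inf R E1R])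
    show "algebraic_over E1 u" if "u \<in> R" for u using Ralg[OF that] EE1 by (rule algebraic_over_mono)
    show "0 \<in> R" by (rule subring_setD[OF R])
    show "finite (x ` I)" by (simp add: I_def)
  qed (use xR sep1 in auto)
  have sepw: "separable_over E \<omega>'"
  proof -
    obtain S where S: "finite S" "\<omega> \<in> S" "(\<Prod>b\<in>S. [:- b, 1:]) \<in> polys_over (range j)"
      using sep unfolding separable_over_def by blast
    have inj: "inj_on fls_const S" using ring_hom_on_eq_iff[OF subfield_set_UNIV k] by (auto intro: inj_onI)
    have "(\<Prod>b\<in>fls_const ` S. [:- b, 1:]) = map_poly fls_const (\<Prod>b\<in>S. [:- b, 1:])"
      using map_poly_hom_on_prod[OF subring_set_UNIV k, of S "\<lambda>b. [:- b, 1:]"]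
      by (simp add: prod.reindex[OF inj] map_poly_pCons)
    also have "\<dots> \<in> polys_over E"
      unfolding polys_over_def
    proof safe
      fix i
      obtain c where "coeff (\<Prod>b\<in>S. [:- b, 1:]) i = j c" using polys_overD[OF S(3), of i] by blast
      then show "coeff (map_poly fls_const (\<Prod>b\<in>S. [:- b, 1:])) i \<in> E"
        using cE by (simp add: coeff_map_poly)
    qed
    finally show ?thesis unfolding separable_over_def using S by (intro exI[of _ "fls_const ` S"]) (auto simp: \<omega>'_def)
  qed
  \<comment> \<open>Here \<open>\<theta>0\<close> enters as the merely algebraic generator, and
    \<open>\<omega>'\<close> is the separable element adjoined to it.\<close>
  obtain \<theta> where \<theta>: "\<theta> \<in> R" "insert \<theta>0 {\<omega>'} \<subseteq> field_hull (insert \<theta> E)"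
  proof (rule primitive_element[OF Esf Einf R])
    show "E \<subseteq> R" using EE1 E1R by blast
    show "{\<omega>'} \<subseteq> R" using wE1 E1R by blast
  qed (use Ralg \<theta>0 sepw in auto)
  define M where "M = field_hull (insert \<theta> E)"
  have Msf: "subfield_set M" unfolding M_def by (rule subfield_field_hull)
  have MN: "M = N"
  proof
    show "M \<subseteq> N" unfolding M_def using \<theta>(1) EE1 E1N by (intro field_hull_minimal Nsf) (auto simp: R_def)
    have EM: "insert \<theta> E \<subseteq> M" unfolding M_def by (rule field_hull_superset)
    have wEM: "insert \<omega>' E \<subseteq> M" using \<theta>(2) EM by (auto simp: M_def)
    have "E1 \<subseteq> M" unfolding E1_eq by (rule field_hull_minimal[OF wEM Msf])
    moreover have "S0 \<subseteq> M" by (rule S0hull[OF wEM])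
    ultimately have "insert \<theta>0 E1 \<subseteq> M" using \<theta>(2) by (auto simp: M_def)
    then have "field_hull (insert \<theta>0 E1) \<subseteq> M" by (rule field_hull_minimal[OF _ Msf])
    then show "N \<subseteq> M" unfolding N_def using \<theta>0(2) \<open>S0 \<subseteq> M\<close> by (intro field_hull_minimal Msf) auto
  qed
  obtain Tau where Tau: "\<And>\<sigma>. \<sigma> permutes I \<Longrightarrow> ring_hom_on N (Tau \<sigma>) \<and>
         (\<forall>u\<in>E1. Tau \<sigma> u = u) \<and> (\<forall>i<Suc m. Tau \<sigma> (x i) = x (\<sigma> i))"
    using gen unfolding N_def by metis
  have TauN: "Tau \<sigma> u \<in> N" if \<sigma>: "\<sigma> permutes I" and u: "u \<in> N" for \<sigma> u
  proof -
    note T' = Tau[OF \<sigma>]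
    have "S0 \<union> x ` I \<subseteq> {u \<in> N. Tau \<sigma> u \<in> N}"
    proof
      fix v assume v: "v \<in> S0 \<union> x ` I"
      then have "v \<in> N" using supN by auto
      moreover have "Tau \<sigma> v \<in> N"
      proof (cases "v \<in> S0")
        case True
        then show ?thesis using T' supE1 \<open>v \<in> N\<close> by auto
      next
        case False
        then obtain i where i: "i \<in> I" "v = x i" using v by auto
        then have "Tau \<sigma> v = x (\<sigma> i)" using T' by (auto simp: I_def)
        then show ?thesis using permutes_in_image[OF \<sigma>, of i] i supN by auto
      qed
      ultimately show "v \<in> {u \<in> N. Tau \<sigma> u \<in> N}" by simp
    qed
    moreover have "ring_hom_on N (Tau \<sigma>)" using T' by blast
    ultimately have "field_hull (S0 \<union> x ` I) \<subseteq> {u \<in> N. Tau \<sigma> u \<in> N}"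
      by (intro field_hull_minimal subfield_preimage Nsf)
    then show ?thesis using u unfolding N_def[symmetric] by blast
  qed
  \<comment> \<open>\<open>U\<close> lists what must have a value at the chosen point: inverses of
    differences keep the roots distinct, the conjugates \<open>Tau \<sigma> \<theta>\<close> let
    every \<open>Tau \<sigma>\<close> specialize, and \<open>\<omega>'\<close> carries the field
    \<open>L\<close> along.\<close>
  define U where "U = insert \<omega>' (x ` I \<union> (\<lambda>(i, k). inverse (x i - x k)) ` (I \<times> I) \<union> (\<lambda>\<sigma>. Tau \<sigma> \<theta>) ` {\<sigma>. \<sigma> permutes I})"
  have \<theta>N: "\<theta> \<in> N" using \<theta>(1) by (simp add: R_def)
  have Ufin: "finite U" unfolding U_def using finite_permutations[of I] by (auto simp: I_def)
  have "x i \<in> N" if "i \<in> I" for i using that supN by auto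
  then have "U \<subseteq> N"
    unfolding U_def using wE1 E1N TauN[OF _ \<theta>N] subfield_setD(1)[OF Nsf] subring_setD(5)[OF subfield_set_imp_subring[OF Nsf]]
    by auto
  then have UM: "U \<subseteq> field_hull (insert \<theta> (range e))" using MN by (simp add: M_def E_def)
  have \<theta>alg: "algebraic_over (range e) \<theta>" using Ralg[OF \<theta>(1)] by (simp add: E_def)
  obtain a B \<phi> where B: "subring_set B" "ring_hom_on B \<phi>" "insert \<theta> U \<subseteq> B"
    and eB: "\<forall>r. ratfun_defined_at r a \<longrightarrow> e r \<in> B \<and> \<phi> (e r) = j (ratfun_eval r a)"
    and spec: "\<forall>\<tau>. ring_hom_on (field_hull (insert \<theta> (range e))) \<tau> \<and> (\<forall>r. \<tau> (e r) = e r) \<and> \<tau> \<theta> \<in> B \<longrightarrow>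
      (\<exists>\<gamma>. ring_hom_on UNIV \<gamma> \<and> bij \<gamma> \<and> (\<forall>c. \<gamma> (j c) = j c) \<and> (\<forall>u\<in>B. \<tau> u \<in> B \<and> \<gamma> (\<phi> u) = \<phi> (\<tau> u)))"
    by (rule hilbertian_specialization[OF hilb e j alg \<theta>alg Ufin UM])
  have def1: "ratfun_defined_at (Fraction_Field.Fract p 1) a" for p
    unfolding ratfun_defined_at_def by force
  have jB: "j' c \<in> B" "\<phi> (j' c) = j c" for c
    using eB[rule_format, OF def1[of "[:c:]"]] econst[of c] ratfun_eval_Fract[of 1 a "[:c:]"] by (auto simp: j'_def)
  have TB: "T \<in> B" "\<phi> T = j a"
    using eB[rule_format, OF def1[of "[:0, 1:]"]] eX ratfun_eval_Fract[of 1 a "[:0, 1:]"] by auto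
  have wB: "\<omega>' \<in> B" and xB: "\<And>i. i \<in> I \<Longrightarrow> x i \<in> B" using B(3) by (auto simp: U_def)
  \<comment> \<open>The place fixes \<open>K_0\<close> only, so the value of
    \<open>\<omega>'\<close> is known merely to be a root of the polynomial \<open>p0\<close> of
    \<open>\<omega>\<close>. This is what makes it conjugate to \<open>\<omega>\<close>.\<close>
  have "poly (map_poly j p0) (\<phi> \<omega>') = 0"
  proof -
    have p0B: "map_poly j' p0 \<in> polys_over B" using jB by (auto simp: polys_over_def coeff_map_poly j'D)
    have "poly (map_poly j' p0) \<omega>' = 0"
      using p1w p00 by (simp add: p1_def map_poly_hom_on_smult[OF subring_set_UNIV j'] ring_hom_on_inverse[OF subfield_set_UNIV j']
        ring_hom_on_nonzero[OF subfield_set_UNIV j'])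
    then have "poly (map_poly \<phi> (map_poly j' p0)) (\<phi> \<omega>') = 0"
      using poly_map_poly_hom_on[OF B(1,2) p0B wB] ring_hom_onD(1)[OF B(1,2)] by simp
    moreover have "map_poly \<phi> (map_poly j' p0) = map_poly j p0"
      using jB ring_hom_onD(1)[OF B(1,2)] by (simp add: map_poly_comp_hom j'D)
    ultimately show ?thesis by simp
  qed
  then obtain \<rho> where \<rho>: "ring_hom_on UNIV \<rho>" "bij \<rho>" "\<And>c. \<rho> (j c) = j c" "\<rho> (\<phi> \<omega>') = \<omega>"
    using automorphism_exists[OF j p0(1) _ p0(2) alg] by blast
  note \<rho>D = ring_hom_onD[OF subring_set_UNIV \<rho>(1)]
  define \<psi> where "\<psi> u = \<rho> (\<phi> u)" for u
  have \<psi>: "ring_hom_on B \<psi>"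
    using B(2) \<rho>D(2,3,4) by (auto simp: ring_hom_on_def \<psi>_def)
  note \<psi>D = ring_hom_onD[OF B(1) \<psi>]
  have \<psi>j: "\<psi> (j' c) = j c" for c using jB \<rho> by (simp add: \<psi>_def)
  have \<psi>w: "\<psi> \<omega>' = \<omega>" using \<rho> by (simp add: \<psi>_def)
  have \<psi>T: "\<psi> T = j a" using TB \<rho> by (simp add: \<psi>_def)
  have rj: "subfield_set (range j)" using subfield_range_hom[OF j] by simp
  have "map_poly j p0 \<noteq> 0" using p00 map_poly_inj_hom[OF j, of p0 0] by auto
  then have walg: "algebraic_over (range j) \<omega>"
    using p0(2) polys_over_range[OF j] unfolding algebraic_over_def by blast
  \<comment> \<open>After the correction by \<open>\<rho>\<close> the elements of \<open>L\<close>
    specialize to themselves; hence the generic pencil specializes to the pencil with the same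
    \<open>f\<close> and \<open>g\<close>.\<close>
  have hullC: "fls_const c \<in> B \<and> \<psi> (fls_const c) = c" if c: "c \<in> field_hull C" for c
  proof -
    obtain q where q: "c = poly (map_poly j q) \<omega>"
      using c unfolding C simple_algebraic_extension[OF rj walg] polys_over_range[OF j] by blast
    have qB: "map_poly j' q \<in> polys_over B" using jB by (auto simp: polys_over_def coeff_map_poly j'D)
    have "fls_const c = poly (map_poly j' q) \<omega>'"
      unfolding q mapj' \<omega>'_def using poly_map_poly_hom_on[OF subring_set_UNIV k, of "map_poly j q" \<omega>] by simp
    moreover have "\<psi> (poly (map_poly j' q) \<omega>') = poly (map_poly \<psi> (map_poly j' q)) \<omega>"
      using poly_map_poly_hom_on[OF B(1) \<psi> qB wB] \<psi>w by simp
    moreover have "map_poly \<psi> (map_poly j' q) = map_poly j q"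
      using \<psi>j by (simp add: map_poly_comp_hom j'D \<psi>D)
    ultimately show ?thesis using poly_in_subring[OF B(1) qB wB] q by simp
  qed
  have lift: "map_poly fls_const h \<in> polys_over B" "map_poly \<psi> (map_poly fls_const h) = h" if "h \<in> polys_over (field_hull C)" for h
    using that hullC by (auto simp: polys_over_def coeff_map_poly \<psi>D intro!: poly_eqI)
  define z' where "z' i = \<psi> (x i)" for i
  have "map_poly \<psi> F = pencil (j a) f g"
    unfolding F_def using map_poly_pencil[OF B(1) \<psi> TB(1) lift(1)[OF fg(1)] lift(1)[OF fg(2)]] lift(2)[OF fg(1)] lift(2)[OF fg(2)] \<psi>T
    by simp
  moreover have "map_poly \<psi> F = (\<Prod>i\<in>I. [:- z' i, 1:])"
  proof -
    have "[:- x i, 1:] \<in> polys_over B" if "i \<in> I" for i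
      using xB[OF that] by (simp add: polys_over_pCons[OF B(1)] polys_over_0[OF B(1)] subring_setD[OF B(1)])
    then have "map_poly \<psi> F = (\<Prod>i\<in>I. map_poly \<psi> [:- x i, 1:])"
      unfolding F by (rule map_poly_hom_on_prod[OF B(1) \<psi>])
    also have "\<dots> = (\<Prod>i\<in>I. [:- z' i, 1:])"
      using xB by (intro prod.cong refl) (simp add: map_poly_hom_on_pCons[OF B(1) \<psi>] \<psi>D z'_def)
    finally show ?thesis .
  qed
  ultimately have eq: "pencil (j a) f g = (\<Prod>i\<in>I. [:- z' i, 1:])" by simp
  have inj: "inj_on z' I"
  proof (rule inj_onI, rule ccontr)
    fix i l assume il: "i \<in> I" "l \<in> I" "z' i = z' l" "i \<noteq> l"
    then have "x i - x l \<noteq> 0" using xinj by (auto dest: inj_onD)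
    moreover have "inverse (x i - x l) \<in> B" using il B(3) by (auto simp: U_def)
    moreover have "x i - x l \<in> B" using xB il by (intro subring_setD[OF B(1)]) auto
    ultimately have "\<psi> (x i - x l) * \<psi> (inverse (x i - x l)) = 1"
      using \<psi>D(4)[of "x i - x l" "inverse (x i - x l)"] \<psi>D(2) by simp
    moreover have "\<psi> (x i - x l) = 0" using \<psi>D(6) xB il by (simp add: z'_def)
    ultimately show False by simp
  qed
  have symm: "\<exists>\<gamma>. ring_hom_on UNIV \<gamma> \<and> bij \<gamma> \<and> (\<forall>c\<in>C. \<gamma> c = c) \<and> (\<forall>i<Suc m. \<gamma> (z' i) = z' (\<sigma> i))"
    if \<sigma>: "\<sigma> permutes I" for \<sigma>
  proof -
    note T' = Tau[OF \<sigma>]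
    have "Tau \<sigma> (e r) = e r" for r using T' EE1 by (auto simp: E_def)
    moreover have "Tau \<sigma> \<theta> \<in> B" using B(3) \<sigma> by (auto simp: U_def)
    ultimately obtain \<gamma> where \<gamma>: "ring_hom_on UNIV \<gamma>" "bij \<gamma>" "\<And>c. \<gamma> (j c) = j c"
      "\<And>u. u \<in> B \<Longrightarrow> Tau \<sigma> u \<in> B \<and> \<gamma> (\<phi> u) = \<phi> (Tau \<sigma> u)"
      using spec[rule_format, of "Tau \<sigma>"] T' MN unfolding M_def E_def by blast
    \<comment> \<open>Conjugation by \<open>\<rho>\<close> turns compatibility with
      \<open>\<phi>\<close> into compatibility with \<open>\<psi>\<close>. That
      \<open>\<omega>\<close> is fixed then follows from
      \<open>Tau \<sigma> \<omega>' = \<omega>'\<close>.\<close>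
    define \<gamma>' where "\<gamma>' u = \<rho> (\<gamma> (inv_into UNIV \<rho> u))" for u
    have inv\<rho>: "inv_into UNIV \<rho> (\<rho> u) = u" for u using \<rho>(2) by (simp add: bij_is_inj)
    have \<gamma>'\<psi>: "\<gamma>' (\<psi> u) = \<psi> (Tau \<sigma> u)" if "u \<in> B" for u
      using \<gamma>(4)[OF that] by (simp add: \<gamma>'_def \<psi>_def inv\<rho>)
    have "ring_hom_on UNIV \<gamma>'"
      using ring_hom_onD(2,3,4)[OF subring_set_UNIV ring_hom_on_inv[OF \<rho>(1,2)]] \<rho>D(2,3,4)
        ring_hom_onD(2,3,4)[OF subring_set_UNIV \<gamma>(1)]
      by (simp add: ring_hom_on_def \<gamma>'_def)
    moreover have "bij \<gamma>'"
    proof -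
      have "bij (\<rho> \<circ> (\<gamma> \<circ> inv_into UNIV \<rho>))"
        using \<rho>(2) \<gamma>(2) bij_imp_bij_inv[OF \<rho>(2)] by (intro bij_comp)
      moreover have "\<rho> \<circ> (\<gamma> \<circ> inv_into UNIV \<rho>) = \<gamma>'" by (auto simp: \<gamma>'_def)
      ultimately show ?thesis by simp
    qed
    moreover have "\<gamma>' c = c" if cC: "c \<in> C" for c
    proof (cases "c = \<omega>")
      case True
      then show ?thesis using \<gamma>'\<psi>[OF wB] T' wE1 \<psi>w by simp
    next
      case False
      then obtain b where "c = j b" using cC by (auto simp: C)
      moreover have "inv_into UNIV \<rho> (j b) = j b" using inv\<rho>[of "j b"] \<rho>(3) by simp
      ultimately show ?thesis using \<gamma>(3) \<rho>(3) by (simp add: \<gamma>'_def)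
    qed
    moreover have "\<gamma>' (z' i) = z' (\<sigma> i)" if "i < Suc m" for i
      using \<gamma>'\<psi>[OF xB, of i] T' that by (simp add: z'_def I_def)
    ultimately show ?thesis by blast
  qed
  show thesis
  proof (rule that)
    show "full_symmetric C (pencil (j a) f g) (Suc m) z'"
      unfolding full_symmetric_def using eq inj symm unfolding I_def by blast
  qed
qed

text \<open>Monic orthogonal polynomials: the \<open>k\<close>-th one is the characteristic
  polynomial of the leading \<open>k\<close> by \<open>k\<close> block of a tridiagonal matrix with
  diagonal \<open>a\<close>, where \<open>b k\<close> is the product of the two off-diagonal entries
  linking the positions \<open>k\<close> and \<open>k + 1\<close>. With this indexing
  \<open>b k\<close> will be \<open>h (Suc k) / h k\<close>.\<close>

fun jacobi :: "(nat \<Rightarrow> 'w::comm_ring_1) \<Rightarrow> (nat \<Rightarrow> 'w) \<Rightarrow> nat \<Rightarrow> 'w poly" where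
  "jacobi a b 0 = 1"
| "jacobi a b (Suc 0) = [:- a 0, 1:]"
| "jacobi a b (Suc (Suc k)) = pencil (a (Suc k)) (jacobi a b (Suc k)) (smult (b k) (jacobi a b k))"

lemma jacobi_monic:
  fixes a b :: "nat \<Rightarrow> 'w::field"
  shows "degree (jacobi a b k) = k \<and> lead_coeff (jacobi a b k) = 1"
proof (induction a b k rule: jacobi.induct)
  case (3 a b k)
  have "degree (smult (b k) (jacobi a b k)) < degree (jacobi a b (Suc k))"
    using 3 degree_smult_le[of "b k" "jacobi a b k"] by simp
  moreover have m: "degree (jacobi a b (Suc k)) = Suc k" "lead_coeff (jacobi a b (Suc k)) = 1" using 3 by auto
  ultimately show ?case
    using degree_pencil[OF m(2), of "smult (b k) (jacobi a b k)" "a (Suc k)"] unfolding m(1) jacobi.simps(3) by blast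
qed auto

text \<open>A common zero of two neighbours would descend along the recurrence, as
  \<open>b k\<close> is nonzero, to the constant 1. This provides the condition that
  \<open>g\<close> does not vanish at the roots of \<open>f\<close>, on which the Laurent expansion
  of the roots rests.\<close>

lemma jacobi_coprime:
  fixes a b :: "nat \<Rightarrow> 'w::field"
  assumes "\<And>k. b k \<noteq> 0"
  shows "poly (jacobi a b k) x \<noteq> 0 \<or> poly (jacobi a b (Suc k)) x \<noteq> 0"
proof (induction k)
  case (Suc k)
  then show ?case using assms[of k] by (auto simp: poly_pencil)
qed simp

text \<open>Choosing the entry \<open>a k\<close> leaves the polynomials up to index
  \<open>k\<close> as they are, which permits choosing the entries one at a time.\<close>

lemma jacobi_cong: "(\<And>i. i < k \<Longrightarrow> a i = a' i) \<Longrightarrow> jacobi a b k = jacobi a' b k"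
  by (induction a b k rule: jacobi.induct) auto

lemma jacobi_polys_over:
  assumes A: "subring_set A" and "\<And>i. a i \<in> A" "\<And>i. b i \<in> A"
  shows "jacobi a b k \<in> polys_over A"
  using assms(2,3)
  by (induction a b k rule: jacobi.induct)
     (auto simp: polys_over_1[OF A] polys_over_0[OF A] polys_over_pCons[OF A] subring_setD[OF A]
       intro!: pencil_polys_over[OF A] polys_over_smult[OF A])

theorem jacobi_full_symmetric:
  fixes j :: "'a::field \<Rightarrow> 'c::alg_closed_field"
  assumes hilb: "hilbertian TYPE('a)" and j: "ring_hom_on UNIV j"
    and alg: "\<And>D. subfield_set D \<Longrightarrow> range j \<subseteq> D \<Longrightarrow>
      (\<And>p x. p \<in> polys_over D \<Longrightarrow> p \<noteq> 0 \<Longrightarrow> poly p x = 0 \<Longrightarrow> x \<in> D) \<Longrightarrow> D = UNIV"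
    and p0: "irreducible p0" "poly (map_poly j p0) \<omega> = 0" and sep: "separable_over (range j) \<omega>"
    and C: "C = insert \<omega> (range j)" and b: "\<And>k. b k \<in> field_hull C" "\<And>k. b k \<noteq> 0" and m: "m > 0"
  shows "\<exists>a z. full_symmetric C (jacobi (\<lambda>i. j (a i)) b m) m z"
  using m
proof (induction m rule: nat_induct_non_zero)
  case 1
  have "full_symmetric C (jacobi (\<lambda>i. j 0) b 1) 1 (\<lambda>_. j 0)"
    unfolding full_symmetric_def
  proof (intro conjI allI impI)
    fix \<sigma> :: "nat \<Rightarrow> nat" assume "\<sigma> permutes {..<1}"
    show "\<exists>\<gamma>. ring_hom_on UNIV \<gamma> \<and> bij \<gamma> \<and> (\<forall>c\<in>C. \<gamma> c = c) \<and> (\<forall>i<1. \<gamma> (j 0) = j 0)"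
      by (intro exI[of _ id]) (auto simp: ring_hom_on_def)
  qed (auto simp: inj_on_def)
  then show ?case by (intro exI[of _ "\<lambda>_. 0"] exI[of _ "\<lambda>_. j 0"]) simp
next
  case (Suc m)
  then obtain a z where full: "full_symmetric C (jacobi (\<lambda>i. j (a i)) b m) m z" by blast
  obtain k where k: "m = Suc k" using Suc.hyps gr0_implies_Suc by blast
  \<comment> \<open>The pencil formed from the polynomials of index \<open>m\<close> and
    \<open>m - 1\<close> has index \<open>m + 1\<close>, and its parameter becomes the entry
    \<open>a m\<close>.\<close>
  define f where "f = jacobi (\<lambda>i. j (a i)) b m"
  define g where "g = smult (b k) (jacobi (\<lambda>i. j (a i)) b k)"
  have H: "subring_set (field_hull C)" by (rule subfield_set_imp_subring[OF subfield_field_hull])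
  have aC: "j (a i) \<in> field_hull C" for i using field_hull_superset[of C] unfolding C by auto
  have fC: "f \<in> polys_over (field_hull C)" unfolding f_def by (rule jacobi_polys_over[OF H aC b(1)])
  have gC: "g \<in> polys_over (field_hull C)"
    unfolding g_def by (intro polys_over_smult[OF H] b(1) jacobi_polys_over[OF H aC])
  have dg: "degree g < m" using jacobi_monic[of _ b k] degree_smult_le[of "b k" "jacobi (\<lambda>i. j (a i)) b k"] by (simp add: g_def k)
  have gz: "poly g (z i) \<noteq> 0" if "i < m" for i
  proof -
    have "poly f (z i) = 0"
      using full that unfolding full_symmetric_def f_def[symmetric] by (auto simp: poly_prod intro!: prod_zero)
    then show ?thesis using jacobi_coprime[of b "\<lambda>i. j (a i)" k "z i"] b(2) by (simp add: f_def g_def k)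
  qed
  obtain c z' where z': "full_symmetric C (pencil (j c) f g) (Suc m) z'"
    using pencil_specialization[OF hilb j alg p0 sep C full[folded f_def] Suc.hyps fC gC dg gz] by blast
  define a' where "a' = a(m := c)"
  have "pencil (j c) f g = jacobi (\<lambda>i. j (a' i)) b (Suc m)"
  proof -
    have "f = jacobi (\<lambda>i. j (a' i)) b m" unfolding f_def a'_def by (rule jacobi_cong) auto
    moreover have "jacobi (\<lambda>i. j (a i)) b k = jacobi (\<lambda>i. j (a' i)) b k"
      unfolding a'_def by (rule jacobi_cong) (auto simp: k)
    ultimately show ?thesis by (simp add: k g_def a'_def)
  qed
  with z' show ?case by metis
qed

section \<open>Prosolvable extensions\<close>

lemma subfield_ring_of_type_algebraI:
  assumes L: "subfield_set (L :: 'b::field set)"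
  shows "subfield L ring_of_type_algebra"
proof -
  interpret R: field "ring_of_type_algebra :: 'b ring" by (rule field_from_type_algebra)
  note sel = ring_of_type_algebra_def[where ?'a = 'b]
  note A = subring_setD[OF subfield_set_imp_subring[OF L]]
  have minus: "\<ominus>\<^bsub>ring_of_type_algebra\<^esub> x = - x" for x :: 'b
    by (rule R.minus_equality) (auto simp: sel)
  have inv: "inv\<^bsub>ring_of_type_algebra\<^esub> x = inverse x" if "x \<noteq> 0" for x :: 'b
    by (rule R.comm_inv_char) (use that in \<open>auto simp: sel\<close>)
  show ?thesis
  proof (rule R.subfieldI')
    show "subring L ring_of_type_algebra"
      by (rule R.subringI) (use A in \<open>auto simp: minus, auto simp: sel\<close>)
    show "inv\<^bsub>ring_of_type_algebra\<^esub> k \<in> L" if "k \<in> L - {\<zero>\<^bsub>ring_of_type_algebra\<^esub>}" for k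
    proof -
      have "k \<noteq> 0" "k \<in> L" using that by (auto simp: sel)
      then show ?thesis using inv subfield_setD[OF L] by simp
    qed
  qed
qed

lemma intermediate_field_closed:
  fixes N :: "'b::field set"
  assumes "intermediate_field j N"
  shows "1 \<in> N" "x \<in> N \<Longrightarrow> y \<in> N \<Longrightarrow> x + y \<in> N" "x \<in> N \<Longrightarrow> y \<in> N \<Longrightarrow> x * y \<in> N" "j c \<in> N"
proof -
  have "subring N ring_of_type_algebra"
    using assms subfieldE(1) unfolding intermediate_field_def by blast
  from subringE[OF this] show "1 \<in> N" "x \<in> N \<Longrightarrow> y \<in> N \<Longrightarrow> x + y \<in> N" "x \<in> N \<Longrightarrow> y \<in> N \<Longrightarrow> x * y \<in> N"
    by (auto simp: ring_of_type_algebra_def)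
  show "j c \<in> N" using assms unfolding intermediate_field_def by blast
qed

lemma root_of_splits_in:
  assumes "splits_in p N" "p \<noteq> 0" "poly p x = 0"
  shows "x \<in> N"
proof -
  obtain c rs where rs: "set rs \<subseteq> N" "p = smult c (\<Prod>r\<leftarrow>rs. [:- r, 1:])"
    using assms(1) unfolding splits_in_def by blast
  have "c \<noteq> 0" using assms(2) rs by auto
  then have "poly (\<Prod>r\<leftarrow>rs. [:- r, 1:]) x = 0" using assms(3) rs by simp
  then have "x \<in> set rs"
  proof (induction rs)
    case (Cons a rs)
    have "poly [:- a, 1:] x = 0 \<or> poly (\<Prod>r\<leftarrow>rs. [:- r, 1:]) x = 0"
      using Cons.prems unfolding list.map prod_list.Cons poly_mult by simp
    then show ?case using Cons.IH by auto
  qed simp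
  with rs show ?thesis by blast
qed

text \<open>\<open>\<tau> x\<close> is a root of the same irreducible polynomial over the base as
  \<open>x\<close>, and all roots of this polynomial lie in \<open>N\<close> by normality.\<close>

lemma galois_extension_stable:
  assumes j: "ring_hom_on UNIV j" and N: "galois_extension j N"
    and \<tau>: "ring_hom_on UNIV \<tau>" "\<And>c. \<tau> (j c) = j c" and x: "x \<in> N"
  shows "\<tau> x \<in> N"
proof -
  obtain p where p: "irreducible p" "poly (map_poly j p) x = 0"
    using N x unfolding galois_extension_def separable_extension_def by blast
  then have "splits_in (map_poly j p) N" using N x unfolding galois_extension_def by blast
  moreover have "map_poly j p \<noteq> 0" using p map_poly_inj_hom[OF j, of p 0] by auto
  moreover have "poly (map_poly j p) (\<tau> x) = 0"
  proof -
    have "map_poly \<tau> (map_poly j p) = map_poly j p"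
      using \<tau>(2) by (intro map_poly_fixed[where D = UNIV])
        (auto simp: ring_hom_onD[OF subring_set_UNIV \<tau>(1)] polys_over_def coeff_map_poly ring_hom_onD[OF subring_set_UNIV j])
    then show ?thesis
      using poly_map_poly_hom_on[OF subring_set_UNIV \<tau>(1), of "map_poly j p" x] p(2)
      by (simp add: ring_hom_onD[OF subring_set_UNIV \<tau>(1)])
  qed
  ultimately show ?thesis by (rule root_of_splits_in)
qed

section \<open>Automorphisms over the base and their iterated commutators\<close>

definition base_automorphisms :: "('a::field \<Rightarrow> 'c::field) \<Rightarrow> ('c \<Rightarrow> 'c) set" where
  "base_automorphisms j = {\<tau>. ring_hom_on UNIV \<tau> \<and> bij \<tau> \<and> (\<forall>c. \<tau> (j c) = j c)}"

lemma base_automorphisms_comp: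
  assumes "\<tau> \<in> base_automorphisms j" "\<sigma> \<in> base_automorphisms j"
  shows "\<tau> \<circ> \<sigma> \<in> base_automorphisms j"
  using assms unfolding base_automorphisms_def by (auto simp: ring_hom_on_def intro: bij_comp)

lemma base_automorphisms_inv:
  assumes "\<tau> \<in> base_automorphisms j"
  shows "inv_into UNIV \<tau> \<in> base_automorphisms j"
proof -
  have \<tau>: "ring_hom_on UNIV \<tau>" "bij \<tau>" "\<And>c. \<tau> (j c) = j c" using assms by (auto simp: base_automorphisms_def)
  have "inv_into UNIV \<tau> (j c) = j c" for c using \<tau>(2,3) by (metis bij_is_inj inv_into_f_f UNIV_I)
  then show ?thesis
    using ring_hom_on_inv[OF \<tau>(1,2)] bij_imp_bij_inv[OF \<tau>(2)] by (auto simp: base_automorphisms_def)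
qed

text \<open>Only the commutators themselves are collected, not the groups they generate. Their
  restrictions still lie in the derived series, and 3-cycles can be followed through single
  commutators.\<close>

fun iterated_commutators :: "('c \<Rightarrow> 'c) set \<Rightarrow> nat \<Rightarrow> ('c \<Rightarrow> 'c) set" where
  "iterated_commutators \<Gamma> 0 = \<Gamma>"
| "iterated_commutators \<Gamma> (Suc k) = {\<gamma> \<circ> \<delta> \<circ> inv_into UNIV \<gamma> \<circ> inv_into UNIV \<delta> |\<gamma> \<delta>.
     \<gamma> \<in> iterated_commutators \<Gamma> k \<and> \<delta> \<in> iterated_commutators \<Gamma> k}"

lemma iterated_commutators_subset:
  assumes "\<Gamma> \<subseteq> base_automorphisms j"
  shows "iterated_commutators \<Gamma> k \<subseteq> base_automorphisms j"
proof (induction k)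
  case (Suc k)
  then show ?case by (auto intro!: base_automorphisms_comp base_automorphisms_inv)
qed (use assms in simp)

text \<open>Restriction to \<open>N\<close> is multiplicative, so commutators of depth
  \<open>k\<close> restrict into the \<open>k\<close>-th derived subgroup, which is trivial for
  large \<open>k\<close>. The conditions on \<open>N\<close> are closure properties that pass to
  intersections, so they can be verified for \<open>galois_closure\<close> directly from its
  definition.\<close>

lemma iterated_commutators_in_derived:
  fixes j :: "'a::field \<Rightarrow> 'c::field"
  assumes closed: "1 \<in> N" "\<And>x y. x \<in> N \<Longrightarrow> y \<in> N \<Longrightarrow> x + y \<in> N" "\<And>x y. x \<in> N \<Longrightarrow> y \<in> N \<Longrightarrow> x * y \<in> N"
      "\<And>c. j c \<in> N"
    and stable: "\<And>\<tau> x. \<tau> \<in> base_automorphisms j \<Longrightarrow> x \<in> N \<Longrightarrow> \<tau> x \<in> N"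
    and solv: "solvable (galois_group j N)" and \<Gamma>: "\<Gamma> \<subseteq> base_automorphisms j"
  obtains k where "\<forall>\<tau>\<in>iterated_commutators \<Gamma> k. \<forall>x\<in>N. \<tau> x = x"
proof -
  define G where "G = galois_group j N"
  define H where "H = {h \<in> Bij N. h \<in> ring_hom (ring_of_type_algebra\<lparr>carrier := N\<rparr>) (ring_of_type_algebra\<lparr>carrier := N\<rparr>) \<and>
        (\<forall>c. h (j c) = j c)}"
  have GH: "G = (BijGroup N)\<lparr>carrier := H\<rparr>" unfolding G_def galois_group_def H_def ..
  have H_iff: "h \<in> H \<longleftrightarrow> h \<in> Bij N \<and> (\<forall>x\<in>N. \<forall>y\<in>N. h (x + y) = h x + h y \<and> h (x * y) = h x * h y) \<and> h 1 = 1 \<and> (\<forall>c. h (j c) = j c)" for h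
    using Bij_imp_funcset[of h N] by (auto simp: H_def ring_hom_def ring_of_type_algebra_def)
  have HN: "h x \<in> N" if "h \<in> H" "x \<in> N" for h x
    using that Bij_imp_funcset[of h N] by (auto simp: H_iff)
  \<comment> \<open>The elements of \<open>BijGroup N\<close> are extensional functions on
    \<open>N\<close>; hence inverses appear as restrictions and products as
    \<open>compose N\<close>.\<close>
  have sub: "subgroup H (BijGroup N)"
  proof (rule group.subgroupI[OF group_BijGroup])
    show "H \<subseteq> carrier (BijGroup N)" by (auto simp: H_iff BijGroup_def)
    have "(\<lambda>x\<in>N. x) \<in> H" using closed by (auto simp: H_iff id_Bij)
    then show "H \<noteq> {}" by blast
    fix h assume h: "h \<in> H"
    then have hB: "h \<in> Bij N" by (simp add: H_iff)
    have l: "inv_into N h (h x) = x" if "x \<in> N" for x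
      using hB that by (auto simp: Bij_def bij_betw_def)
    have r: "h (inv_into N h x) = x" "inv_into N h x \<in> N" if "x \<in> N" for x
      using hB that Bij_inv_into_mem[OF hB] by (auto simp: Bij_def bij_betw_def f_inv_into_f)
    have "inv\<^bsub>BijGroup N\<^esub> h = (\<lambda>x\<in>N. inv_into N h x)" by (rule inv_BijGroup[OF hB])
    also have "\<dots> \<in> H"
      unfolding H_iff
    proof (intro conjI ballI allI)
      show "restrict (inv_into N h) N \<in> Bij N" by (rule restrict_inv_into_Bij[OF hB])
      show "restrict (inv_into N h) N 1 = 1" using l[of 1] closed h by (simp add: H_iff)
      show "restrict (inv_into N h) N (j c) = j c" for c using l[of "j c"] closed h by (simp add: H_iff)
      fix x y assume xy: "x \<in> N" "y \<in> N"
      show "restrict (inv_into N h) N (x + y) = restrict (inv_into N h) N x + restrict (inv_into N h) N y"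
        using l[of "inv_into N h x + inv_into N h y"] xy closed r h by (simp add: H_iff)
      show "restrict (inv_into N h) N (x * y) = restrict (inv_into N h) N x * restrict (inv_into N h) N y"
        using l[of "inv_into N h x * inv_into N h y"] xy closed r h by (simp add: H_iff)
    qed
    finally show "inv\<^bsub>BijGroup N\<^esub> h \<in> H" .
    fix g assume g: "g \<in> H"
    have "h \<otimes>\<^bsub>BijGroup N\<^esub> g = compose N h g" using h g by (simp add: BijGroup_def H_iff)
    also have "\<dots> \<in> H"
      using h g HN[OF g] closed by (auto simp: H_iff compose_Bij compose_eq)
    finally show "h \<otimes>\<^bsub>BijGroup N\<^esub> g \<in> H" .
  qed
  have G: "group G" unfolding GH by (rule subgroup.subgroup_is_group[OF sub group_BijGroup])
  interpret G: group G by (rule G)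
  have oneG: "\<one>\<^bsub>G\<^esub> = (\<lambda>x\<in>N. x)" by (simp add: GH BijGroup_def)
  have carG: "carrier G = H" by (simp add: GH)
  have multG: "h \<otimes>\<^bsub>G\<^esub> g = compose N h g" if "h \<in> H" "g \<in> H" for h g
    using that by (simp add: GH BijGroup_def H_iff)
  define res where "res \<tau> = restrict \<tau> N" for \<tau> :: "'c \<Rightarrow> 'c"
  have invl: "inv_into UNIV \<tau> (\<tau> x) = x" and invr: "\<tau> (inv_into UNIV \<tau> x) = x" if "\<tau> \<in> base_automorphisms j" for \<tau> x
    using that by (auto simp: base_automorphisms_def bij_is_inj bij_is_surj surj_f_inv_f)
  have resH: "res \<tau> \<in> H" if \<tau>: "\<tau> \<in> base_automorphisms j" for \<tau>
  proof -
    have "bij_betw (restrict \<tau> N) N N"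
    proof (rule bij_betwI[where g = "inv_into UNIV \<tau>"])
      show "restrict \<tau> N \<in> N \<rightarrow> N" using stable[OF \<tau>] by auto
      show "inv_into UNIV \<tau> \<in> N \<rightarrow> N" using stable[OF base_automorphisms_inv[OF \<tau>]] by auto
      show "inv_into UNIV \<tau> (restrict \<tau> N x) = x" if "x \<in> N" for x using invl[OF \<tau>] that by simp
      show "restrict \<tau> N (inv_into UNIV \<tau> y) = y" if "y \<in> N" for y
        using invr[OF \<tau>] stable[OF base_automorphisms_inv[OF \<tau>] that] by simp
    qed
    then have "res \<tau> \<in> Bij N" by (simp add: res_def Bij_def)
    moreover have "ring_hom_on UNIV \<tau>" "\<And>c. \<tau> (j c) = j c" using \<tau> by (auto simp: base_automorphisms_def)
    ultimately show ?thesis using closed by (simp add: H_iff res_def ring_hom_on_def)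
  qed
  have resmult: "res (\<tau> \<circ> \<sigma>) = res \<tau> \<otimes>\<^bsub>G\<^esub> res \<sigma>" if "\<tau> \<in> base_automorphisms j" "\<sigma> \<in> base_automorphisms j" for \<tau> \<sigma>
    unfolding multG[OF resH[OF that(1)] resH[OF that(2)]]
    using stable[OF that(2)] by (auto simp: res_def compose_def fun_eq_iff)
  have resinv: "res (inv_into UNIV \<tau>) = inv\<^bsub>G\<^esub> (res \<tau>)" if \<tau>: "\<tau> \<in> base_automorphisms j" for \<tau>
  proof (rule G.inv_equality[symmetric])
    show "res (inv_into UNIV \<tau>) \<otimes>\<^bsub>G\<^esub> res \<tau> = \<one>\<^bsub>G\<^esub>"
      unfolding resmult[OF base_automorphisms_inv[OF \<tau>] \<tau>, symmetric] oneG
      using invl[OF \<tau>] by (auto simp: fun_eq_iff res_def)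
  qed (use resH[OF \<tau>] resH[OF base_automorphisms_inv[OF \<tau>]] in \<open>auto simp: carG\<close>)
  have der: "res \<tau> \<in> (derived G ^^ k) (carrier G)" if "\<tau> \<in> iterated_commutators \<Gamma> k" for \<tau> k
    using that
  proof (induction k arbitrary: \<tau>)
    case 0
    then show ?case using resH \<Gamma> by (auto simp: carG)
  next
    case (Suc k)
    then obtain \<gamma> \<delta> where \<gamma>\<delta>: "\<tau> = \<gamma> \<circ> \<delta> \<circ> inv_into UNIV \<gamma> \<circ> inv_into UNIV \<delta>"
      "\<gamma> \<in> iterated_commutators \<Gamma> k" "\<delta> \<in> iterated_commutators \<Gamma> k" by auto
    have b: "\<gamma> \<in> base_automorphisms j" "\<delta> \<in> base_automorphisms j"
      using iterated_commutators_subset[OF \<Gamma>] \<gamma>\<delta> by blast+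
    have "res \<tau> = res \<gamma> \<otimes>\<^bsub>G\<^esub> res \<delta> \<otimes>\<^bsub>G\<^esub> inv\<^bsub>G\<^esub> (res \<gamma>) \<otimes>\<^bsub>G\<^esub> inv\<^bsub>G\<^esub> (res \<delta>)"
      unfolding \<gamma>\<delta>(1) using b
      by (simp add: resmult resinv base_automorphisms_comp base_automorphisms_inv)
    then have "res \<tau> \<in> derived_set G ((derived G ^^ k) (carrier G))"
      using Suc.IH[OF \<gamma>\<delta>(2)] Suc.IH[OF \<gamma>\<delta>(3)] by blast
    then have "res \<tau> \<in> derived G ((derived G ^^ k) (carrier G))"
      unfolding derived_def[of G "(derived G ^^ k) (carrier G)"] by (rule generate.incl)
    then show ?case by simp
  qed
  obtain k where k: "(derived G ^^ k) (carrier G) = {\<one>\<^bsub>G\<^esub>}"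
    using solv G.solvable_iff_trivial_derived_seq unfolding G_def by blast
  show thesis
  proof (rule that, intro ballI)
    fix \<tau> x assume "\<tau> \<in> iterated_commutators \<Gamma> k" "x \<in> N"
    then have "res \<tau> = (\<lambda>x\<in>N. x)" using der[of \<tau> k] k oneG by auto
    then have "res \<tau> x = (\<lambda>x\<in>N. x) x" by simp
    then show "\<tau> x = x" using \<open>x \<in> N\<close> by (simp add: res_def)
  qed
qed

text \<open>This is where \<open>n > 4\<close> enters: a 3-cycle on \<open>a, b, c\<close> is the commutator of 3-cycles on
  \<open>a, d, c\<close> and \<open>c, b, e\<close>.\<close>

lemma three_cycles_are_iterated_commutators:
  fixes z :: "nat \<Rightarrow> 'c"
  assumes n: "n \<ge> 5" and inj: "\<And>\<tau>. \<tau> \<in> \<Gamma> \<Longrightarrow> bij \<tau>"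
    and full: "\<And>\<sigma>. \<sigma> permutes {..<n} \<Longrightarrow> \<exists>\<tau>\<in>\<Gamma>. \<forall>i<n. \<tau> (z i) = z (\<sigma> i)"
    and abc: "a < n" "b < n" "c < n" "a \<noteq> b" "b \<noteq> c" "a \<noteq> c"
  shows "\<exists>\<tau>\<in>iterated_commutators \<Gamma> k. bij \<tau> \<and> \<tau> (z a) = z b \<and> \<tau> (z b) = z c \<and> \<tau> (z c) = z a \<and>
    (\<forall>i<n. i \<noteq> a \<and> i \<noteq> b \<and> i \<noteq> c \<longrightarrow> \<tau> (z i) = z i)"
  using abc
proof (induction k arbitrary: a b c)
  case 0
  define \<sigma> where "\<sigma> = transpose a b \<circ> transpose b c"
  have "\<sigma> permutes {..<n}"
    unfolding \<sigma>_def using 0 by (intro permutes_compose permutes_swap_id) auto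
  then obtain \<tau> where \<tau>: "\<tau> \<in> \<Gamma>" "\<forall>i<n. \<tau> (z i) = z (\<sigma> i)" using full by blast
  have "\<sigma> a = b" "\<sigma> b = c" "\<sigma> c = a" "\<And>i. i \<noteq> a \<and> i \<noteq> b \<and> i \<noteq> c \<longrightarrow> \<sigma> i = i"
    using 0 by (auto simp: \<sigma>_def transpose_def)
  then show ?case using \<tau> inj 0 by (intro bexI[of _ \<tau>]) auto
next
  case (Suc k)
  have "card ({..<n} - {a, b, c}) \<ge> 2" using n Suc.prems by (subst card_Diff_subset) auto
  then obtain D where D: "D \<subseteq> {..<n} - {a, b, c}" "card D = 2" by (meson obtain_subset_with_card_n)
  then obtain d e where "D = {d, e}" "d \<noteq> e" by (meson card_2_iff)
  with D have de: "d < n" "e < n" "d \<noteq> e" "d \<noteq> a" "d \<noteq> b" "d \<noteq> c" "e \<noteq> a" "e \<noteq> b" "e \<noteq> c" by auto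
  have "\<exists>\<tau>\<in>iterated_commutators \<Gamma> k. bij \<tau> \<and> \<tau> (z a) = z d \<and> \<tau> (z d) = z c \<and> \<tau> (z c) = z a \<and>
      (\<forall>i<n. i \<noteq> a \<and> i \<noteq> d \<and> i \<noteq> c \<longrightarrow> \<tau> (z i) = z i)"
    by (rule Suc.IH) (use Suc.prems de in auto)
  then obtain \<gamma> where \<gamma>: "\<gamma> \<in> iterated_commutators \<Gamma> k" "bij \<gamma>" "\<gamma> (z a) = z d" "\<gamma> (z d) = z c" "\<gamma> (z c) = z a"
    "\<forall>i<n. i \<noteq> a \<and> i \<noteq> d \<and> i \<noteq> c \<longrightarrow> \<gamma> (z i) = z i"
    by (elim bexE conjE)
  have "\<exists>\<tau>\<in>iterated_commutators \<Gamma> k. bij \<tau> \<and> \<tau> (z c) = z b \<and> \<tau> (z b) = z e \<and> \<tau> (z e) = z c \<and>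
      (\<forall>i<n. i \<noteq> c \<and> i \<noteq> b \<and> i \<noteq> e \<longrightarrow> \<tau> (z i) = z i)"
    by (rule Suc.IH) (use Suc.prems de in auto)
  then obtain \<delta> where \<delta>: "\<delta> \<in> iterated_commutators \<Gamma> k" "bij \<delta>" "\<delta> (z c) = z b" "\<delta> (z b) = z e" "\<delta> (z e) = z c"
    "\<forall>i<n. i \<noteq> c \<and> i \<noteq> b \<and> i \<noteq> e \<longrightarrow> \<delta> (z i) = z i"
    by (elim bexE conjE)
  define \<gamma>' where "\<gamma>' = inv_into UNIV \<gamma>"
  define \<delta>' where "\<delta>' = inv_into UNIV \<delta>"
  have inv: "\<gamma>' y = x" if "\<gamma> x = y" for x y using \<gamma>(2) that unfolding \<gamma>'_def by (metis bij_is_inj inv_into_f_f UNIV_I)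
  have inv': "\<delta>' y = x" if "\<delta> x = y" for x y using \<delta>(2) that unfolding \<delta>'_def by (metis bij_is_inj inv_into_f_f UNIV_I)
  have g': "\<gamma>' (z d) = z a" "\<gamma>' (z c) = z d" "\<gamma>' (z a) = z c"
    "\<And>i. i < n \<Longrightarrow> i \<noteq> a \<Longrightarrow> i \<noteq> d \<Longrightarrow> i \<noteq> c \<Longrightarrow> \<gamma>' (z i) = z i"
    using inv[OF \<gamma>(3)] inv[OF \<gamma>(4)] inv[OF \<gamma>(5)] inv[OF \<gamma>(6)[rule_format]] by auto
  have d': "\<delta>' (z b) = z c" "\<delta>' (z e) = z b" "\<delta>' (z c) = z e"
    "\<And>i. i < n \<Longrightarrow> i \<noteq> c \<Longrightarrow> i \<noteq> b \<Longrightarrow> i \<noteq> e \<Longrightarrow> \<delta>' (z i) = z i"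
    using inv'[OF \<delta>(3)] inv'[OF \<delta>(4)] inv'[OF \<delta>(5)] inv'[OF \<delta>(6)[rule_format]] by auto
  \<comment> \<open>Read from right to left, \<open>z a\<close> passes through \<open>z a\<close>,
    \<open>z c\<close> and \<open>z b\<close> to \<open>z b\<close>; similarly \<open>z b\<close>
    ends at \<open>z c\<close> and \<open>z c\<close> at \<open>z a\<close>, while
    \<open>z d\<close> and \<open>z e\<close> are moved away and brought back.\<close>
  define \<tau> where "\<tau> = \<gamma> \<circ> \<delta> \<circ> \<gamma>' \<circ> \<delta>'"
  have "\<tau> \<in> iterated_commutators \<Gamma> (Suc k)" unfolding \<tau>_def \<gamma>'_def \<delta>'_def using \<gamma>(1) \<delta>(1) by auto
  moreover have "bij \<tau>"
    unfolding \<tau>_def \<gamma>'_def \<delta>'_def using \<gamma>(2) \<delta>(2) by (intro bij_comp bij_imp_bij_inv)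
  moreover have "\<tau> (z a) = z b"
    using Suc.prems de g' d' \<gamma> \<delta> by (simp add: \<tau>_def)
  moreover have "\<tau> (z b) = z c"
    using Suc.prems de g' d' \<gamma> \<delta> by (simp add: \<tau>_def)
  moreover have "\<tau> (z c) = z a"
    using Suc.prems de g' d' \<gamma> \<delta> by (simp add: \<tau>_def)
  moreover have "\<tau> (z i) = z i" if i: "i < n" "i \<noteq> a" "i \<noteq> b" "i \<noteq> c" for i
  proof -
    consider "i = d" | "i = e" | "i \<noteq> d" "i \<noteq> e" by blast
    then show ?thesis
      by cases (use Suc.prems de g' d' \<gamma> \<delta> i in \<open>simp_all add: \<tau>_def\<close>)
  qed
  ultimately show ?case by blast
qed

text \<open>This is the condition \<open>alg\<close> of the specialization theorems, for the closure
  of \<open>K\<close> over \<open>K_0\<close>. First \<open>K\<close> enters \<open>D\<close>, by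
  algebraicity over \<open>K_0\<close>; then the closure does, by algebraicity over
  \<open>K\<close>.\<close>

lemma closure_algebraic_over_base:
  fixes \<iota> :: "'a::field \<Rightarrow> 'k::field"
  assumes sep: "separable_extension \<iota> UNIV" and D: "subfield_set D" "range (to_ac \<circ> \<iota>) \<subseteq> D"
    and cl: "\<And>p x. p \<in> polys_over D \<Longrightarrow> p \<noteq> 0 \<Longrightarrow> poly p x = 0 \<Longrightarrow> x \<in> D"
    and \<iota>: "ring_hom_on UNIV \<iota>"
  shows "D = (UNIV :: 'k alg_closure set)"
proof -
  have ac: "ring_hom_on UNIV (to_ac :: 'k \<Rightarrow> _)" by (simp add: ring_hom_on_def)
  have ac_D: "to_ac k \<in> D" for k
  proof -
    obtain p where p: "irreducible p" "poly (map_poly \<iota> p) k = 0"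
      using sep unfolding separable_extension_def by blast
    define P where "P = map_poly to_ac (map_poly \<iota> p)"
    have "P \<noteq> 0" using p map_poly_inj_hom[OF \<iota>, of p 0] map_poly_inj_hom[OF ac, of "map_poly \<iota> p" 0] by (auto simp: P_def)
    moreover have "P \<in> polys_over D"
      using D(2) by (auto simp: P_def polys_over_def coeff_map_poly ring_hom_onD[OF subring_set_UNIV \<iota>])
    moreover have "poly P (to_ac k) = 0"
      using poly_map_poly_hom_on[OF subring_set_UNIV ac, of "map_poly \<iota> p" k] p by (simp add: P_def)
    ultimately show ?thesis using cl by blast
  qed
  have "x \<in> D" for x
  proof -
    obtain p :: "'k poly" where p: "p \<noteq> 0" "poly (map_poly to_ac p) x = 0" using alg_closure_algebraic by blast
    then have "map_poly to_ac p \<noteq> 0" using map_poly_inj_hom[OF ac, of p 0] by auto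
    moreover have "map_poly to_ac p \<in> polys_over D" using ac_D by (auto simp: polys_over_def coeff_map_poly)
    ultimately show ?thesis using cl p(2) by blast
  qed
  then show ?thesis by blast
qed

section \<open>Simple roots, derivatives and separable elements\<close>

lemma simple_roots_product:
  fixes P :: "'c::alg_closed_field poly"
  assumes P: "lead_coeff P = 1" and simple: "\<And>a. poly P a = 0 \<Longrightarrow> poly (pderiv P) a \<noteq> 0"
  shows "P = (\<Prod>b\<in>{b. poly P b = 0}. [:- b, 1:])"
proof -
  have P0: "P \<noteq> 0" using P by auto
  define S where "S = {b. poly P b = 0}"
  have S: "finite S" unfolding S_def by (rule poly_roots_finite[OF P0])
  have "(\<Prod>b\<in>S. [:- b, 1:]) dvd P" by (rule prod_distinct_roots_dvd[OF S]) (auto simp: S_def)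
  then obtain Q where Q: "P = (\<Prod>b\<in>S. [:- b, 1:]) * Q" by (elim dvdE)
  have "degree Q = 0"
  proof (rule ccontr)
    assume "degree Q \<noteq> 0"
    then obtain y where y: "poly Q y = 0" using alg_closed_imp_poly_has_root by blast
    have "poly P y = 0" using arg_cong[OF Q, of "\<lambda>p. poly p y"] y by simp
    then have yS: "y \<in> S" by (simp add: S_def)
    obtain Q' where Q': "Q = [:- y, 1:] * Q'" using y by (auto simp: poly_eq_0_iff_dvd elim: dvdE)
    have "P = ([:- y, 1:] * [:- y, 1:]) * ((\<Prod>b\<in>S - {y}. [:- b, 1:]) * Q')"
      unfolding Q Q' prod.remove[OF S yS] by (simp only: ac_simps)
    then have "poly (pderiv P) y = 0" by (simp only: pderiv_mult poly_add poly_mult) simp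
    then show False using simple[of y] yS by (auto simp: S_def)
  qed
  then obtain c where c: "Q = [:c:]" using degree_eq_zeroE by blast
  have "lead_coeff P = lead_coeff (\<Prod>b\<in>S. [:- b, 1:]) * lead_coeff Q" unfolding Q by (rule lead_coeff_mult)
  then have "c = 1" using P lead_coeff_prod_linear[of "\<lambda>b. b" S] c by simp
  with Q c show ?thesis by (simp add: S_def)
qed

lemma map_poly_pderiv_hom:
  assumes j: "ring_hom_on UNIV (j :: 'a::field \<Rightarrow> 'w::field)"
  shows "map_poly j (pderiv p) = pderiv (map_poly j p)"
proof (induction p)
  case (pCons a p)
  then show ?case
    by (simp add: pderiv_pCons map_poly_hom_on_add[OF subring_set_UNIV j] map_poly_hom_on_pCons[OF subring_set_UNIV j]
        ring_hom_onD[OF subring_set_UNIV j])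
qed simp

lemma rsquarefree_imp_pderiv_nonzero:
  fixes P :: "'c::alg_closed_field poly"
  assumes "rsquarefree P" "degree P > 0"
  shows "pderiv P \<noteq> 0"
proof
  assume d: "pderiv P = 0"
  obtain x where x: "poly P x = 0" using alg_closed_imp_poly_has_root[OF assms(2)] by blast
  then obtain Q where Q: "P = [:- x, 1:] * Q" by (auto simp: poly_eq_0_iff_dvd elim: dvdE)
  have "pderiv P = [:- x, 1:] * pderiv Q + Q * 1" unfolding Q by (simp only: pderiv_mult) (simp add: pderiv_pCons)
  then have "poly (pderiv P) x = poly Q x" by simp
  then have "[:- x, 1:] dvd Q" using d by (simp add: poly_eq_0_iff_dvd)
  then have "[:- x, 1:] ^ 2 dvd P" unfolding Q power2_eq_square by (rule mult_dvd_mono[OF dvd_refl])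
  moreover have "P \<noteq> 0" using assms by auto
  ultimately have "order x P \<ge> 2" by (simp add: order_divides)
  moreover have "order x P = 0 \<or> order x P = 1" using assms(1) unfolding rsquarefree_def by blast
  ultimately show False by auto
qed

text \<open>\<open>separable_poly\<close> speaks of roots in the algebraic closure of
  \<open>'a\<close>, while the roots are needed in \<open>'c\<close>. The bridge is
  \<open>pderiv p \<noteq> 0\<close>, a condition on \<open>p\<close> alone, which for irreducible
  \<open>p\<close> excludes multiple roots in every extension.\<close>

lemma separable_element_splits:
  fixes j :: "'a::field \<Rightarrow> 'c::alg_closed_field"
  assumes j: "ring_hom_on UNIV j" and p: "irreducible p" "separable_poly p" "poly (map_poly j p) x = 0"
  shows "separable_over (range j) x"
proof -
  have ac: "ring_hom_on UNIV (to_ac :: 'a \<Rightarrow> _)" by (simp add: ring_hom_on_def)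
  have p0: "p \<noteq> 0" using p by auto
  have dp: "degree p > 0" using p(1) by (metis gr0I irreducible_def is_unit_iff_degree)
  have "pderiv (map_poly to_ac p) \<noteq> 0"
    using p(2) dp unfolding separable_poly_def
    by (intro rsquarefree_imp_pderiv_nonzero) (auto simp: degree_map_poly_hom[OF ac])
  then have dp0: "pderiv p \<noteq> 0" by (auto simp flip: map_poly_pderiv_hom[OF ac])
  define P where "P = map_poly j (smult (inverse (lead_coeff p)) p)"
  have lc: "lead_coeff P = 1"
    unfolding P_def using p0 by (intro map_poly_hom_on_monic[OF subring_set_UNIV j]) simp
  have Pp: "P = smult (j (inverse (lead_coeff p))) (map_poly j p)"
    unfolding P_def by (rule map_poly_hom_on_smult[OF subring_set_UNIV j]) auto
  have c0: "j (inverse (lead_coeff p)) \<noteq> 0" using p0 ring_hom_on_nonzero[OF subfield_set_UNIV j] by auto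
  have simple: "poly (pderiv P) a \<noteq> 0" if "poly P a = 0" for a
  proof
    assume "poly (pderiv P) a = 0"
    then have "poly (map_poly j (pderiv p)) a = 0" using c0 by (simp add: Pp pderiv_smult map_poly_pderiv_hom[OF j])
    moreover have "poly (map_poly j p) a = 0" using that c0 by (simp add: Pp)
    ultimately have "p dvd pderiv p" using irreducible_dvd_of_common_root[OF j p(1)] by blast
    then have "degree p \<le> degree (pderiv p)" using dp0 by (rule dvd_imp_degree_le)
    moreover have "degree (pderiv p) \<le> degree p - 1"
      by (rule degree_le) (auto simp: coeff_pderiv intro: coeff_eq_0)
    ultimately show False using dp by simp
  qed
  define S where "S = {b. poly P b = 0}"
  have "P = (\<Prod>b\<in>S. [:- b, 1:])" unfolding S_def by (rule simple_roots_product[OF lc simple])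
  moreover have "P \<in> polys_over (range j)" using polys_over_range[OF j] by (auto simp: P_def)
  moreover have "P \<noteq> 0" using lc by auto
  then have "finite S" unfolding S_def by (rule poly_roots_finite)
  moreover have "x \<in> S" using p(3) by (simp add: S_def Pp)
  ultimately show ?thesis
    unfolding separable_over_def by (intro exI[of _ S]) simp
qed

text \<open>The generator has to lie in \<open>K\<close>, so it is sought in the ring
  \<open>range to_ac\<close>. The computation takes place in the algebraic closure because
  \<open>separable_over\<close> asks for the presence of all roots of a polynomial.\<close>

lemma prosolvable_primitive_element:
  fixes \<iota> :: "'a::field \<Rightarrow> 'k::field"
  assumes \<iota>: "ring_hom_on UNIV \<iota>" and sep: "separable_extension \<iota> UNIV" and inf: "infinite (UNIV :: 'a set)"
    and B: "finite B"
  obtains \<omega> where "to_ac ` B \<subseteq> field_hull (insert (to_ac \<omega>) (range (to_ac \<circ> \<iota>)))"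
proof -
  define j where "j = to_ac \<circ> \<iota>"
  have ac: "ring_hom_on UNIV (to_ac :: 'k \<Rightarrow> _)" by (simp add: ring_hom_on_def)
  have j: "ring_hom_on UNIV j" using \<iota> by (auto simp: j_def ring_hom_on_def)
  have E: "subfield_set (range j)" using subfield_range_hom[OF j] by simp
  have Einf: "infinite (range j)"
  proof -
    have "inj j" using ring_hom_on_eq_iff[OF subfield_set_UNIV j] by (auto simp: inj_def)
    then show ?thesis using inf finite_imageD by blast
  qed
  have R: "subring_set (range (to_ac :: 'k \<Rightarrow> _))" by (rule subring_range_hom[OF ac]) simp
  have *: "\<exists>p. irreducible p \<and> separable_poly p \<and> poly (map_poly j p) (to_ac k) = 0" for k
  proof -
    obtain p where p: "irreducible p" "poly (map_poly \<iota> p) k = 0" "separable_poly p"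
      using sep unfolding separable_extension_def by blast
    have "map_poly j p = map_poly to_ac (map_poly \<iota> p)"
      using map_poly_comp_hom[of to_ac \<iota> p] ring_hom_onD(1)[OF subring_set_UNIV \<iota>] by (simp add: j_def comp_def)
    then have "poly (map_poly j p) (to_ac k) = 0"
      using poly_map_poly_hom_on[OF subring_set_UNIV ac, of "map_poly \<iota> p" k] p by simp
    with p show ?thesis by blast
  qed
  have alg: "algebraic_over (range j) x" if x: "x \<in> range to_ac" for x
  proof -
    obtain k where k: "x = to_ac k" using x by blast
    obtain p where p: "irreducible p" "poly (map_poly j p) x = 0" using * k by blast
    then have "map_poly j p \<noteq> 0" using map_poly_inj_hom[OF j, of p 0] by auto
    with p show ?thesis unfolding algebraic_over_def using polys_over_range[OF j] by blast
  qed
  have sepo: "separable_over (range j) x" if x: "x \<in> to_ac ` B" for x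
  proof -
    obtain k where k: "x = to_ac k" using x by blast
    obtain p where "irreducible p" "separable_poly p" "poly (map_poly j p) x = 0" using * k by blast
    then show ?thesis by (rule separable_element_splits[OF j])
  qed
  obtain \<gamma> where \<gamma>: "\<gamma> \<in> range to_ac" "insert 0 (to_ac ` B) \<subseteq> field_hull (insert \<gamma> (range j))"
  proof (rule primitive_element[OF E Einf R, where B = "to_ac ` B" and \<alpha> = 0])
    show "range j \<subseteq> range to_ac" by (auto simp: j_def)
    show "0 \<in> range (to_ac :: 'k \<Rightarrow> _)" by (rule subring_setD[OF R])
  qed (use alg sepo B in auto)
  then show thesis using that unfolding j_def by auto
qed

lemma simple_extension_finite:
  fixes \<iota> :: "'a::field \<Rightarrow> 'k::field"
  assumes \<iota>: "ring_hom_on UNIV \<iota>" and alg: "algebraic_over (range \<iota>) \<omega>"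
  shows "finite_extension \<iota> (field_hull (insert \<omega> (range \<iota>)))"
proof -
  define E where "E = range \<iota>"
  define L where "L = field_hull (insert \<omega> E)"
  have E: "subfield_set E" using subfield_range_hom[OF \<iota>] by (simp add: E_def)
  note EA = subfield_set_imp_subring[OF E]
  have algE: "algebraic_over E \<omega>" using alg by (simp add: E_def)
  have Lsf: "subfield_set L" unfolding L_def by (rule subfield_field_hull)
  note LA = subring_setD[OF subfield_set_imp_subring[OF Lsf]]
  have sup: "insert \<omega> E \<subseteq> L" unfolding L_def by (rule field_hull_superset)
  have L: "L = {poly p \<omega> |p. p \<in> polys_over E}" unfolding L_def by (rule simple_algebraic_extension[OF E algE])
  obtain m where m: "m \<in> polys_over E" "lead_coeff m = 1" "poly m \<omega> = 0"
    using min_poly_exists[OF E algE] by metis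
  interpret V: vector_space "ext_scale \<iota>"
    by (rule vector_space_ext_scale) (simp add: field_embedding_iff_hom_on \<iota>)
  define B where "B = (\<lambda>i. \<omega> ^ i) ` {..<degree m}"
  have "V.span B = L"
  proof
    have "\<iota> c \<in> L" for c using sup by (auto simp: E_def)
    then have "V.subspace L"
      unfolding V.subspace_def using LA by (auto simp: ext_scale_def)
    moreover have "B \<subseteq> L" using sup LA(7) by (auto simp: B_def)
    ultimately show "V.span B \<subseteq> L" by (rule V.span_minimal[rotated])
    show "L \<subseteq> V.span B"
    proof
      fix y assume "y \<in> L"
      then obtain p where p: "p \<in> polys_over E" "y = poly p \<omega>" unfolding L by blast
      obtain q r where qr: "q \<in> polys_over E" "r \<in> polys_over E" "p = q * m + r" "r = 0 \<or> degree r < degree m"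
        using monic_division[OF EA m(1,2) p(1)] by blast
      have "y = poly r \<omega>" using p qr m by simp
      also have "\<dots> = (\<Sum>i\<le>degree r. coeff r i * \<omega> ^ i)" by (rule poly_altdef)
      also have "\<dots> \<in> V.span B"
      proof (rule V.span_sum)
        fix i assume i: "i \<in> {..degree r}"
        obtain c where c: "coeff r i = \<iota> c" using polys_overD[OF qr(2), of i] by (auto simp: E_def)
        show "coeff r i * \<omega> ^ i \<in> V.span B"
        proof (cases "r = 0")
          case False
          then have "i < degree m" using i qr(4) by auto
          then have "\<omega> ^ i \<in> V.span B" by (intro V.span_base) (auto simp: B_def)
          then show ?thesis using V.span_scale[of "\<omega> ^ i" B c] by (simp add: ext_scale_def c)
        qed (simp add: V.span_zero)
      qed
      finally show "y \<in> V.span B" .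
    qed
  qed
  moreover have "finite B" by (simp add: B_def)
  moreover have "intermediate_field \<iota> L"
    unfolding intermediate_field_def using subfield_ring_of_type_algebraI[OF Lsf] sup by (auto simp: E_def)
  ultimately show ?thesis unfolding finite_extension_def L_def E_def by blast
qed

text \<open>The minimal polynomial \<open>\<mu>\<close> over \<open>K\<close> of one root has
  finitely many coefficients, so they lie in a finite subextension, and commutators of some fixed
  depth \<open>k\<close> fix its Galois closure. Such commutators include 3-cycles taking root 0 to
  any other root. As they fix \<open>\<mu>\<close>, all \<open>n\<close> roots of \<open>f\<close>
  are roots of \<open>\<mu>\<close>.\<close>

theorem prosolvable_irreducible:
  fixes \<iota> :: "'a::field \<Rightarrow> 'k::field"
  assumes \<iota>: "ring_hom_on UNIV \<iota>" and pros: "prosolvable \<iota>" and inf: "infinite (UNIV :: 'a set)"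
    and n: "n \<ge> 5" and C: "range (to_ac \<circ> \<iota>) \<subseteq> C" and full: "full_symmetric C (map_poly to_ac f) n z"
  shows "irreducible (f :: 'k poly)"
proof -
  define j where "j = to_ac \<circ> \<iota>"
  have ac: "ring_hom_on UNIV (to_ac :: 'k \<Rightarrow> _)" by (simp add: ring_hom_on_def)
  have j: "ring_hom_on UNIV j" using \<iota> by (auto simp: j_def ring_hom_on_def)
  have sep: "separable_extension \<iota> UNIV" using pros by (simp add: prosolvable_def)
  have f: "map_poly to_ac f = (\<Prod>i<n. [:- z i, 1:])" and zinj: "inj_on z {..<n}"
    and sym: "\<And>\<sigma>. \<sigma> permutes {..<n} \<Longrightarrow>
      \<exists>\<gamma>. ring_hom_on UNIV \<gamma> \<and> bij \<gamma> \<and> (\<forall>c\<in>C. \<gamma> c = c) \<and> (\<forall>i<n. \<gamma> (z i) = z (\<sigma> i))"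
    using full unfolding full_symmetric_def by blast+
  have z0: "poly (map_poly to_ac f) (z 0) = 0"
    unfolding f poly_prod using n by (intro prod_zero) (auto intro!: bexI[of _ 0])
  have f0: "map_poly to_ac f \<noteq> 0" unfolding f by simp
  have "algebraic_over (range to_ac) (z 0)"
    unfolding algebraic_over_def using z0 f0 polys_over_range[OF ac] by blast
  then obtain \<mu> where \<mu>: "irreducible \<mu>" "lead_coeff \<mu> = 1" "poly (map_poly to_ac \<mu>) (z 0) = 0"
    and dvd: "\<And>q. poly (map_poly to_ac q) (z 0) = 0 \<Longrightarrow> \<mu> dvd q"
    using hom_min_poly[OF ac] by blast
  obtain \<omega> where \<omega>: "to_ac ` set (coeffs \<mu>) \<subseteq> field_hull (insert (to_ac \<omega>) (range (to_ac \<circ> \<iota>)))"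
    using prosolvable_primitive_element[OF \<iota> sep inf, of "set (coeffs \<mu>)"] by blast
  have \<omega>alg: "algebraic_over (range \<iota>) \<omega>"
  proof -
    obtain p where p: "irreducible p" "poly (map_poly \<iota> p) \<omega> = 0"
      using sep unfolding separable_extension_def by blast
    then have "map_poly \<iota> p \<noteq> 0" using map_poly_inj_hom[OF \<iota>, of p 0] by auto
    with p show ?thesis unfolding algebraic_over_def using polys_over_range[OF \<iota>] by blast
  qed
  define L where "L = field_hull (insert \<omega> (range \<iota>))"
  have fin: "finite_extension \<iota> L" unfolding L_def by (rule simple_extension_finite[OF \<iota> \<omega>alg])
  have Lsup: "insert \<omega> (range \<iota>) \<subseteq> L" unfolding L_def by (rule field_hull_superset)
  have "subfield_set (to_ac ` L)"
    by (rule subfield_range_hom[OF ring_hom_on_subset[OF ac]]) (auto simp: L_def subfield_field_hull)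
  then have "field_hull (insert (to_ac \<omega>) (range (to_ac \<circ> \<iota>))) \<subseteq> to_ac ` L"
    using Lsup by (intro field_hull_minimal) auto
  with \<omega> have coeffL: "to_ac ` set (coeffs \<mu>) \<subseteq> to_ac ` L" by blast
  define N where "N = galois_closure j (to_ac ` L)"
  have solv: "solvable (galois_group j N)"
    using pros fin unfolding prosolvable_def N_def j_def by blast
  have LN: "to_ac ` L \<subseteq> N" unfolding N_def galois_closure_def by blast
  have interm: "intermediate_field j M" if "galois_extension j M" for M
    using that unfolding galois_extension_def separable_extension_def by blast
  have NI: "y \<in> N" if "\<And>M. galois_extension j M \<Longrightarrow> to_ac ` L \<subseteq> M \<Longrightarrow> y \<in> M" for y
    using that unfolding N_def galois_closure_def by blast
  have ND: "y \<in> M" if "y \<in> N" "galois_extension j M" "to_ac ` L \<subseteq> M" for y M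
    using that unfolding N_def galois_closure_def by blast
  define \<Gamma> where "\<Gamma> = {\<tau>. ring_hom_on UNIV \<tau> \<and> bij \<tau> \<and> (\<forall>c\<in>C. \<tau> c = c)}"
  have \<Gamma>: "\<Gamma> \<subseteq> base_automorphisms j"
    using C by (auto simp: \<Gamma>_def base_automorphisms_def j_def)
  obtain k where k: "\<forall>\<tau>\<in>iterated_commutators \<Gamma> k. \<forall>x\<in>N. \<tau> x = x"
  proof (rule iterated_commutators_in_derived[OF _ _ _ _ _ solv \<Gamma>])
    show "1 \<in> N" by (rule NI) (rule intermediate_field_closed(1)[OF interm])
    show "x + y \<in> N" if "x \<in> N" "y \<in> N" for x y
      by (rule NI, rule intermediate_field_closed(2)[OF interm]) (use ND that in auto)
    show "x * y \<in> N" if "x \<in> N" "y \<in> N" for x y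
      by (rule NI, rule intermediate_field_closed(3)[OF interm]) (use ND that in auto)
    show "j c \<in> N" for c by (rule NI) (rule intermediate_field_closed(4)[OF interm])
    show "\<tau> x \<in> N" if \<tau>: "\<tau> \<in> base_automorphisms j" and x: "x \<in> N" for \<tau> x
    proof (rule NI)
      fix M assume M: "galois_extension j M" "to_ac ` L \<subseteq> M"
      have "ring_hom_on UNIV \<tau>" "\<And>c. \<tau> (j c) = j c" using \<tau> by (auto simp: base_automorphisms_def)
      then show "\<tau> x \<in> M" using ND[OF x M] by (rule galois_extension_stable[OF j M(1)])
    qed
  qed
  have root: "poly (map_poly to_ac \<mu>) (z i) = 0" if i: "i < n" for i
  proof (cases "i = 0")
    case False
    \<comment> \<open>A third index, so that there is a 3-cycle taking 0 to
      \<open>i\<close>.\<close>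
    obtain c where c: "c < n" "c \<noteq> 0" "c \<noteq> i"
    proof -
      have "(if i = 1 then 2 else 1) < n" "(if i = 1 then 2 else 1 :: nat) \<noteq> 0" "(if i = 1 then 2 else 1) \<noteq> i"
        using n by auto
      then show thesis by (rule that)
    qed
    have "\<exists>\<tau>\<in>iterated_commutators \<Gamma> k. bij \<tau> \<and> \<tau> (z 0) = z i \<and> \<tau> (z i) = z c \<and> \<tau> (z c) = z 0 \<and>
      (\<forall>l<n. l \<noteq> 0 \<and> l \<noteq> i \<and> l \<noteq> c \<longrightarrow> \<tau> (z l) = z l)"
    proof (rule three_cycles_are_iterated_commutators[OF n])
      show "bij \<tau>" if "\<tau> \<in> \<Gamma>" for \<tau> using that by (simp add: \<Gamma>_def)
      show "\<exists>\<tau>\<in>\<Gamma>. \<forall>l<n. \<tau> (z l) = z (\<sigma> l)" if "\<sigma> permutes {..<n}" for \<sigma>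
        using sym[OF that] unfolding \<Gamma>_def by blast
    qed (use c i False n in auto)
    then obtain \<tau> where \<tau>: "\<tau> \<in> iterated_commutators \<Gamma> k" "\<tau> (z 0) = z i" by blast
    have \<tau>h: "ring_hom_on UNIV \<tau>"
      using iterated_commutators_subset[OF \<Gamma>] \<tau>(1) by (auto simp: base_automorphisms_def)
    note \<tau>D = ring_hom_onD[OF subring_set_UNIV \<tau>h]
    have "\<tau> (to_ac (coeff \<mu> l)) = to_ac (coeff \<mu> l)" for l
    proof (cases "coeff \<mu> l = 0")
      case False
      then have "coeff \<mu> l \<in> set (coeffs \<mu>)" by (metis coeff_in_coeffs coeff_0 le_degree)
      then have "to_ac (coeff \<mu> l) \<in> N" using coeffL LN by blast
      then show ?thesis by (rule k[rule_format, OF \<tau>(1)])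
    qed (simp add: \<tau>D)
    then have "map_poly \<tau> (map_poly to_ac \<mu>) = map_poly to_ac \<mu>"
      by (intro poly_eqI) (simp add: coeff_map_poly \<tau>D)
    then show ?thesis
      using poly_map_poly_hom_on[OF subring_set_UNIV \<tau>h, of "map_poly to_ac \<mu>" "z 0"] \<mu>(3) \<tau>(2) by (simp add: \<tau>D)
  qed (use \<mu> in simp)
  \<comment> \<open>Together with \<open>\<mu> dvd f\<close>, the comparison of degrees leaves only
    a unit as the cofactor.\<close>
  have "map_poly to_ac f dvd map_poly to_ac \<mu>"
    unfolding f by (rule prod_distinct_roots_dvd[OF _ zinj]) (use root in auto)
  moreover have "map_poly to_ac \<mu> \<noteq> 0" using \<mu>(1) map_poly_inj_hom[OF ac, of \<mu> 0] by auto
  ultimately have "degree f \<le> degree \<mu>"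
    using dvd_imp_degree_le by (metis degree_map_poly_hom[OF ac])
  moreover obtain q where q: "f = \<mu> * q" using dvd[OF z0] by (elim dvdE)
  moreover have "f \<noteq> 0" using f0 by auto
  ultimately have "q \<noteq> 0" "degree q = 0" by (auto simp: degree_mult_eq)
  then have "q dvd 1" by (simp add: is_unit_iff_degree)
  then obtain r where "1 = q * r" by (elim dvdE)
  then have "\<mu> = f * r" using q by (metis mult.assoc mult.right_neutral)
  moreover have "\<not> f dvd 1" using irreducible_not_unit[OF \<mu>(1)] q dvd_mult_left by blast
  ultimately show ?thesis using irreducible_mono[OF \<mu>(1)] by (metis dvd_triv_left)
qed

section \<open>Separability of simple extensions\<close>

lemma map_poly_pcompose_hom:
  assumes j: "ring_hom_on UNIV (j :: 'a::field \<Rightarrow> 'w::field)"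
  shows "map_poly j (pcompose r q) = pcompose (map_poly j r) (map_poly j q)"
proof (induction r)
  case (pCons a r)
  then show ?case
    by (simp add: pcompose_pCons map_poly_hom_on_add[OF subring_set_UNIV j] map_poly_hom_on_mult[OF subring_set_UNIV j]
        map_poly_hom_on_pCons[OF subring_set_UNIV j] ring_hom_onD[OF subring_set_UNIV j])
qed simp

lemma dvd_distinct_linear_product:
  fixes m :: "'c::alg_closed_field poly"
  assumes S: "finite S" and m: "lead_coeff m = 1" "m dvd (\<Prod>b\<in>S. [:- b, 1:])"
  shows "m = (\<Prod>b\<in>{b. poly m b = 0}. [:- b, 1:])"
proof (rule simple_roots_product[OF m(1)])
  fix a assume a: "poly m a = 0"
  obtain h where h: "(\<Prod>b\<in>S. [:- b, 1:]) = m * h" using m(2) by (elim dvdE)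
  have "poly (\<Prod>b\<in>S. [:- b, 1:]) a = 0" unfolding h using a by simp
  then have aS: "a \<in> S" using S by (auto simp: poly_prod)
  obtain n where n: "m = [:- a, 1:] * n" using a by (auto simp: poly_eq_0_iff_dvd elim: dvdE)
  have "[:- a, 1:] * (\<Prod>b\<in>S - {a}. [:- b, 1:]) = [:- a, 1:] * (n * h)"
    using h unfolding n prod.remove[OF S aS] by (simp only: mult.assoc)
  then have "(\<Prod>b\<in>S - {a}. [:- b, 1:]) = n * h" by (subst (asm) mult_cancel_left) auto
  moreover have "poly (\<Prod>b\<in>S - {a}. [:- b, 1:]) a \<noteq> 0" using S by (auto simp: poly_prod)
  ultimately have "poly n a \<noteq> 0" by auto
  moreover have "pderiv m = [:- a, 1:] * pderiv n + n * 1"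
    unfolding n by (simp only: pderiv_mult) (simp add: pderiv_pCons)
  then have "poly (pderiv m) a = poly n a" by simp
  ultimately show "poly (pderiv m) a \<noteq> 0" by simp
qed

text \<open>An element with inseparable minimal polynomial \<open>m(X) = m1(X^p)\<close> would lie in the field
  generated by its \<open>p\<close>-th power, which has too small a degree.\<close>

lemma separable_simple_extension:
  fixes j :: "'a::field \<Rightarrow> 'c::alg_closed_field"
  assumes j: "ring_hom_on UNIV j" and x: "separable_over (range j) x"
    and y: "y \<in> field_hull (insert x (range j))" and m: "irreducible m" "poly (map_poly j m) y = 0"
  shows "pderiv m \<noteq> 0"
proof
  assume dm: "pderiv m = 0"
  note jD = ring_hom_onD[OF subring_set_UNIV j]
  define p where "p = CHAR('a)"
  define d where "d = degree m"
  have m0: "m \<noteq> 0" using m by auto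
  have d: "d > 0" using m(1) unfolding d_def by (metis gr0I irreducible_def is_unit_iff_degree)
  have pdvd: "p dvd i" if i: "coeff m i \<noteq> 0" for i
  proof (cases i)
    case (Suc l)
    have "coeff (pderiv m) l = 0" using dm by simp
    then have "of_nat i * coeff m i = 0" by (simp add: coeff_pderiv Suc)
    then have "of_nat i = (0 :: 'a)" using i by simp
    then show ?thesis by (simp add: p_def of_nat_eq_0_iff_char_dvd)
  qed simp
  have pd: "p dvd d" using pdvd[of d] m0 by (simp add: d_def)
  then obtain k where k: "d = p * k" by (elim dvdE)
  \<comment> \<open>Characteristic 0 is excluded here: 0 does not divide the positive degree
    \<open>d\<close>.\<close>
  have p0: "p > 0" using k d by (cases p) auto
  have p: "prime p" unfolding p_def by (rule prime_CHAR_semidom) (use p0 in \<open>simp add: p_def\<close>)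
  then have p2: "p \<ge> 2" by (rule prime_ge_2_nat)
  have k0: "k > 0" using k d by (cases k) auto
  \<comment> \<open>So that \<open>m(X) = m1(X^p)\<close>. The summation bound \<open>d\<close> is
    generous; the terms beyond \<open>k\<close> vanish.\<close>
  define m1 where "m1 = (\<Sum>i\<le>d. monom (coeff m (p * i)) i)"
  have cm1: "coeff m1 i = coeff m (p * i)" for i
  proof -
    have "coeff m (p * i) = 0" if "\<not> i \<le> d"
    proof (rule coeff_eq_0)
      have "i \<le> p * i" using p0 by simp
      then show "degree m < p * i" using that unfolding d_def by linarith
    qed
    then show ?thesis by (auto simp: m1_def coeff_sum)
  qed
  have lm1: "coeff m1 k \<noteq> 0" using m0 by (simp add: cm1 d_def flip: k)
  have "degree m1 \<le> k"
  proof (rule degree_le, intro allI impI)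
    fix i assume "k < i"
    then have "d < p * i" using k p0 by simp
    then show "coeff m1 i = 0" unfolding cm1 d_def by (rule coeff_eq_0)
  qed
  then have dm1: "degree m1 = k" using le_degree[OF lm1] by simp
  define w where "w = y ^ p"
  have m1w: "poly (map_poly j m1) w = 0"
  proof -
    have "poly (map_poly j m) y = (\<Sum>i\<le>d. j (coeff m i) * y ^ i)"
      by (simp add: poly_altdef degree_map_poly_hom[OF j] coeff_map_poly jD d_def)
    also have "\<dots> = (\<Sum>i\<in>(\<lambda>l. p * l) ` {..k}. j (coeff m i) * y ^ i)"
    proof (rule sum.mono_neutral_right)
      show "(\<lambda>l. p * l) ` {..k} \<subseteq> {..d}" using k by auto
      show "\<forall>i\<in>{..d} - (\<lambda>l. p * l) ` {..k}. j (coeff m i) * y ^ i = 0"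
      proof
        fix i assume i: "i \<in> {..d} - (\<lambda>l. p * l) ` {..k}"
        have "coeff m i = 0"
        proof (rule ccontr)
          assume "coeff m i \<noteq> 0"
          then obtain l where l: "i = p * l" using pdvd by (auto elim: dvdE)
          then have "l \<le> k" using i k p0 by auto
          with l i show False by auto
        qed
        then show "j (coeff m i) * y ^ i = 0" by (simp add: jD)
      qed
    qed simp
    also have "\<dots> = (\<Sum>l\<le>k. j (coeff m1 l) * w ^ l)"
      using p0 by (subst sum.reindex) (auto simp: inj_on_def cm1 w_def power_mult)
    also have "\<dots> = poly (map_poly j m1) w"
      by (simp add: poly_altdef degree_map_poly_hom[OF j] coeff_map_poly jD dm1)
    finally show ?thesis using m(2) by simp
  qed
  define E where "E = range j"
  have E: "subfield_set E" using subfield_range_hom[OF j] by (simp add: E_def)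
  have m10: "m1 \<noteq> 0" using lm1 by auto
  have walg: "algebraic_over E w"
    unfolding algebraic_over_def E_def polys_over_range[OF j]
    using m1w m10 map_poly_inj_hom[OF j, of m1 0] by auto
  define E' where "E' = field_hull (insert w E)"
  have E': "subfield_set E'" unfolding E'_def by (rule subfield_field_hull)
  note A' = subfield_set_imp_subring[OF E']
  have supE': "insert w E \<subseteq> E'" unfolding E'_def by (rule field_hull_superset)
  then have PE': "polys_over E \<subseteq> polys_over E'" by (intro polys_over_mono) auto
  obtain S where S: "finite S" "x \<in> S" "(\<Prod>b\<in>S. [:- b, 1:]) \<in> polys_over E"
    using x unfolding separable_over_def E_def by blast
  have xS: "poly (\<Prod>b\<in>S. [:- b, 1:]) x = 0" using S by (auto simp: poly_prod)
  have S0: "(\<Prod>b\<in>S. [:- b, 1:]) \<noteq> 0" using S by auto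
  have xalgE: "algebraic_over E x" unfolding algebraic_over_def using S xS S0 by blast
  then have xalg: "algebraic_over E' x" using supE' by (intro algebraic_over_mono[of E x E']) auto
  obtain g where g: "g \<in> polys_over E'" "lead_coeff g = 1" "poly g x = 0"
    and gdvd: "\<And>q. q \<in> polys_over E' \<Longrightarrow> poly q x = 0 \<Longrightarrow> \<exists>r\<in>polys_over E'. q = r * g"
    using min_poly_exists[OF E' xalg] by blast
  have gdvd': "g dvd q" if "q \<in> polys_over E'" "poly q x = 0" for q using gdvd[OF that] by auto
  have gprod: "g = (\<Prod>b\<in>{b. poly g b = 0}. [:- b, 1:])"
    using S PE' xS by (intro dvd_distinct_linear_product[OF S(1) g(2)] gdvd') auto
  obtain P where P: "P \<in> polys_over E" "y = poly P x"
    using y simple_algebraic_extension[OF E xalgE] unfolding E_def by blast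
  obtain Q R where QR: "Q \<in> polys_over E'" "R \<in> polys_over E'" "P = Q * g + R" "R = 0 \<or> degree R < degree g"
    using monic_division[OF A' g(1,2)] P(1) PE' by blast
  \<comment> \<open>Since \<open>P ^ p - w\<close> vanishes at \<open>x\<close>, it vanishes at
    every conjugate \<open>r\<close> of \<open>x\<close> over \<open>E' = E(y^p)\<close>. Taking
    \<open>p\<close>-th roots is unique in characteristic \<open>p\<close>, so \<open>P\<close>, and
    hence its remainder \<open>R\<close> modulo \<open>g\<close>, takes the value \<open>y\<close>
    at all of them. By its degree \<open>R\<close> is then the constant \<open>y\<close>.\<close>
  have Rr: "poly R r = y" if r: "poly g r = 0" for r
  proof -
    have "P ^ p - [:w:] \<in> polys_over E'"
    proof (rule polys_over_diff[OF A'])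
      have PP: "P \<in> polys_over E'" using P PE' by blast
      show "P ^ p \<in> polys_over E'"
        by (induction p) (auto simp: polys_over_1[OF A'] intro: polys_over_mult[OF A' PP])
      show "[:w:] \<in> polys_over E'" using supE' by (simp add: polys_over_pCons[OF A'] polys_over_0[OF A'])
    qed
    moreover have "poly (P ^ p - [:w:]) x = 0" using P by (simp add: w_def)
    ultimately obtain h where h: "P ^ p - [:w:] = g * h" using gdvd' by (metis dvdE)
    have "poly (P ^ p - [:w:]) r = 0" unfolding h using r by simp
    then have e: "poly P r ^ p = y ^ p" by (simp add: w_def)
    have chp: "CHAR('c) = p"
    proof (rule CHAR_eqI)
      have ofn: "j (of_nat n) = of_nat n" for n by (induction n) (simp_all add: jD)
      show "of_nat p = (0 :: 'c)" using ofn[of p] by (simp add: p_def jD)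
      fix n assume "of_nat n = (0 :: 'c)"
      then have "j (of_nat n) = 0" using ofn by simp
      then have "of_nat n = (0 :: 'a)" using ring_hom_on_nonzero[OF subfield_set_UNIV j] by auto
      then show "p dvd n" by (simp add: p_def of_nat_eq_0_iff_char_dvd)
    qed
    have "((poly P r - y) + y) ^ p = (poly P r - y) ^ p + y ^ p"
      by (rule freshmans_dream) (use p chp in auto)
    then have "(poly P r - y) ^ p = 0" using e by simp
    then have "poly P r = y" by simp
    then show ?thesis using QR(3) r by simp
  qed
  have "y \<in> E'"
  proof -
    have "(\<Prod>b\<in>{b. poly g b = 0}. [:- b, 1:]) dvd R - [:y:]"
    proof (rule prod_distinct_roots_dvd)
      have "g \<noteq> 0" using g by auto
      then show "finite {b. poly g b = 0}" by (rule poly_roots_finite)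
    qed (use Rr in auto)
    then have gR: "g dvd R - [:y:]" using gprod by simp
    have dg: "degree g > 0"
    proof (rule ccontr)
      assume "\<not> degree g > 0"
      then obtain a where "g = [:a:]" using degree_eq_zeroE by blast
      with g show False by simp
    qed
    have "R - [:y:] = 0"
    proof (rule ccontr)
      assume "R - [:y:] \<noteq> 0"
      then have "degree g \<le> degree (R - [:y:])" using gR by (intro dvd_imp_degree_le)
      moreover have "degree (R - [:y:]) \<le> degree R" by (rule degree_diff_le) auto
      ultimately show False using QR(4) dg by auto
    qed
    then have "y = coeff R 0" by simp
    then show ?thesis using polys_overD[OF QR(2)] by simp
  qed
  then obtain P2 where P2: "P2 \<in> polys_over E" "y = poly P2 w"
    unfolding E'_def simple_algebraic_extension[OF E walg] by blast
  then obtain p2 where p2': "P2 = map_poly j p2" unfolding E_def polys_over_range[OF j] by blast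
  define r where "r = p2 mod m1"
  have rw: "poly (map_poly j r) w = y"
  proof -
    have "p2 = p2 div m1 * m1 + r" by (simp add: r_def)
    then have "map_poly j p2 = map_poly j (p2 div m1) * map_poly j m1 + map_poly j r"
      using map_poly_hom_on_add[OF subring_set_UNIV j] map_poly_hom_on_mult[OF subring_set_UNIV j] by (metis UNIV_I polys_over_UNIV)
    then show ?thesis using P2(2) m1w p2' by simp
  qed
  \<comment> \<open>Written as \<open>r(y^p)\<close> with \<open>degree r < k\<close>, the element
    \<open>y\<close> is a root of \<open>r(X^p) - X\<close>. This is nonzero because
    \<open>p\<close> does not divide 1, and its degree is below \<open>d = p * k\<close>, against
    the minimality of \<open>m\<close>.\<close>
  define t where "t = pcompose r (monom 1 p) - [:0, 1:]"
  have "poly (map_poly j t) y = 0"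
    unfolding t_def
    by (simp add: map_poly_hom_on_diff[OF subring_set_UNIV j] map_poly_pcompose_hom[OF j] poly_pcompose
        map_poly_monom jD poly_monom rw map_poly_hom_on_pCons[OF subring_set_UNIV j] flip: w_def)
  then have "m dvd t" by (rule irreducible_dvd_of_common_root[OF j m])
  have dpc: "degree (pcompose r (monom 1 p)) = degree r * p" by (simp add: degree_pcompose degree_monom_eq)
  have "t \<noteq> 0"
  proof
    assume "t = 0"
    then have "pcompose r (monom 1 p) = [:0, 1:]" by (simp add: t_def)
    then have "degree r * p = 1" using dpc by simp
    then show False using p2 by simp
  qed
  then have "d \<le> degree t" using \<open>m dvd t\<close> unfolding d_def by (intro dvd_imp_degree_le)
  moreover have "degree t < d"
  proof -
    have "degree r < k" using degree_mod_less[OF m10, of p2] k0 unfolding r_def dm1 by auto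
    then have "degree r * p < d" using p0 by (simp add: k mult.commute)
    moreover have "1 < d" using p2 k0 by (simp add: k) (metis One_nat_def Suc_le_eq dual_order.trans less_eq_Suc_le mult_le_mono nat_mult_1_right numeral_2_eq_2)
    ultimately show ?thesis unfolding t_def by (intro degree_diff_less) (auto simp: dpc)
  qed
  ultimately show False by simp
qed

text \<open>A nonzero derivative has smaller degree than the irreducible \<open>m\<close>, so it
  shares no root with \<open>m\<close>; this gives the bound on root orders that
  \<open>separable_poly\<close> demands.\<close>

lemma simple_extension_separable:
  fixes x :: "'k::field alg_closure"
  assumes x: "separable_over (range to_ac) x" and F: "F = field_hull (insert x (range to_ac))"
  shows "separable_extension to_ac F"
  unfolding separable_extension_def
proof (intro conjI ballI)
  have ac: "ring_hom_on UNIV (to_ac :: 'k \<Rightarrow> _)" by (simp add: ring_hom_on_def)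
  have Fsf: "subfield_set F" unfolding F by (rule subfield_field_hull)
  show "intermediate_field to_ac F"
    unfolding intermediate_field_def
    using subfield_ring_of_type_algebraI[OF Fsf] field_hull_superset[of "insert x (range to_ac)"] F by auto
  fix y assume y: "y \<in> F"
  obtain p :: "'k poly" where "p \<noteq> 0" "poly (map_poly to_ac p) y = 0" using alg_closure_algebraic by blast
  then have "algebraic_over (range to_ac) y"
    unfolding algebraic_over_def polys_over_range[OF ac] using map_poly_inj_hom[OF ac, of p 0] by auto
  then obtain m where m: "irreducible m" "poly (map_poly to_ac m) y = 0" using hom_min_poly[OF ac] by blast
  have dm: "pderiv m \<noteq> 0" using separable_simple_extension[OF ac x _ m] y F by blast
  have dpos: "degree m > 0" using m(1) by (metis gr0I irreducible_def is_unit_iff_degree)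
  have M0: "map_poly to_ac m \<noteq> 0" using m map_poly_inj_hom[OF ac, of m 0] by auto
  have "order a (map_poly to_ac m) = 0 \<or> order a (map_poly to_ac m) = 1" for a
  proof (rule ccontr)
    assume "\<not> ?thesis"
    then have "order a (map_poly to_ac m) \<ge> 2" by linarith
    then have "[:- a, 1:] ^ 2 dvd map_poly to_ac m" using M0 by (simp add: order_divides)
    then obtain h where h: "map_poly to_ac m = [:- a, 1:] ^ 2 * h" by (elim dvdE)
    have "pderiv (map_poly to_ac m) = [:- a, 1:] * ([:- a, 1:] * pderiv h + 2 * h)"
      unfolding h power2_eq_square
      by (simp only: pderiv_mult) (simp add: pderiv_pCons algebra_simps del: mult_pCons_left mult_pCons_right)
    then have "poly (pderiv (map_poly to_ac m)) a = 0" by (simp only: poly_mult) simp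
    then have 1: "poly (map_poly to_ac (pderiv m)) a = 0" by (simp add: map_poly_pderiv_hom[OF ac])
    have 2: "poly (map_poly to_ac m) a = 0" unfolding h by simp
    have "m dvd pderiv m" by (rule irreducible_dvd_of_common_root[OF ac m(1) 2 1])
    then have "degree m \<le> degree (pderiv m)" using dm by (rule dvd_imp_degree_le)
    moreover have "degree (pderiv m) \<le> degree m - 1"
      by (rule degree_le) (auto simp: coeff_pderiv intro: coeff_eq_0)
    ultimately show False using dpos by simp
  qed
  then have "separable_poly m" unfolding separable_poly_def rsquarefree_def using M0 by blast
  with m show "\<exists>p. irreducible p \<and> poly (map_poly to_ac p) y = 0 \<and> separable_poly p" by blast
qed

section \<open>Diagonalization of quadratic forms\<close>

locale nondegenerate_form =
  fixes s :: "'k::field \<Rightarrow> 'v::ab_group_add \<Rightarrow> 'v" and Basis :: "'v set" and q :: "'v \<Rightarrow> 'k"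
  assumes fd: "finite_dimensional_vector_space s Basis"
    and two: "(2 :: 'k) \<noteq> 0"
    and quad: "quadratic_form s q" and nondeg: "nondegenerate q"
begin

sublocale V: finite_dimensional_vector_space s Basis by (rule fd)

abbreviation bil :: "'v \<Rightarrow> 'v \<Rightarrow> 'k" where "bil \<equiv> polar_form q"

lemma bil_commute: "bil u v = bil v u"
  by (simp add: polar_form_def add.commute)

lemma bil_add: "bil u (v + w) = bil u v + bil u w" and bil_scale: "bil u (s c v) = c * bil u v"
  using quad unfolding quadratic_form_def Vector_Spaces.linear_iff by blast+

lemma bil_0: "bil u 0 = 0"
  using bil_scale[of u 0 0] by simp

lemma bil_diff: "bil u (v - w) = bil u v - bil u w"
  using bil_add[of u "v - w" w] by simp

lemma bil_sum: "bil u (sum f I) = (\<Sum>i\<in>I. bil u (f i))"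
  by (induction I rule: infinite_finite_induct) (auto simp: bil_0 bil_add)

lemma bil_self: "bil u u = 2 * q u"
proof -
  have "u + u = s 2 u" using V.scale_left_distrib[of 1 1 u] by simp
  then have "q (u + u) = 2\<^sup>2 * q u" using quad unfolding quadratic_form_def by metis
  then show ?thesis by (simp add: polar_form_def power2_eq_square)
qed

definition orthogonal_family :: "nat \<Rightarrow> (nat \<Rightarrow> 'v) \<Rightarrow> bool" where
  "orthogonal_family r v \<longleftrightarrow> (\<forall>i<r. q (v i) \<noteq> 0) \<and> (\<forall>i<r. \<forall>k<r. i \<noteq> k \<longrightarrow> bil (v i) (v k) = 0)"

text \<open>The denominator is \<open>bil (v i) (v i)\<close>: the polar form takes the value
  \<open>2 * q u\<close> on the diagonal.\<close>

definition coord :: "(nat \<Rightarrow> 'v) \<Rightarrow> nat \<Rightarrow> 'v \<Rightarrow> 'k" where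
  "coord v i u = bil (v i) u / (2 * q (v i))"

lemma bil_combination:
  assumes "orthogonal_family r v" "k < r"
  shows "bil (v k) (\<Sum>i<r. s (c i) (v i)) = c k * (2 * q (v k))"
proof -
  have "bil (v k) (\<Sum>i<r. s (c i) (v i)) = (\<Sum>i<r. c i * bil (v k) (v i))"
    by (simp add: bil_sum bil_scale)
  also have "\<dots> = (\<Sum>i<r. if i = k then c k * bil (v k) (v k) else 0)"
    using assms by (intro sum.cong) (auto simp: orthogonal_family_def)
  also have "\<dots> = c k * bil (v k) (v k)" using assms(2) by simp
  finally show ?thesis by (simp add: bil_self)
qed

lemma coord_combination:
  assumes "orthogonal_family r v" "k < r"
  shows "coord v k (\<Sum>i<r. s (c i) (v i)) = c k"
  using assms two by (simp add: coord_def bil_combination orthogonal_family_def)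

lemma orthogonal_family_independent:
  assumes v: "orthogonal_family r v"
  shows "inj_on v {..<r}" "V.independent (v ` {..<r})"
proof -
  show inj: "inj_on v {..<r}"
  proof (rule inj_onI, rule ccontr)
    fix i k assume "i \<in> {..<r}" "k \<in> {..<r}" "v i = v k" "i \<noteq> k"
    then have "bil (v i) (v i) = 0" "q (v i) \<noteq> 0" using v by (auto simp: orthogonal_family_def)
    then show False using two by (simp add: bil_self)
  qed
  show "V.independent (v ` {..<r})"
  proof (rule V.independent_if_scalars_zero)
    fix f x assume f: "(\<Sum>x\<in>v ` {..<r}. s (f x) x) = 0" and "x \<in> v ` {..<r}"
    then obtain k where k: "k < r" "x = v k" by auto
    have "(\<Sum>i<r. s (f (v i)) (v i)) = 0" using f by (simp add: sum.reindex[OF inj])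
    then have "f (v k) = 0"
      using coord_combination[OF v k(1), of "\<lambda>i. f (v i)"] by (simp add: coord_def bil_0)
    then show "f x = 0" by (simp add: k)
  qed simp
qed

text \<open>Projecting a vector outside the span gives a nonzero vector orthogonal to the family,
  but \<open>q\<close> may vanish on it. Nondegeneracy supplies a partner, also projected, with
  nonzero polar value, and then \<open>q\<close> is nonzero on one of the two vectors or on their
  sum.\<close>

lemma orthogonal_family_extend:
  assumes v: "orthogonal_family r v" and r: "r < V.dim UNIV"
  obtains u where "orthogonal_family (Suc r) (v(r := u))"
proof -
  have "card (v ` {..<r}) = r" using card_image[OF orthogonal_family_independent(1)[OF v]] by simp
  then have "V.span (v ` {..<r}) \<noteq> UNIV"
    using r V.dim_le_card[of UNIV "v ` {..<r}"] by auto
  then obtain x where x: "x \<notin> V.span (v ` {..<r})" by blast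
  define proj where "proj u = u - (\<Sum>i<r. s (coord v i u) (v i))" for u
  have orth: "bil (v k) (proj u) = 0" if "k < r" for k u
    using bil_combination[OF v that, of "\<lambda>i. coord v i u"] that v two
    by (simp add: proj_def bil_diff coord_def orthogonal_family_def)
  have "proj x \<noteq> 0"
  proof
    assume "proj x = 0"
    then have "x = (\<Sum>i<r. s (coord v i x) (v i))" by (simp add: proj_def)
    moreover have "\<dots> \<in> V.span (v ` {..<r})"
      by (intro V.span_sum V.span_scale V.span_base) auto
    ultimately show False using x by simp
  qed
  then obtain w where w: "bil (proj x) w \<noteq> 0" using nondeg unfolding nondegenerate_def by blast
  have eqw: "bil (proj x) (proj w) = bil (proj x) w"
  proof -
    have "bil (proj x) (v i) = 0" if "i < r" for i using orth[OF that, of x] by (simp add: bil_commute)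
    then show ?thesis by (simp add: proj_def[of w] bil_diff bil_sum bil_scale)
  qed
  have "q (proj x + proj w) - q (proj x) - q (proj w) \<noteq> 0"
    using w unfolding eqw[symmetric] unfolding polar_form_def .
  then have "q (proj x) \<noteq> 0 \<or> q (proj w) \<noteq> 0 \<or> q (proj x + proj w) \<noteq> 0" by auto
  moreover have "bil (v k) (proj x + proj w) = 0" if "k < r" for k
    using orth[OF that] by (simp add: bil_add)
  ultimately obtain u where u: "q u \<noteq> 0" "\<And>k. k < r \<Longrightarrow> bil (v k) u = 0" using orth by blast
  have "orthogonal_family (Suc r) (v(r := u))"
    using v u bil_commute[of u] by (auto simp: orthogonal_family_def less_Suc_eq)
  then show thesis by (rule that)
qed

lemma orthogonal_basis_exists: "\<exists>v. orthogonal_family (V.dim UNIV) v"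
proof -
  have "r \<le> V.dim UNIV \<Longrightarrow> \<exists>v. orthogonal_family r v" for r
  proof (induction r)
    case 0
    show ?case by (simp add: orthogonal_family_def)
  next
    case (Suc r)
    then obtain v where "orthogonal_family r v" by auto
    then show ?case using orthogonal_family_extend[of r v] Suc.prems by (metis Suc_le_lessD)
  qed
  then show ?thesis by blast
qed

text \<open>The defect \<open>d\<close> is orthogonal to \<open>n\<close> independent, hence
  spanning, vectors, so it lies in the radical of the form.\<close>

lemma coord_expansion:
  assumes v: "orthogonal_family n v" and n: "n = V.dim UNIV"
  shows "u = (\<Sum>i<n. s (coord v i u) (v i))"
proof -
  define d where "d = u - (\<Sum>i<n. s (coord v i u) (v i))"
  have "card (v ` {..<n}) = n" using card_image[OF orthogonal_family_independent(1)[OF v]] by simp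
  then have span: "V.span (v ` {..<n}) = UNIV"
    using V.card_ge_dim_independent[of "v ` {..<n}" UNIV] orthogonal_family_independent(2)[OF v] n by auto
  have "bil (v k) d = 0" if "k < n" for k
    using bil_combination[OF v that, of "\<lambda>i. coord v i u"] that v two
    by (simp add: d_def bil_diff coord_def orthogonal_family_def)
  then have zero: "bil d (v k) = 0" if "k < n" for k using that by (simp add: bil_commute)
  have "V.subspace {w. bil d w = 0}"
    by (auto simp: V.subspace_def bil_0 bil_add bil_scale)
  then have "V.span (v ` {..<n}) \<subseteq> {w. bil d w = 0}"
    using zero by (intro V.span_minimal) auto
  then have "\<forall>w. bil d w = 0" using span by auto
  then have "d = 0" using nondeg unfolding nondegenerate_def by blast
  then show ?thesis by (simp add: d_def)
qed

lemma form_coord: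
  assumes v: "orthogonal_family n v" and n: "n = V.dim UNIV"
  shows "q u = (\<Sum>i<n. q (v i) * (coord v i u)\<^sup>2)"
proof -
  have "2 * q u = bil u (\<Sum>i<n. s (coord v i u) (v i))"
    using coord_expansion[OF v n, of u] by (simp add: bil_self)
  also have "\<dots> = (\<Sum>i<n. coord v i u * bil (v i) u)" by (simp add: bil_sum bil_scale bil_commute)
  also have "\<dots> = (\<Sum>i<n. 2 * (q (v i) * (coord v i u)\<^sup>2))"
  proof (rule sum.cong[OF refl])
    fix i assume "i \<in> {..<n}"
    then have "q (v i) \<noteq> 0" using v by (simp add: orthogonal_family_def)
    then have "bil (v i) u = coord v i u * (2 * q (v i))" using two by (simp add: coord_def)
    then show "coord v i u * bil (v i) u = 2 * (q (v i) * (coord v i u)\<^sup>2)" by (simp add: power2_eq_square)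
  qed
  finally have "2 * q u = 2 * (\<Sum>i<n. q (v i) * (coord v i u)\<^sup>2)" by (simp add: sum_distrib_left)
  then show ?thesis using two by simp
qed

lemma coord_linear: "coord v i (u + w) = coord v i u + coord v i w" "coord v i (s c u) = c * coord v i u"
  by (simp_all add: coord_def bil_add bil_scale add_divide_distrib)

end

section \<open>Trace forms of Jacobi polynomials\<close>

text \<open>The confluent form of the identity, with both arguments equal and multiplied through by
  \<open>h k\<close>. At a root of the polynomial of index \<open>k + 1\<close> the left side
  reduces to a single product.\<close>

lemma christoffel_darboux:
  fixes a b h :: "nat \<Rightarrow> 'w::field"
  assumes h: "\<And>k. h k \<noteq> 0" and b: "\<And>k. b k = h (Suc k) / h k"
  shows "poly (pderiv (jacobi a b (Suc k)) * jacobi a b k - pderiv (jacobi a b k) * jacobi a b (Suc k)) x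
    = (\<Sum>i\<le>k. h k / h i * (poly (jacobi a b i) x)\<^sup>2)"
proof (induction k)
  case 0
  then show ?case using h[of 0] by (simp add: pderiv_pCons pderiv_1)
next
  case (Suc k)
  define J where "J = jacobi a b"
  have p: "poly (pderiv (J (Suc (Suc k)))) x
      = poly (J (Suc k)) x + (x - a (Suc k)) * poly (pderiv (J (Suc k))) x - b k * poly (pderiv (J k)) x"
    by (simp add: J_def pencil_def pderiv_diff pderiv_mult pderiv_smult pderiv_pCons pderiv_add algebra_simps)
  have r: "poly (J (Suc (Suc k))) x = (x - a (Suc k)) * poly (J (Suc k)) x - b k * poly (J k) x"
    by (simp add: J_def poly_pencil)
  have "poly (pderiv (J (Suc (Suc k))) * J (Suc k) - pderiv (J (Suc k)) * J (Suc (Suc k))) x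
      = (poly (J (Suc k)) x)\<^sup>2 + b k * poly (pderiv (J (Suc k)) * J k - pderiv (J k) * J (Suc k)) x"
    by (simp add: p r power2_eq_square algebra_simps)
  also have "\<dots> = (poly (J (Suc k)) x)\<^sup>2 + b k * (\<Sum>i\<le>k. h k / h i * (poly (J i) x)\<^sup>2)"
    using Suc.IH by (simp add: J_def)
  also have "b k * (\<Sum>i\<le>k. h k / h i * (poly (J i) x)\<^sup>2) = (\<Sum>i\<le>k. h (Suc k) / h i * (poly (J i) x)\<^sup>2)"
    using h by (auto simp: sum_distrib_left b field_simps intro!: sum.cong)
  finally show ?case using h[of "Suc k"] by (simp add: J_def add.commute)
qed

lemma map_poly_jacobi:
  assumes j: "ring_hom_on UNIV (j :: 'a::field \<Rightarrow> 'w::field)"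
  shows "map_poly j (jacobi a b k) = jacobi (\<lambda>i. j (a i)) (\<lambda>i. j (b i)) k"
  by (induction a b k rule: jacobi.induct)
     (simp_all add: map_poly_pencil[OF subring_set_UNIV j] map_poly_hom_on_smult[OF subring_set_UNIV j]
       map_poly_hom_on_1[OF subring_set_UNIV j] map_poly_hom_on_pCons[OF subring_set_UNIV j]
       ring_hom_onD[OF subring_set_UNIV j])

lemma jacobi_span:
  fixes p :: "'a::field poly"
  assumes "p = 0 \<or> degree p < k"
  shows "\<exists>c. p = (\<Sum>i<k. smult (c i) (jacobi a b i))"
  using assms
proof (induction k arbitrary: p)
  case (Suc k)
  define c where "c = coeff p k"
  define p' where "p' = p - smult c (jacobi a b k)"
  have m: "degree (jacobi a b k) = k" "coeff (jacobi a b k) k = 1" using jacobi_monic[of a b k] by auto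
  have "degree p' \<le> k"
    unfolding p'_def using Suc.prems degree_smult_le[of c "jacobi a b k"] m by (intro degree_diff_le) auto
  moreover have "coeff p' k = 0" by (simp add: p'_def c_def m)
  ultimately have "p' = 0 \<or> degree p' < k"
    by (metis leading_coeff_0_iff order_le_less)
  then obtain c' where "p' = (\<Sum>i<k. smult (c' i) (jacobi a b i))" using Suc.IH by blast
  moreover have "p = p' + smult c (jacobi a b k)" by (simp add: p'_def)
  ultimately have "p = (\<Sum>i<k. smult (c' i) (jacobi a b i)) + smult c (jacobi a b k)" by simp
  also have "\<dots> = (\<Sum>i<Suc k. smult ((c'(k := c)) i) (jacobi a b i))" by simp
  finally show ?case by blast
qed simp

lemma jacobi_sum_degree:
  fixes c :: "nat \<Rightarrow> 'a::field"
  shows "(\<Sum>i<k. smult (c i) (jacobi a b i)) = 0 \<or> degree (\<Sum>i<k. smult (c i) (jacobi a b i)) < k"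
proof (cases k)
  case (Suc l)
  have "degree (\<Sum>i<k. smult (c i) (jacobi a b i)) \<le> l"
  proof (rule degree_sum_le)
    fix i assume "i \<in> {..<k}"
    then show "degree (smult (c i) (jacobi a b i)) \<le> l"
      using degree_smult_le[of "c i" "jacobi a b i"] jacobi_monic[of a b i] Suc by auto
  qed simp
  then show ?thesis by (simp add: Suc)
qed simp

lemma jacobi_independent:
  fixes c :: "nat \<Rightarrow> 'a::field"
  assumes "(\<Sum>i<k. smult (c i) (jacobi a b i)) = 0"
  shows "\<forall>i<k. c i = 0"
  using assms
proof (induction k)
  case (Suc k)
  have "coeff (\<Sum>i<k. smult (c i) (jacobi a b i)) k = 0"
    using jacobi_sum_degree[of c a b k] by (auto intro: coeff_eq_0)
  moreover have "coeff (jacobi a b k) k = 1" using jacobi_monic[of a b k] by auto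
  ultimately have ck: "c k = 0" using arg_cong[OF Suc.prems, of "\<lambda>p. coeff p k"] by simp
  with Suc show ?case by (auto simp: less_Suc_eq)
qed simp

text \<open>\<open>field_trace\<close> uses some unspecified basis \<open>B\<close>; the point is
  independence of this choice, shown like \<open>tr (P Q) = tr (Q P)\<close>: expand
  \<open>y * b\<close> through the \<open>e i\<close>, expand each \<open>e i\<close> through
  \<open>B\<close>, and exchange the sums.\<close>

lemma field_trace_coordinates:
  fixes j :: "'k::field \<Rightarrow> 'c::field" and e :: "nat \<Rightarrow> 'c"
  assumes j: "ring_hom_on UNIV j" and F: "subring_set F" "range j \<subseteq> F"
    and e: "\<And>i. i < n \<Longrightarrow> e i \<in> F"
    and d: "\<And>u. u \<in> F \<Longrightarrow> u = (\<Sum>i<n. j (d i u) * e i)"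
      "\<And>i u w. u \<in> F \<Longrightarrow> w \<in> F \<Longrightarrow> i < n \<Longrightarrow> d i (u + w) = d i u + d i w"
      "\<And>i u c. u \<in> F \<Longrightarrow> i < n \<Longrightarrow> d i (j c * u) = c * d i u"
    and y: "y \<in> F"
  shows "field_trace j F y = (\<Sum>i<n. d i (y * e i))"
proof -
  interpret V: vector_space "ext_scale j"
    by (rule vector_space_ext_scale) (simp add: field_embedding_iff_hom_on j)
  note FA = subring_setD[OF F(1)]
  have jF: "j c \<in> F" for c using F(2) by auto
  have sub: "V.subspace F" using FA jF by (auto simp: V.subspace_def ext_scale_def)
  obtain B0 where "B0 \<subseteq> F" "V.independent B0" "F \<subseteq> V.span B0" using V.basis_exists[of F] by metis
  then have "V.span B0 = F" using V.span_minimal[OF _ sub] by blast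
  define B where "B = (SOME B. \<not> V.dependent B \<and> V.span B = F)"
  have B: "V.independent B" "V.span B = F"
    using someI[of "\<lambda>B. \<not> V.dependent B \<and> V.span B = F" B0] \<open>V.independent B0\<close> \<open>V.span B0 = F\<close>
    unfolding B_def by auto
  have BF: "b \<in> F" if "b \<in> B" for b using V.span_base[OF that] B by simp
  \<comment> \<open>Finiteness matters because a sum over an infinite basis would be 0 by
    convention.\<close>
  have fin: "finite B"
  proof -
    have "B \<subseteq> V.span (e ` {..<n})"
    proof
      fix b assume "b \<in> B"
      then have "b = (\<Sum>i<n. ext_scale j (d i b) (e i))" using d(1)[OF BF] by (simp add: ext_scale_def)
      also have "\<dots> \<in> V.span (e ` {..<n})" by (intro V.span_sum V.span_scale V.span_base) auto
      finally show "b \<in> V.span (e ` {..<n})" .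
    qed
    then show ?thesis using V.independent_span_bound[OF _ B(1), of "e ` {..<n}"] by simp
  qed
  define rep where "rep = V.representation B"
  have rep_sum: "rep (\<Sum>i\<in>I. j (c i) * f i) b = (\<Sum>i\<in>I. c i * rep (f i) b)" if "\<And>i. i \<in> I \<Longrightarrow> f i \<in> F" for I :: "nat set" and c f b
  proof -
    have "rep (\<Sum>i\<in>I. ext_scale j (c i) (f i)) b = (\<Sum>i\<in>I. rep (ext_scale j (c i) (f i)) b)"
      unfolding rep_def using that B(2) V.span_scale by (subst V.representation_sum[OF B(1)]) auto
    also have "\<dots> = (\<Sum>i\<in>I. c i * rep (f i) b)"
      unfolding rep_def using that B(2) by (intro sum.cong refl) (simp add: V.representation_scale[OF B(1)])
    finally show ?thesis by (simp add: ext_scale_def)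
  qed
  have d_sum: "d i (\<Sum>b\<in>S. j (c b) * f b) = (\<Sum>b\<in>S. c b * d i (f b))"
    if "finite S" "\<And>b. b \<in> S \<Longrightarrow> f b \<in> F" "i < n" for S :: "'c set" and c f i
    using that
  proof (induction S rule: finite_induct)
    case empty
    have "d i (j 0 * 0) = 0 * d i 0" by (rule d(3)) (use FA that in auto)
    then show ?case by simp
  next
    case (insert b S)
    have "(\<Sum>b\<in>S. j (c b) * f b) \<in> F" using insert.prems jF FA by (intro subring_set_sum[OF F(1)]) auto
    then show ?case using insert FA jF by (simp add: d(2,3))
  qed
  have "field_trace j F y = (\<Sum>b\<in>B. rep (y * b) b)"
    unfolding field_trace_def B_def[symmetric] rep_def Let_def ..
  also have "\<dots> = (\<Sum>b\<in>B. \<Sum>i<n. d i (y * b) * rep (e i) b)"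
  proof (rule sum.cong[OF refl])
    fix b assume "b \<in> B"
    then have "y * b \<in> F" using BF y FA by auto
    then have "rep (y * b) b = rep (\<Sum>i<n. j (d i (y * b)) * e i) b" using d(1) by metis
    also have "\<dots> = (\<Sum>i<n. d i (y * b) * rep (e i) b)" using e by (intro rep_sum) auto
    finally show "rep (y * b) b = (\<Sum>i<n. d i (y * b) * rep (e i) b)" .
  qed
  also have "\<dots> = (\<Sum>i<n. \<Sum>b\<in>B. rep (e i) b * d i (y * b))"
    by (subst sum.swap) (simp add: mult.commute)
  also have "\<dots> = (\<Sum>i<n. d i (y * e i))"
  proof (rule sum.cong[OF refl])
    fix i assume i: "i \<in> {..<n}"
    have "(\<Sum>b\<in>B. ext_scale j (rep (e i) b) b) = e i"
      unfolding rep_def using e i B fin by (subst V.sum_representation_eq) auto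
    then have "y * e i = y * (\<Sum>b\<in>B. ext_scale j (rep (e i) b) b)" by simp
    also have "\<dots> = (\<Sum>b\<in>B. j (rep (e i) b) * (y * b))"
      by (simp add: ext_scale_def sum_distrib_left mult.left_commute)
    finally show "(\<Sum>b\<in>B. rep (e i) b * d i (y * b)) = d i (y * e i)"
      using d_sum[OF fin, of "\<lambda>b. y * b" i "rep (e i)"] BF y FA i by simp
  qed
  finally show ?thesis .
qed

text \<open>Let \<open>\<beta>\<close> be the diagonal form in the basis \<open>e\<close>.
  Multiplication by \<open>x\<close>, hence by every element of \<open>F\<close>, is self-adjoint.
  So the trace of \<open>y\<close> is the sum of \<open>\<beta> (y * e i) (e i) / h i\<close>, that
  is \<open>\<beta> y \<delta>\<close> with \<open>\<delta>\<close> the sum of the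
  \<open>(e i)^2 / h i\<close>. For \<open>\<alpha> = 1 / \<delta>\<close> the trace of
  \<open>\<alpha> * u^2\<close> becomes \<open>\<beta> (u^2) 1 = \<beta> u u\<close>.\<close>

theorem jacobi_trace_form:
  fixes a h :: "nat \<Rightarrow> 'k::field"
  assumes h: "\<And>k. h k \<noteq> 0" and b: "\<And>k. b k = h (Suc k) / h k"
    and n: "n \<ge> 2" and irr: "irreducible (jacobi a b n)"
    and x: "poly (map_poly to_ac (jacobi a b n)) x = 0"
    and simple: "poly (pderiv (map_poly to_ac (jacobi a b n))) x \<noteq> 0"
    and F: "F = field_hull (insert x (range to_ac))"
  obtains \<alpha> where "\<alpha> \<in> F" "\<alpha> \<noteq> 0"
    "bij_betw (\<lambda>c. \<Sum>i<n. to_ac (c i) * poly (map_poly to_ac (jacobi a b i)) x) ({..<n} \<rightarrow>\<^sub>E UNIV) F"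
    "\<forall>c. scaled_trace_form to_ac F \<alpha> (\<Sum>i<n. to_ac (c i) * poly (map_poly to_ac (jacobi a b i)) x)
      = (\<Sum>i<n. h i * (c i)\<^sup>2)"
proof -
  have ac: "ring_hom_on UNIV (to_ac :: 'k \<Rightarrow> _)" by (simp add: ring_hom_on_def)
  define f where "f = jacobi a b n"
  have df: "degree f = n" using jacobi_monic[of a b n] by (simp add: f_def)
  have f0: "f \<noteq> 0" using df n by auto
  have E: "subfield_set (range (to_ac :: 'k \<Rightarrow> _))" using subfield_range_hom[OF ac] by simp
  have xalg: "algebraic_over (range to_ac) x"
    unfolding algebraic_over_def polys_over_range[OF ac]
    using x f0 map_poly_inj_hom[OF ac, of f 0] by (auto simp: f_def)
  have Fx: "F = {poly (map_poly to_ac p) x |p. True}"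
    unfolding F simple_algebraic_extension[OF E xalg] polys_over_range[OF ac] by blast
  have Fsf: "subfield_set F" unfolding F by (rule subfield_field_hull)
  note FA = subfield_set_imp_subring[OF Fsf]
  have sup: "insert x (range to_ac) \<subseteq> F" unfolding F by (rule field_hull_superset)
  then have acF: "to_ac c \<in> F" and xF: "x \<in> F" for c by auto
  define e where "e i = poly (map_poly to_ac (jacobi a b i)) x" for i
  have eF: "e i \<in> F" for i unfolding Fx e_def by blast
  have e0: "e 0 = 1" by (simp add: e_def)
  have en: "e n = 0" using x by (simp add: e_def)
  define comb where "comb c = (\<Sum>i<n. to_ac (c i) * e i)" for c
  have comb_poly: "comb c = poly (map_poly to_ac (\<Sum>i<n. smult (c i) (jacobi a b i))) x" for c
  proof -
    have "map_poly to_ac (\<Sum>i\<in>I. smult (c i) (jacobi a b i)) = (\<Sum>i\<in>I. smult (to_ac (c i)) (map_poly to_ac (jacobi a b i)))"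
      if "finite I" for I
      using that
      by (induction I rule: finite_induct)
         (simp_all add: map_poly_hom_on_add[OF subring_set_UNIV ac] map_poly_hom_on_smult[OF subring_set_UNIV ac])
    then show ?thesis by (simp add: comb_def e_def poly_sum)
  qed
  \<comment> \<open>Being irreducible, \<open>f\<close> is the minimal polynomial of
    \<open>x\<close>, so no nonzero polynomial of degree below \<open>n\<close> vanishes
    there.\<close>
  have small: "p = 0" if p: "p = 0 \<or> degree p < n" "poly (map_poly to_ac p) x = 0" for p
  proof (rule ccontr)
    assume p0: "p \<noteq> 0"
    have "f dvd p" using irreducible_dvd_of_common_root[OF ac, of f x p] irr x p by (simp add: f_def)
    then have "n \<le> degree p" using p0 dvd_imp_degree_le df by metis
    then show False using p p0 by simp
  qed
  have uniq: "\<forall>i<n. c i = c' i" if "comb c = comb c'" for c c'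
  proof -
    have "comb (\<lambda>i. c i - c' i) = 0"
      using that by (simp add: comb_def algebra_simps sum_subtractf)
    then have "(\<Sum>i<n. smult (c i - c' i) (jacobi a b i)) = 0"
      unfolding comb_poly by (intro small jacobi_sum_degree)
    then show ?thesis using jacobi_independent[of "\<lambda>i. c i - c' i" a b n] by simp
  qed
  have "\<exists>c. u = comb c" if "u \<in> F" for u
  proof -
    obtain p where p: "u = poly (map_poly to_ac p) x" using \<open>u \<in> F\<close> unfolding Fx by blast
    define r where "r = p mod f"
    have "p = p div f * f + r" by (simp add: r_def)
    then have "map_poly to_ac p = map_poly to_ac (p div f) * map_poly to_ac f + map_poly to_ac r"
      using map_poly_hom_on_add[OF subring_set_UNIV ac] map_poly_hom_on_mult[OF subring_set_UNIV ac] by (metis UNIV_I polys_over_UNIV)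
    then have "u = poly (map_poly to_ac r) x" using p x by (simp add: f_def)
    moreover have "r = 0 \<or> degree r < n" using degree_mod_less[OF f0, of p] df by (simp add: r_def)
    then obtain c where "r = (\<Sum>i<n. smult (c i) (jacobi a b i))" using jacobi_span[of r n a b] by blast
    ultimately show ?thesis using comb_poly by metis
  qed
  then obtain D where D: "\<And>u. u \<in> F \<Longrightarrow> u = comb (D u)" by metis
  have combF: "comb c \<in> F" for c
    unfolding comb_def using acF eF by (intro subring_set_sum[OF FA] subring_setD[OF FA])
  have Dcomb: "D (comb c) i = c i" if "i < n" for c i
    using uniq[OF D[OF combF, of c, symmetric]] that by simp
  define d where "d i u = D u i" for i u
  have dcomb: "d i (comb c) = c i" if "i < n" for c i using Dcomb[OF that] by (simp add: d_def)
  have dexp: "u = (\<Sum>i<n. to_ac (d i u) * e i)" if "u \<in> F" for u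
    using D[OF that] by (simp add: comb_def d_def)
  have dadd: "d i (u + w) = d i u + d i w" if "u \<in> F" "w \<in> F" "i < n" for i u w
  proof -
    have "u + w = comb (\<lambda>i. d i u + d i w)"
      by (subst dexp[OF that(1)], subst dexp[OF that(2)]) (simp add: comb_def algebra_simps sum.distrib)
    then show ?thesis using dcomb[OF that(3), of "\<lambda>i. d i u + d i w"] by simp
  qed
  have dscale: "d i (to_ac c * u) = c * d i u" if "u \<in> F" "i < n" for i u c
  proof -
    have "to_ac c * u = comb (\<lambda>i. c * d i u)"
      by (subst dexp[OF that(1)]) (simp add: comb_def sum_distrib_left mult.assoc)
    then show ?thesis using dcomb[OF that(2), of "\<lambda>i. c * d i u"] by simp
  qed
  have dsum: "d i (\<Sum>k\<in>I. to_ac (c k) * w k) = (\<Sum>k\<in>I. c k * d i (w k))"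
    if "finite I" "\<And>k. k \<in> I \<Longrightarrow> w k \<in> F" "i < n" for I :: "nat set" and c w i
    using that
  proof (induction I rule: finite_induct)
    case empty
    have "d i (to_ac 0 * 0) = 0 * d i 0" by (rule dscale) (use subring_setD[OF FA] that in auto)
    then show ?case by simp
  next
    case (insert k I)
    have "(\<Sum>k\<in>I. to_ac (c k) * w k) \<in> F"
      using insert.prems acF by (intro subring_set_sum[OF FA] subring_setD[OF FA]) auto
    then show ?case using insert acF subring_setD[OF FA] by (simp add: dadd dscale)
  qed
  define \<beta> where "\<beta> u v = (\<Sum>i<n. h i * d i u * d i v)" for u v
  have \<beta>comm: "\<beta> u v = \<beta> v u" for u v by (simp add: \<beta>_def mult_ac)
  have de: "d i (e k) = (if i = k then 1 else 0)" if "i < n" "k < n" for i k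
  proof -
    have "e k = (\<Sum>i<n. if i = k then e k else 0)" using that by simp
    also have "\<dots> = comb (\<lambda>i. if i = k then 1 else 0)" unfolding comb_def by (intro sum.cong) auto
    finally show ?thesis using dcomb[OF that(1), of "\<lambda>i. if i = k then 1 else 0"] by simp
  qed
  have \<beta>e: "\<beta> u (e i) = h i * d i u" if "i < n" for u i
  proof -
    have "\<beta> u (e i) = (\<Sum>k<n. if k = i then h i * d i u else 0)"
      unfolding \<beta>_def using that by (intro sum.cong) (auto simp: de)
    then show ?thesis using that by simp
  qed
  \<comment> \<open>The matrix of multiplication by \<open>x\<close>: column \<open>i\<close>
    expresses \<open>x * e i\<close> through \<open>e (i + 1)\<close>, \<open>e i\<close> and
    \<open>e (i - 1)\<close>. In the last column the term \<open>e n\<close> falls away because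
    \<open>x\<close> is a root of the polynomial of index \<open>n\<close>.\<close>
  define M where "M k i = (if k = Suc i then 1 else if k = i then a i else if Suc k = i then b k else 0)" for k i
  have xe: "d k (x * e i) = M k i" if k: "k < n" and i: "i < n" for k i
  proof -
    have "x * e i = comb (\<lambda>k. M k i)"
    proof (cases i)
      case 0
      have "comb (\<lambda>k. M k i) = (\<Sum>k<n. (if k = 1 then e 1 else 0) + (if k = 0 then to_ac (a 0) * e 0 else 0))"
        unfolding comb_def by (intro sum.cong) (auto simp: M_def 0)
      also have "\<dots> = e 1 + to_ac (a 0) * e 0" using n by (simp add: sum.distrib)
      finally show ?thesis by (simp add: 0 e_def map_poly_hom_on_pCons[OF subring_set_UNIV ac])
    next
      case (Suc l)
      have "comb (\<lambda>k. M k i) = (\<Sum>k<n. (if k = Suc i then e (Suc i) else 0) + (if k = i then to_ac (a i) * e i else 0)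
          + (if k = l then to_ac (b l) * e l else 0))"
        unfolding comb_def by (intro sum.cong) (auto simp: M_def Suc)
      also have "\<dots> = e (Suc i) + to_ac (a i) * e i + to_ac (b l) * e l"
        using i en by (auto simp: sum.distrib Suc) (metis Suc_lessI Suc)
      also have "\<dots> = x * e i"
      proof -
        have "map_poly to_ac (jacobi a b (Suc i))
            = pencil (to_ac (a i)) (map_poly to_ac (jacobi a b i)) (smult (to_ac (b l)) (map_poly to_ac (jacobi a b l)))"
          by (simp add: Suc map_poly_pencil[OF subring_set_UNIV ac] map_poly_hom_on_smult[OF subring_set_UNIV ac])
        then have "e (Suc i) = (x - to_ac (a i)) * e i - to_ac (b l) * e l" by (simp add: e_def poly_pencil)
        then show ?thesis by (simp add: algebra_simps)
      qed
      finally show ?thesis by simp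
    qed
    then show ?thesis using dcomb[OF k, of "\<lambda>k. M k i"] by simp
  qed
  \<comment> \<open>Weighted by \<open>h\<close> the matrix is symmetric because
    \<open>b k = h (Suc k) / h k\<close>; this is where the form dictates the coefficients of the
    recurrence.\<close>
  have Msym: "h k * M k i = h i * M i k" for k i
    using h by (auto simp: M_def b)
  have \<beta>x: "\<beta> (x * u) v = \<beta> u (x * v)" if u: "u \<in> F" and v: "v \<in> F" for u v
  proof -
    have dx: "d k (x * w) = (\<Sum>i<n. d i w * M k i)" if w: "w \<in> F" and k: "k < n" for w k
    proof -
      have "x * w = (\<Sum>i<n. to_ac (d i w) * (x * e i))"
        by (subst dexp[OF w]) (simp add: sum_distrib_left mult.left_commute)
      then have "d k (x * w) = (\<Sum>i<n. d i w * d k (x * e i))"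
        using dsum[of "{..<n}" "\<lambda>i. x * e i" k "\<lambda>i. d i w"] k eF xF subring_setD[OF FA] by simp
      then show ?thesis using xe[OF k] by simp
    qed
    have "\<beta> (x * u) v = (\<Sum>k<n. \<Sum>i<n. h k * M k i * d i u * d k v)"
      unfolding \<beta>_def using dx[OF u] by (simp add: sum_distrib_left sum_distrib_right mult_ac)
    also have "\<dots> = (\<Sum>k<n. \<Sum>i<n. h i * M i k * d i u * d k v)"
      by (simp only: Msym)
    also have "\<dots> = (\<Sum>i<n. \<Sum>k<n. h i * M i k * d i u * d k v)" by (rule sum.swap)
    also have "\<dots> = \<beta> u (x * v)"
      unfolding \<beta>_def using dx[OF v] by (simp add: sum_distrib_left sum_distrib_right mult_ac)
    finally show ?thesis .
  qed
  have \<beta>add: "\<beta> (u + w) v = \<beta> u v + \<beta> w v" if "u \<in> F" "w \<in> F" for u v w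
    unfolding \<beta>_def using dadd[OF that] by (simp add: algebra_simps sum.distrib)
  have \<beta>scale: "\<beta> (to_ac c * u) v = c * \<beta> u v" if "u \<in> F" for u v c
    unfolding \<beta>_def using dscale[OF that] by (simp add: algebra_simps sum_distrib_left)
  have \<beta>mult: "\<beta> (y * u) v = \<beta> u (y * v)" if y: "y \<in> F" and u: "u \<in> F" and v: "v \<in> F" for y u v
  proof -
    obtain p where p: "y = poly (map_poly to_ac p) x" using y unfolding Fx by blast
    have "\<beta> (poly (map_poly to_ac p) x * u) v = \<beta> u (poly (map_poly to_ac p) x * v)"
      using u v
    proof (induction p arbitrary: u v)
      case 0
      have "\<beta> 0 v = 0" "\<beta> 0 u = 0" using \<beta>scale[OF 0(1), of 0 v] \<beta>scale[OF 0(2), of 0 u] by simp_all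
      then show ?case by (simp add: \<beta>comm[of u])
    next
      case (pCons c p)
      define P where "P = poly (map_poly to_ac p) x"
      have PF: "P \<in> F" unfolding P_def Fx by blast
      have eq: "poly (map_poly to_ac (pCons c p)) x * w = to_ac c * w + P * (x * w)" for w
        by (simp add: map_poly_hom_on_pCons[OF subring_set_UNIV ac] P_def algebra_simps)
      have mem: "w \<in> F \<Longrightarrow> to_ac c * w \<in> F" "w \<in> F \<Longrightarrow> P * (x * w) \<in> F" "w \<in> F \<Longrightarrow> x * w \<in> F" "w \<in> F \<Longrightarrow> P * w \<in> F" for w
        using PF xF acF subring_setD[OF FA] by auto
      have "\<beta> (poly (map_poly to_ac (pCons c p)) x * u) v = c * \<beta> u v + \<beta> (P * (x * u)) v"
        unfolding eq using pCons.prems mem by (simp add: \<beta>add \<beta>scale)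
      also have "\<beta> (P * (x * u)) v = \<beta> (x * u) (P * v)" using pCons.IH[of "x * u" v] pCons.prems mem by (simp add: P_def)
      also have "\<dots> = \<beta> u (x * (P * v))" using \<beta>x pCons.prems mem by simp
      also have "x * (P * v) = P * (x * v)" by (simp add: mult_ac)
      also have "c * \<beta> u v + \<beta> u (P * (x * v)) = \<beta> u (to_ac c * v + P * (x * v))"
        using pCons.prems mem \<beta>add[of "to_ac c * v" "P * (x * v)" u] \<beta>scale[of v c u] by (simp add: \<beta>comm[of u])
      finally show ?case unfolding eq .
    qed
    then show ?thesis by (simp add: p)
  qed
  \<comment> \<open>The element that represents the trace with respect to
    \<open>\<beta>\<close>.\<close>
  define \<delta> where "\<delta> = (\<Sum>i<n. to_ac (1 / h i) * (e i)\<^sup>2)"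
  have \<delta>F: "\<delta> \<in> F" unfolding \<delta>_def using acF eF by (intro subring_set_sum[OF FA] subring_setD[OF FA])
  have trace: "field_trace to_ac F y = \<beta> y \<delta>" if y: "y \<in> F" for y
  proof -
    have "field_trace to_ac F y = (\<Sum>i<n. d i (y * e i))"
      by (rule field_trace_coordinates[OF ac FA]) (use acF eF dexp dadd dscale y in auto)
    also have "\<dots> = (\<Sum>i<n. 1 / h i * \<beta> y (e i * e i))"
    proof (rule sum.cong[OF refl])
      fix i assume i: "i \<in> {..<n}"
      have "\<beta> y (e i * e i) = \<beta> (e i * y) (e i)" using \<beta>mult[OF eF y eF] by simp
      also have "\<dots> = h i * d i (y * e i)" using \<beta>e i by (simp add: mult.commute)
      finally show "d i (y * e i) = 1 / h i * \<beta> y (e i * e i)" using h by simp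
    qed
    also have "\<dots> = \<beta> y \<delta>"
    proof -
      have "\<beta> (\<Sum>i\<in>I. to_ac (1 / h i) * (e i)\<^sup>2) y = (\<Sum>i\<in>I. 1 / h i * \<beta> (e i * e i) y)" if "finite I" for I
        using that
      proof (induction I rule: finite_induct)
        case empty
        have "\<beta> (to_ac 0 * 1) y = 0 * \<beta> 1 y" by (rule \<beta>scale) (rule subring_setD[OF FA])
        then show ?case by simp
      next
        case (insert i I)
        have m: "e i * e i \<in> F" "to_ac (1 / h i) * (e i)\<^sup>2 \<in> F"
          by (intro subring_setD[OF FA] acF eF)+
        have "(\<Sum>i\<in>I. to_ac (1 / h i) * (e i)\<^sup>2) \<in> F" using acF eF by (intro subring_set_sum[OF FA] subring_setD[OF FA])
        then show ?case
          using insert m \<beta>add[OF m(2)] \<beta>scale[OF m(1), of "1 / h i" y] by (simp add: power2_eq_square)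
      qed
      then show ?thesis by (simp add: \<delta>_def \<beta>comm[of y])
    qed
    finally show ?thesis .
  qed
  \<comment> \<open>At \<open>x\<close> the Christoffel-Darboux identity equates a nonzero multiple
    of \<open>\<delta>\<close> with the product of the derivative, nonzero at a simple root, and the
    value of the polynomial of index \<open>n - 1\<close>, nonzero by its degree.\<close>
  have \<delta>0: "\<delta> \<noteq> 0"
  proof
    assume z: "\<delta> = 0"
    obtain l where l: "n = Suc l" using n by (cases n) auto
    define H where "H i = to_ac (h i)" for i
    define Ja where "Ja = jacobi (\<lambda>i. to_ac (a i)) (\<lambda>i. to_ac (b i))"
    have mapJ: "map_poly to_ac (jacobi a b i) = Ja i" for i unfolding Ja_def by (rule map_poly_jacobi[OF ac])
    have "poly (pderiv (Ja (Suc l)) * Ja l - pderiv (Ja l) * Ja (Suc l)) x = (\<Sum>i\<le>l. H l / H i * (poly (Ja i) x)\<^sup>2)"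
      unfolding Ja_def by (rule christoffel_darboux) (auto simp: H_def h b)
    also have "\<dots> = H l * \<delta>"
      unfolding \<delta>_def l lessThan_Suc_atMost sum_distrib_left
      by (intro sum.cong refl) (simp add: H_def e_def mapJ)
    finally have "poly (pderiv (Ja n)) x * poly (Ja l) x = 0"
      using z en by (simp add: l e_def mapJ)
    then have "poly (Ja l) x = 0" using simple mapJ[of n] by simp
    then have "jacobi a b l = 0" using small[of "jacobi a b l"] jacobi_monic[of a b l] l by (simp add: mapJ)
    then show False using jacobi_monic[of a b l] by simp
  qed
  define \<alpha> where "\<alpha> = inverse \<delta>"
  have \<alpha>F: "\<alpha> \<in> F" unfolding \<alpha>_def by (rule subfield_setD[OF Fsf \<delta>F])
  have \<alpha>0: "\<alpha> \<noteq> 0" using \<delta>0 by (simp add: \<alpha>_def)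
  show thesis
  proof (rule that[OF \<alpha>F \<alpha>0])
    show "bij_betw (\<lambda>c. \<Sum>i<n. to_ac (c i) * poly (map_poly to_ac (jacobi a b i)) x) ({..<n} \<rightarrow>\<^sub>E UNIV) F"
      unfolding e_def[symmetric] comb_def[symmetric] bij_betw_def
    proof
      show "inj_on comb ({..<n} \<rightarrow>\<^sub>E UNIV)"
      proof (rule inj_onI)
        fix c c' assume cc: "c \<in> {..<n} \<rightarrow>\<^sub>E UNIV" "c' \<in> {..<n} \<rightarrow>\<^sub>E (UNIV :: 'k set)" "comb c = comb c'"
        then show "c = c'" using uniq[OF cc(3)] by (intro PiE_ext[OF cc(1,2)]) auto
      qed
      show "comb ` ({..<n} \<rightarrow>\<^sub>E UNIV) = F"
      proof
        show "F \<subseteq> comb ` ({..<n} \<rightarrow>\<^sub>E UNIV)"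
        proof
          fix u assume "u \<in> F"
          then have "u = comb (restrict (D u) {..<n})" using D by (simp add: comb_def)
          then show "u \<in> comb ` ({..<n} \<rightarrow>\<^sub>E UNIV)" by (auto intro!: imageI)
        qed
      qed (use combF in auto)
    qed
    show "\<forall>c. scaled_trace_form to_ac F \<alpha> (\<Sum>i<n. to_ac (c i) * poly (map_poly to_ac (jacobi a b i)) x)
      = (\<Sum>i<n. h i * (c i)\<^sup>2)"
    proof
      fix c :: "nat \<Rightarrow> 'k"
      define u where "u = comb c"
      have u: "u \<in> F" unfolding u_def by (rule combF)
      have u2: "u * u \<in> F" "\<alpha> * (u * u) \<in> F" using u \<alpha>F subring_setD[OF FA] by auto
      have oneF: "1 \<in> F" by (rule subring_setD[OF FA])
      have "scaled_trace_form to_ac F \<alpha> u = \<beta> (\<alpha> * (u * u)) \<delta>"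
        unfolding scaled_trace_form_def power2_eq_square by (rule trace[OF u2(2)])
      also have "\<dots> = \<beta> (u * u) (\<alpha> * \<delta>)" by (rule \<beta>mult[OF \<alpha>F u2(1) \<delta>F])
      also have "\<alpha> * \<delta> = 1" using \<delta>0 by (simp add: \<alpha>_def)
      also have "\<beta> (u * u) 1 = \<beta> u u" using \<beta>mult[OF u u oneF] by simp
      also have "\<dots> = (\<Sum>i<n. h i * (c i)\<^sup>2)"
        unfolding \<beta>_def using dcomb[of _ c] by (intro sum.cong) (auto simp: u_def power2_eq_square)
      finally show "scaled_trace_form to_ac F \<alpha> (\<Sum>i<n. to_ac (c i) * poly (map_poly to_ac (jacobi a b i)) x)
        = (\<Sum>i<n. h i * (c i)\<^sup>2)" by (simp add: u_def comb_def e_def)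
    qed
  qed
qed

section \<open>From the diagonal form over \<open>K\<close> to the trace form\<close>

theorem theorem1:
  fixes \<iota> :: "'k0::field \<Rightarrow> 'k::field"
    and s :: "'k \<Rightarrow> 'v::ab_group_add \<Rightarrow> 'v"
    and Basis :: "'v set"
    and q :: "'v \<Rightarrow> 'k"
  assumes "hilbertian TYPE('k0)"
    and "CHAR('k0) \<noteq> 2"
    and "field_embedding \<iota>"
    and "prosolvable \<iota>"
    and "finite_dimensional_vector_space s Basis"
    and "vector_space.dim s (UNIV :: 'v set) > 4"
    and "quadratic_form s q"
    and "nondegenerate q"
  shows "isomorphic_to_scaled_trace_form s q"
proof -
  have \<iota>: "ring_hom_on UNIV \<iota>" using assms(3) by (simp add: field_embedding_iff_hom_on)
  note \<iota>D = ring_hom_onD[OF subring_set_UNIV \<iota>]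
  have ac: "ring_hom_on UNIV (to_ac :: 'k \<Rightarrow> _)" by (simp add: ring_hom_on_def)
  have sep: "separable_extension \<iota> UNIV" using assms(4) by (simp add: prosolvable_def)
  have inf: "infinite (UNIV :: 'k0 set)" by (rule hilbertian_infinite[OF assms(1)])
  \<comment> \<open>By injectivity of \<open>\<iota>\<close> the characteristic of
    \<open>K_0\<close> would divide 2, and characteristic 1 does not occur in a field.\<close>
  have two: "(2 :: 'k) \<noteq> 0"
  proof
    assume "(2 :: 'k) = 0"
    then have "\<iota> (1 + 1) = 0" unfolding \<iota>D(3)[OF UNIV_I UNIV_I] \<iota>D(2) by simp
    then have "of_nat 2 = (0 :: 'k0)" using ring_hom_on_nonzero[OF subfield_set_UNIV \<iota>, of "1 + 1"] by auto
    then have "CHAR('k0) dvd 2" by (simp only: of_nat_eq_0_iff_char_dvd)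
    then have "CHAR('k0) = 1 \<or> CHAR('k0) = 2" using two_is_prime_nat prime_nat_iff by blast
    then have "of_nat 1 = (0 :: 'k0)" using assms(2) of_nat_CHAR by metis
    then show False by simp
  qed
  interpret Q: nondegenerate_form s Basis q
    using assms(5,7,8) two by (simp add: nondegenerate_form_def)
  define n where "n = Q.V.dim UNIV"
  have n: "n \<ge> 5" using assms(6) by (simp add: n_def)
  obtain v where v: "Q.orthogonal_family n v" using Q.orthogonal_basis_exists unfolding n_def by blast
  \<comment> \<open>Padding with 1 beyond \<open>n\<close> makes all \<open>b k\<close> nonzero and
    gives the sequence \<open>b\<close> only finitely many values.\<close>
  define h where "h i = (if i < n then q (v i) else 1)" for i
  have h: "h i \<noteq> 0" for i using v by (simp add: h_def Q.orthogonal_family_def)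
  define b where "b k = h (Suc k) / h k" for k
  have b0: "b k \<noteq> 0" for k using h by (simp add: b_def)
  define j where "j = to_ac \<circ> \<iota>"
  have j: "ring_hom_on UNIV j" by (simp add: j_def ring_hom_on_def \<iota>D)
  have "finite (range b)"
  proof (rule finite_subset)
    show "range b \<subseteq> insert 1 (b ` {..<n})"
    proof
      fix y assume "y \<in> range b"
      then obtain k where "y = b k" by blast
      then show "y \<in> insert 1 (b ` {..<n})" by (cases "k < n") (auto simp: b_def h_def)
    qed
  qed simp
  then obtain \<omega> where \<omega>: "to_ac ` range b \<subseteq> field_hull (insert (to_ac \<omega>) (range (to_ac \<circ> \<iota>)))"
    using prosolvable_primitive_element[OF \<iota> sep inf] by blast
  \<comment> \<open>The field generated by \<open>C\<close> is \<open>L = K_0(\<omega>)\<close>, a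
    simple extension inside \<open>K\<close> that contains all \<open>b k\<close>.\<close>
  define C where "C = insert (to_ac \<omega>) (range j)"
  have bC: "to_ac (b k) \<in> field_hull C" for k using \<omega> unfolding C_def j_def by blast
  obtain p0 where p0: "irreducible p0" "poly (map_poly \<iota> p0) \<omega> = 0" "separable_poly p0"
    using sep unfolding separable_extension_def by blast
  have "map_poly j p0 = map_poly to_ac (map_poly \<iota> p0)"
    using map_poly_comp_hom[of to_ac \<iota> p0] \<iota>D(1) by (simp add: j_def comp_def)
  then have p0\<omega>: "poly (map_poly j p0) (to_ac \<omega>) = 0"
    using poly_map_poly_hom_on[OF subring_set_UNIV ac, of "map_poly \<iota> p0" \<omega>] p0(2) by simp
  have sep\<omega>: "separable_over (range j) (to_ac \<omega>)"
    by (rule separable_element_splits[OF j p0(1,3) p0\<omega>])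
  have alg: "D = UNIV" if D: "subfield_set D" "range j \<subseteq> D"
    "\<And>p x. p \<in> polys_over D \<Longrightarrow> p \<noteq> 0 \<Longrightarrow> poly p x = 0 \<Longrightarrow> x \<in> D" for D
    by (rule closure_algebraic_over_base[OF sep D(1) D(2)[unfolded j_def] D(3) \<iota>])
  have "\<exists>a z. full_symmetric C (jacobi (\<lambda>i. j (a i)) (\<lambda>k. to_ac (b k)) n) n z"
  proof (rule jacobi_full_symmetric[OF assms(1) j alg p0(1) p0\<omega> sep\<omega> C_def])
    show "to_ac (b k) \<noteq> 0" for k using b0 by simp
  qed (use bC n in auto)
  then obtain a z where full: "full_symmetric C (jacobi (\<lambda>i. j (a i)) (\<lambda>k. to_ac (b k)) n) n z" by blast
  define f where "f = jacobi (\<lambda>i. \<iota> (a i)) b n"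
  have mf: "map_poly to_ac f = jacobi (\<lambda>i. j (a i)) (\<lambda>k. to_ac (b k)) n"
    unfolding f_def map_poly_jacobi[OF ac] by (simp add: j_def)
  have full': "full_symmetric C (map_poly to_ac f) n z" unfolding mf by (rule full)
  have irr: "irreducible f"
    by (rule prosolvable_irreducible[OF \<iota> assms(4) inf n _ full']) (auto simp: C_def j_def)
  have fz: "map_poly to_ac f = (\<Prod>i<n. [:- z i, 1:])" and zinj: "inj_on z {..<n}"
    using full' unfolding full_symmetric_def by blast+
  define x where "x = z 0"
  define g where "g = (\<Prod>i\<in>{..<n} - {0}. [:- z i, 1:])"
  have fg: "map_poly to_ac f = [:- x, 1:] * g"
    unfolding fz g_def x_def using n by (intro prod.remove) auto
  have gx: "poly g x \<noteq> 0"
    using zinj n by (auto simp: g_def x_def poly_prod inj_on_def)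
  have x: "poly (map_poly to_ac f) x = 0" unfolding fg by simp
  have "pderiv (map_poly to_ac f) = [:- x, 1:] * pderiv g + g * 1"
    unfolding fg by (simp only: pderiv_mult) (simp add: pderiv_pCons)
  then have simple: "poly (pderiv (map_poly to_ac f)) x \<noteq> 0" using gx by simp
  have sepx: "separable_over (range to_ac) x"
  proof -
    have "(\<Prod>b\<in>z ` {..<n}. [:- b, 1:]) = map_poly to_ac f" unfolding fz by (simp add: prod.reindex[OF zinj])
    moreover have "map_poly to_ac f \<in> polys_over (range to_ac)" unfolding polys_over_range[OF ac] by blast
    ultimately show ?thesis
      unfolding separable_over_def x_def using n by (intro exI[of _ "z ` {..<n}"]) auto
  qed
  define F where "F = field_hull (insert x (range to_ac))"
  define e where "e i = poly (map_poly to_ac (jacobi (\<lambda>i. \<iota> (a i)) b i)) x" for i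
  have n2: "n \<ge> 2" using n by simp
  obtain \<alpha> where \<alpha>: "\<alpha> \<in> F" "\<alpha> \<noteq> 0"
    and bij: "bij_betw (\<lambda>c. \<Sum>i<n. to_ac (c i) * e i) ({..<n} \<rightarrow>\<^sub>E UNIV) F"
    and tr: "\<forall>c. scaled_trace_form to_ac F \<alpha> (\<Sum>i<n. to_ac (c i) * e i) = (\<Sum>i<n. h i * (c i)\<^sup>2)"
    unfolding e_def
    by (rule jacobi_trace_form[OF h b_def n2 irr[unfolded f_def] x[unfolded f_def] simple[unfolded f_def] F_def])
  have xalg: "algebraic_over (range to_ac) x"
  proof -
    have "f \<noteq> 0" using irr by auto
    then have "map_poly to_ac f \<noteq> 0" using map_poly_inj_hom[OF ac, of f 0] by auto
    then show ?thesis unfolding algebraic_over_def polys_over_range[OF ac] using x by blast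
  qed
  define \<phi> where "\<phi> u = (\<Sum>i<n. to_ac (Q.coord v i u) * e i)" for u
  have "Vector_Spaces.linear s (ext_scale to_ac) \<phi>"
    unfolding Vector_Spaces.linear_iff
  proof (intro conjI allI)
    show "vector_space s" by (rule Q.V.vector_space_axioms)
    show "vector_space (ext_scale to_ac)" by (rule vector_space_ext_scale[OF field_embedding_to_ac])
    show "\<phi> (u + w) = \<phi> u + \<phi> w" for u w
      by (simp add: \<phi>_def Q.coord_linear distrib_right sum.distrib)
    show "\<phi> (s c u) = ext_scale to_ac c (\<phi> u)" for c u
      by (simp add: \<phi>_def Q.coord_linear ext_scale_def sum_distrib_left mult.assoc)
  qed
  moreover have "bij_betw \<phi> UNIV F"
  proof -
    \<comment> \<open>Coordinates are taken as extensional functions on \<open>{..<n}\<close>, the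
      domain on which \<open>jacobi_trace_form\<close> provides its bijection onto
      \<open>F\<close>.\<close>
    have "bij_betw (\<lambda>u. \<lambda>i\<in>{..<n}. Q.coord v i u) UNIV ({..<n} \<rightarrow>\<^sub>E UNIV)"
    proof (rule bij_betwI[where g = "\<lambda>c. \<Sum>i<n. s (c i) (v i)"])
      show "(\<Sum>i<n. s ((\<lambda>i\<in>{..<n}. Q.coord v i u) i) (v i)) = u" for u
        using Q.coord_expansion[OF v n_def, of u] by simp
      show "(\<lambda>i\<in>{..<n}. Q.coord v i (\<Sum>i<n. s (c i) (v i))) = c" if "c \<in> {..<n} \<rightarrow>\<^sub>E UNIV" for c
        using that Q.coord_combination[OF v] by (intro PiE_ext[OF _ that]) auto
    qed auto
    then have "bij_betw ((\<lambda>c. \<Sum>i<n. to_ac (c i) * e i) \<circ> (\<lambda>u. \<lambda>i\<in>{..<n}. Q.coord v i u)) UNIV F"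
      using bij by (rule bij_betw_trans)
    moreover have "(\<lambda>c. \<Sum>i<n. to_ac (c i) * e i) \<circ> (\<lambda>u. \<lambda>i\<in>{..<n}. Q.coord v i u) = \<phi>"
      by (auto simp: \<phi>_def fun_eq_iff)
    ultimately show ?thesis by simp
  qed
  moreover have "scaled_trace_form to_ac F \<alpha> (\<phi> u) = q u" for u
    using tr[rule_format, of "\<lambda>i. Q.coord v i u"] Q.form_coord[OF v n_def, of u] by (simp add: \<phi>_def h_def)
  moreover have "finite_extension to_ac F" unfolding F_def by (rule simple_extension_finite[OF ac xalg])
  moreover have "separable_extension to_ac F" by (rule simple_extension_separable[OF sepx F_def])
  ultimately show ?thesis unfolding isomorphic_to_scaled_trace_form_def using \<alpha> by blast
qed

end
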